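(* The problem \textsc{Labelled Undirected Token Moving} (LUTM) is W[1]-hard when parameterized by $\ell+f$, where $f=|V(G)|-|S\cup T|$.
   Context: Tokens sit on vertices of an undirected graph $G$. A labelled configuration is a sequence $(v_1,\dots,v_k)$ of distinct vertices, meaning the token with label $i$ is on $v_i$; we also write $S$ for its set of vertices. A move is a pair $(s,t)$; executing it moves the token on $s$, with its label, to $t$. A vertex is free if it carries no token; a path is free if all its intermediate vertices are free. A move $(s,t)$ in a sequence is valid if, after executing the preceding moves, there is a token on $s$, $t$ is free, and there is a free path from $s$ to $t$. A transforming sequence from $S$ to $T$ is a sequence of valid moves whose execution from $S$ puts every labelled token on the vertex prescribed for its label by $T$. LUTM: given an undirected graph $G$, labelled configurations $S,T$ with $|S|=|T|=k$, and an integer $\ell$, decide whether there is a transforming sequence from $S$ to $T$ of length at most $\ell$. *)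

theory Defs
  imports Main
begin

section \<open>Model of computation\<close>

text \<open>
  Inputs and outputs are binary trees, and algorithms are programs of the WHILE language over
  binary trees (Jones, ``Computability and Complexity from a Programming Perspective'').  Every
  elementary operation is charged the size of the trees it touches, so that repeatedly pairing a
  tree with itself is not cheap.  With this cost measure WHILE programs and multitape Turing
  machines simulate each other with polynomial overhead.
\<close>

datatype data = Leaf | Node data data

fun dsize :: "data \<Rightarrow> nat" where
  "dsize Leaf = 1"
| "dsize (Node a b) = 1 + dsize a + dsize b"

datatype com =
    Clear nat
  | Copy nat nat
  | MkNode nat nat nat
  | Left nat nat
  | Right nat nat
  | Seq com com
  | Cond nat com com
  | While nat com

type_synonym store = "nat \<Rightarrow> data"

fun left :: "data \<Rightarrow> data" where
  "left Leaf = Leaf"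
| "left (Node a b) = a"

fun right :: "data \<Rightarrow> data" where
  "right Leaf = Leaf"
| "right (Node a b) = b"

text \<open>
  \<open>exec c s t s'\<close>: started in store \<open>s\<close>, the program \<open>c\<close> halts in store \<open>s'\<close> after \<open>t\<close> time units.
  In assignments the first register is the target; \<open>Leaf\<close> plays the role of false.
\<close>

inductive exec :: "com \<Rightarrow> store \<Rightarrow> nat \<Rightarrow> store \<Rightarrow> bool" where
  Clear: "exec (Clear x) s 1 (s(x := Leaf))"
| Copy: "exec (Copy x y) s (1 + dsize (s y)) (s(x := s y))"
| MkNode: "exec (MkNode x y z) s (1 + dsize (s y) + dsize (s z)) (s(x := Node (s y) (s z)))"
| Left: "exec (Left x y) s (1 + dsize (s y)) (s(x := left (s y)))"
| Right: "exec (Right x y) s (1 + dsize (s y)) (s(x := right (s y)))"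
| Seq: "exec c1 s1 t1 s2 \<Longrightarrow> exec c2 s2 t2 s3 \<Longrightarrow> exec (Seq c1 c2) s1 (t1 + t2) s3"
| CondTrue: "s x \<noteq> Leaf \<Longrightarrow> exec c1 s t s' \<Longrightarrow> exec (Cond x c1 c2) s (1 + t) s'"
| CondFalse: "s x = Leaf \<Longrightarrow> exec c2 s t s' \<Longrightarrow> exec (Cond x c1 c2) s (1 + t) s'"
| WhileFalse: "s x = Leaf \<Longrightarrow> exec (While x c) s 1 s"
| WhileTrue: "s1 x \<noteq> Leaf \<Longrightarrow> exec c s1 t1 s2 \<Longrightarrow> exec (While x c) s2 t2 s3
    \<Longrightarrow> exec (While x c) s1 (1 + t1 + t2) s3"

text \<open>Input and output are passed in register 0; all other registers initially hold \<open>Leaf\<close>.\<close>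

definition computes_in :: "com \<Rightarrow> data \<Rightarrow> data \<Rightarrow> nat \<Rightarrow> bool" where
  "computes_in p inp out t \<longleftrightarrow> (\<exists>s. exec p ((\<lambda>_. Leaf)(0 := inp)) t s \<and> s 0 = out)"

text \<open>
  Numbers are encoded in unary.  In the two problems below all numbers are positions or vertices,
  which are smaller than the instance, or are bounded by the parameter, so this does not affect
  fixed-parameter reducibility.
\<close>

fun enc_nat :: "nat \<Rightarrow> data" where
  "enc_nat 0 = Leaf"
| "enc_nat (Suc n) = Node Leaf (enc_nat n)"

fun enc_list :: "('a \<Rightarrow> data) \<Rightarrow> 'a list \<Rightarrow> data" where
  "enc_list e [] = Leaf"
| "enc_list e (x # xs) = Node (e x) (enc_list e xs)"

fun enc_prod :: "('a \<Rightarrow> data) \<Rightarrow> ('b \<Rightarrow> data) \<Rightarrow> 'a \<times> 'b \<Rightarrow> data" where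
  "enc_prod e1 e2 (a, b) = Node (e1 a) (e2 b)"

definition computable_nat :: "(nat \<Rightarrow> nat) \<Rightarrow> bool" where
  "computable_nat f \<longleftrightarrow> (\<exists>p. \<forall>n. \<exists>t. computes_in p (enc_nat n) (enc_nat (f n)) t)"


section \<open>Parameterized problems and the W-hierarchy\<close>

text \<open>A parameterized problem is a set of pairs (instance, parameter).\<close>

type_synonym param_problem = "(data \<times> nat) set"

definition fpt_reducible :: "param_problem \<Rightarrow> param_problem \<Rightarrow> bool" where
  "fpt_reducible A B \<longleftrightarrow>
    (\<exists>p f g c. computable_nat f \<and> computable_nat g \<and>
      (\<forall>x k. \<exists>x' k' t.
        computes_in p (Node x (enc_nat k)) (Node x' (enc_nat k')) t \<and>
        t \<le> f k * dsize x ^ c \<and>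
        k' \<le> g k \<and>
        ((x, k) \<in> A \<longleftrightarrow> (x', k') \<in> B)))"

text \<open>
  Boolean circuits are given by the list of their nodes in topological order; nodes are referred
  to by their position in the list, and the last node is the output.
\<close>

datatype gate = Input | Neg nat | And "nat list" | Or "nat list"

type_synonym circuit = "gate list"

fun gate_args :: "gate \<Rightarrow> nat list" where
  "gate_args Input = []"
| "gate_args (Neg j) = [j]"
| "gate_args (And js) = js"
| "gate_args (Or js) = js"

definition wf_circuit :: "circuit \<Rightarrow> bool" where
  "wf_circuit C \<longleftrightarrow> C \<noteq> [] \<and>
    (\<forall>i < length C.
      distinct (gate_args (C ! i)) \<and>
      (\<forall>j \<in> set (gate_args (C ! i)). j < i) \<and>
      (C ! i \<noteq> Input \<longrightarrow> gate_args (C ! i) \<noteq> []))"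

definition circuit_path :: "circuit \<Rightarrow> nat list \<Rightarrow> bool" where
  "circuit_path C p \<longleftrightarrow> p \<noteq> [] \<and> set p \<subseteq> {..<length C} \<and>
    C ! hd p = Input \<and> last p = length C - 1 \<and>
    successively (\<lambda>i j. i \<in> set (gate_args (C ! j))) p"

definition depth_at_most :: "nat \<Rightarrow> circuit \<Rightarrow> bool" where
  "depth_at_most d C \<longleftrightarrow> (\<forall>p. circuit_path C p \<longrightarrow> length p - 1 \<le> d)"

definition large :: "gate \<Rightarrow> bool" where
  "large g \<longleftrightarrow> length (gate_args g) > 2"

definition weft_at_most :: "nat \<Rightarrow> circuit \<Rightarrow> bool" where
  "weft_at_most t C \<longleftrightarrow>
    (\<forall>p. circuit_path C p \<longrightarrow> length (filter (\<lambda>i. large (C ! i)) p) \<le> t)"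

text \<open>
  In a well-formed circuit a valuation of the nodes is determined by its values on the input
  nodes, that is, by the assignment; the weight counts the input nodes that are set to true.
\<close>

definition circuit_valuation :: "circuit \<Rightarrow> (nat \<Rightarrow> bool) \<Rightarrow> bool" where
  "circuit_valuation C v \<longleftrightarrow>
    (\<forall>i < length C. case C ! i of
        Input \<Rightarrow> True
      | Neg j \<Rightarrow> v i \<longleftrightarrow> \<not> v j
      | And js \<Rightarrow> v i \<longleftrightarrow> (\<forall>j \<in> set js. v j)
      | Or js \<Rightarrow> v i \<longleftrightarrow> (\<exists>j \<in> set js. v j))"

definition weighted_satisfiable :: "circuit \<Rightarrow> nat \<Rightarrow> bool" where
  "weighted_satisfiable C k \<longleftrightarrow>
    (\<exists>v. circuit_valuation C v \<and> v (length C - 1) \<and>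
      card {i. i < length C \<and> C ! i = Input \<and> v i} = k)"

fun enc_gate :: "gate \<Rightarrow> data" where
  "enc_gate Input = Node (enc_nat 0) Leaf"
| "enc_gate (Neg j) = Node (enc_nat 1) (enc_nat j)"
| "enc_gate (And js) = Node (enc_nat 2) (enc_list enc_nat js)"
| "enc_gate (Or js) = Node (enc_nat 3) (enc_list enc_nat js)"

definition weighted_circuit_sat :: "nat \<Rightarrow> nat \<Rightarrow> param_problem" where
  "weighted_circuit_sat t d =
    {(enc_list enc_gate C, k) | C k.
      wf_circuit C \<and> weft_at_most t C \<and> depth_at_most d C \<and> weighted_satisfiable C k}"

definition W_class :: "nat \<Rightarrow> param_problem set" where
  "W_class t = {A. \<exists>d \<ge> 1. fpt_reducible A (weighted_circuit_sat t d)}"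

definition W_hard :: "nat \<Rightarrow> param_problem \<Rightarrow> bool" where
  "W_hard t B \<longleftrightarrow> (\<forall>A \<in> W_class t. fpt_reducible A B)"


section \<open>Labelled undirected token moving\<close>

text \<open>
  A graph is given by its vertex set and its set of edges, which are two-element vertex sets.
  In a configuration the entry at position \<open>i\<close> is the vertex carrying the token with label \<open>i\<close>.
\<close>

definition ugraph :: "'a set \<Rightarrow> 'a set set \<Rightarrow> bool" where
  "ugraph V E \<longleftrightarrow> finite V \<and> (\<forall>e \<in> E. e \<subseteq> V \<and> card e = 2)"

type_synonym 'a config = "'a list"
type_synonym 'a move = "'a \<times> 'a"

definition configuration :: "'a set \<Rightarrow> 'a config \<Rightarrow> bool" where
  "configuration V c \<longleftrightarrow> distinct c \<and> set c \<subseteq> V"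

definition path_between :: "'a set \<Rightarrow> 'a set set \<Rightarrow> 'a \<Rightarrow> 'a list \<Rightarrow> 'a \<Rightarrow> bool" where
  "path_between V E s p t \<longleftrightarrow> p \<noteq> [] \<and> hd p = s \<and> last p = t \<and> set p \<subseteq> V \<and> distinct p \<and>
    successively (\<lambda>u v. {u, v} \<in> E) p"

definition free_path :: "'a set \<Rightarrow> 'a set set \<Rightarrow> 'a config \<Rightarrow> 'a \<Rightarrow> 'a list \<Rightarrow> 'a \<Rightarrow> bool" where
  "free_path V E c s p t \<longleftrightarrow> path_between V E s p t \<and> set (butlast (tl p)) \<inter> set c = {}"

definition valid_move :: "'a set \<Rightarrow> 'a set set \<Rightarrow> 'a config \<Rightarrow> 'a move \<Rightarrow> bool" where
  "valid_move V E c = (\<lambda>(s, t). s \<in> set c \<and> t \<in> V - set c \<and> (\<exists>p. free_path V E c s p t))"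

definition execute_move :: "'a config \<Rightarrow> 'a move \<Rightarrow> 'a config" where
  "execute_move c = (\<lambda>(s, t). map (\<lambda>v. if v = s then t else v) c)"

fun valid_sequence :: "'a set \<Rightarrow> 'a set set \<Rightarrow> 'a config \<Rightarrow> 'a move list \<Rightarrow> bool" where
  "valid_sequence V E c [] \<longleftrightarrow> True"
| "valid_sequence V E c (m # ms) \<longleftrightarrow>
    valid_move V E c m \<and> valid_sequence V E (execute_move c m) ms"

definition transforming_sequence ::
    "'a set \<Rightarrow> 'a set set \<Rightarrow> 'a config \<Rightarrow> 'a config \<Rightarrow> 'a move list \<Rightarrow> bool" where
  "transforming_sequence V E S T ms \<longleftrightarrow>
    valid_sequence V E S ms \<and> foldl execute_move S ms = T"

text \<open>
  An instance \<open>(n, es, S, T, l)\<close> describes the graph with vertices \<open>0, ..., n - 1\<close> and edge list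
  \<open>es\<close>, the two configurations and the bound on the number of moves.
\<close>

type_synonym lutm_instance = "nat \<times> (nat \<times> nat) list \<times> nat config \<times> nat config \<times> nat"

definition edges_of :: "(nat \<times> nat) list \<Rightarrow> nat set set" where
  "edges_of es = (\<lambda>(u, v). {u, v}) ` set es"

fun lutm_wf :: "lutm_instance \<Rightarrow> bool" where
  "lutm_wf (n, es, S, T, l) \<longleftrightarrow>
    ugraph {..<n} (edges_of es) \<and> configuration {..<n} S \<and> configuration {..<n} T \<and>
    length S = length T"

fun lutm_yes :: "lutm_instance \<Rightarrow> bool" where
  "lutm_yes (n, es, S, T, l) \<longleftrightarrow>
    (\<exists>ms. transforming_sequence {..<n} (edges_of es) S T ms \<and> length ms \<le> l)"

fun lutm_param :: "lutm_instance \<Rightarrow> nat" where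
  "lutm_param (n, es, S, T, l) = l + (card {..<n} - card (set S \<union> set T))"

definition enc_lutm :: "lutm_instance \<Rightarrow> data" where
  "enc_lutm =
    enc_prod enc_nat (enc_prod (enc_list (enc_prod enc_nat enc_nat))
      (enc_prod (enc_list enc_nat) (enc_prod (enc_list enc_nat) enc_nat)))"

definition LUTM :: param_problem where
  "LUTM = {(enc_lutm I, lutm_param I) | I. lutm_wf I \<and> lutm_yes I}"

end

theory Submission
  imports Defs
begin

text \<open>
  Weighted satisfiability of circuits of weft one is reduced to multicoloured clique, and that to
  token moving.

  In weft one the value of the output under a given assignment is certified by at most
  \<open>q = 2 ^ d\<close> inputs, if large gates treat unknown arguments as neutral: then a partial assignment
  can err only by missing an input of the certificate.  An assignment of weight \<open>k\<close> is described by
  the \<open>k + 1\<close> gaps between consecutive true inputs.  For every \<open>q\<close>-tuple of gap indices a clique has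
  to select positions of these gaps, and of \<open>q\<close> more, under which the output evaluates to true; edges
  enforce that all selected gaps agree.  If the resulting assignment made the output false, the
  tuple of the gaps that contain its certificate would show it.

  In the token moving instance the only free vertices are \<open>m + 3\<close> hubs, adjacent to all vertices of
  the \<open>m\<close>-coloured graph.  Every pair of colours has a test, in which two tokens have to be exchanged: one at
  the far end of a path of length \<open>m\<close> that leads to the first colour, the other on a vertex adjacent to
  the second colour.  The bound on the number of moves forces that only one vertex of every colour is
  ever opened and that one of the two tokens makes only a single move.  During that move the free
  vertices are exactly its target, the \<open>m\<close> other vertices of the path and the two opened vertices of
  the colours of the test, which are therefore adjacent.
\<close>

section \<open>Polynomial-time functions\<close>

text \<open>Hubs are adjacent to every colour, so a token could pass from colour \<open>i\<close> to
  colour \<open>j\<close> over a hub or a third opened vertex even if the two opened vertices are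
  not adjacent. The length of the path prevents this: always m + 3 vertices are free, a direct move
  between the ends of a test needs m + 1 of them as its target and the rest of the path, and the
  last two must have the colours \<open>i\<close> and \<open>j\<close>. In the other direction, m
  path tokens and one exchanged token have to be parked, and for distinct colours m + 1 places are
  available: 3 hubs and m - 2 opened vertices of other colours, adjacent to both vertices in use
  because of the clique. W[1] is defined here by circuits of weft one and any constant depth, with
  no normal form such as bounded clauses; certificates take the place of a normalization. They may
  contain false inputs, and a gap settles all the inputs it spans, so a bounded number of gaps is
  enough. There are m = (k + 1) ^ q colours, one per tuple, and q is constant for fixed d; so the
  new parameter, a polynomial in m, depends on k alone.\<close>

class repr =
  fixes repr :: "'a \<Rightarrow> data"
  assumes repr_inj: "repr x = repr y \<Longrightarrow> x = y"

abbreviation sz :: "'a::repr \<Rightarrow> nat" where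
  "sz x \<equiv> dsize (repr x)"

lemma enc_nat_inj: "enc_nat m = enc_nat n \<Longrightarrow> m = n"
proof (induction m arbitrary: n)
  case 0
  then show ?case by (cases n) auto
next
  case (Suc m)
  then show ?case by (cases n) auto
qed

lemma enc_list_inj:
  assumes "\<And>x y. e x = e y \<Longrightarrow> x = y"
  shows "enc_list e xs = enc_list e ys \<Longrightarrow> xs = ys"
proof (induction xs arbitrary: ys)
  case Nil
  then show ?case by (cases ys) auto
next
  case (Cons x xs)
  then show ?case using assms by (cases ys) auto
qed

instantiation data :: repr
begin
definition repr_data :: "data \<Rightarrow> data" where "repr_data x = x"
instance by standard (simp add: repr_data_def)
end

instantiation unit :: repr
begin
definition repr_unit :: "unit \<Rightarrow> data" where "repr_unit x = Leaf"
instance by standard simp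
end

instantiation bool :: repr
begin
definition repr_bool :: "bool \<Rightarrow> data" where "repr_bool b = (if b then Node Leaf Leaf else Leaf)"
instance by standard (auto simp: repr_bool_def split: if_splits)
end

text \<open>Numbers, and below lists, pairs and gates, reuse the encodings of the problem
  definitions. The typed functions of the reduction therefore act on exactly the trees that
  \<open>weighted_circuit_sat\<close> and \<open>LUTM\<close> speak of.\<close>

instantiation nat :: repr
begin
definition repr_nat :: "nat \<Rightarrow> data" where "repr_nat = enc_nat"
instance by standard (simp add: repr_nat_def enc_nat_inj)
end

instantiation list :: (repr) repr
begin
definition repr_list :: "'a list \<Rightarrow> data" where "repr_list = enc_list repr"
instance by standard (use enc_list_inj[of repr] repr_inj in \<open>auto simp: repr_list_def\<close>)
end

instantiation prod :: (repr, repr) repr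
begin
definition repr_prod :: "'a \<times> 'b \<Rightarrow> data" where "repr_prod = enc_prod repr repr"
instance by standard (auto simp: repr_prod_def dest: repr_inj)
end

instantiation gate :: repr
begin
definition repr_gate :: "gate \<Rightarrow> data" where "repr_gate = enc_gate"
instance
proof
  fix x y :: gate
  have [simp]: "enc_nat 2 = Node Leaf (Node Leaf Leaf)"
      "enc_nat 3 = Node Leaf (Node Leaf (Node Leaf Leaf))"
    by (simp_all add: numeral_eq_Suc)
  assume "repr x = repr y"
  then show "x = y"
    using enc_list_inj[of enc_nat, OF enc_nat_inj] enc_nat_inj
    by (cases x; cases y) (auto simp: repr_gate_def)
qed
end

lemma repr_simps [simp]:
  "repr (0 :: nat) = Leaf" "repr (Suc n) = Node Leaf (repr n)"
  "repr ([] :: 'a::repr list) = Leaf" "repr ((x :: 'a) # xs) = Node (repr x) (repr xs)"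
  "repr (a :: 'a, b :: 'b::repr) = Node (repr a) (repr b)"
  "repr () = Leaf" "repr True = Node Leaf Leaf" "repr False = Leaf"
  "repr (d :: data) = d"
  by (simp_all add: repr_nat_def repr_list_def repr_prod_def repr_unit_def repr_bool_def
      repr_data_def)

lemma dsize_pos [simp]: "0 < dsize x" "Suc 0 \<le> dsize x" "dsize x \<noteq> 0"
  by (cases x; simp)+

lemma sz_nat: "sz (n :: nat) = 2 * n + 1"
  by (induction n) auto

lemma length_le_sz: "length xs \<le> sz xs"
  by (induction xs) auto

lemma sz_mem: "x \<in> set xs \<Longrightarrow> sz x \<le> sz xs"
  by (induction xs) auto

lemma sz_append: "sz (xs @ ys) + 1 = sz xs + sz ys"
  by (induction xs) auto

text \<open>The base \<open>sz x + 1\<close> is at least 2, so a larger exponent absorbs constant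
  factors and sums, and a single exponent describes any polynomial bound.\<close>

definition pbd :: "('a::repr \<Rightarrow> nat) \<Rightarrow> bool" where
  "pbd t \<longleftrightarrow> (\<exists>c. \<forall>x. t x \<le> (sz x + 1) ^ c)"

lemma pbdI: "(\<And>x. t x \<le> (sz x + 1) ^ c) \<Longrightarrow> pbd t"
  unfolding pbd_def by blast

lemma pbd_mono: "pbd t \<Longrightarrow> (\<And>x. u x \<le> t x) \<Longrightarrow> pbd u"
  unfolding pbd_def by (meson order_trans)

lemma le_two_power: "n \<le> (2::nat) ^ n"
  by (simp add: less_imp_le_nat)

lemma pbd_const: "pbd (\<lambda>_. k)"
proof (rule pbdI)
  fix x :: 'a
  have "k \<le> 2 ^ k" by (rule le_two_power)
  also have "\<dots> \<le> (sz x + 1) ^ k"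
    by (rule power_mono) auto
  finally show "k \<le> (sz x + 1) ^ k" .
qed

lemma pbd_sz: "pbd sz"
  by (rule pbdI[of _ 1]) simp

lemma pbd_mult:
  assumes "pbd t" "pbd u"
  shows "pbd (\<lambda>x. t x * u x)"
proof -
  obtain a b where "\<And>x. t x \<le> (sz x + 1) ^ a" "\<And>x. u x \<le> (sz x + 1) ^ b"
    using assms unfolding pbd_def by blast
  then show ?thesis
    by (intro pbdI[of _ "a + b"]) (simp add: power_add mult_mono)
qed

lemma pbd_add:
  fixes t u :: "'a::repr \<Rightarrow> nat"
  assumes "pbd t" "pbd u"
  shows "pbd (\<lambda>x. t x + u x)"
proof -
  obtain a b where ab: "\<And>x. t x \<le> (sz x + 1) ^ a" "\<And>x. u x \<le> (sz x + 1) ^ b"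
    using assms unfolding pbd_def by blast
  show ?thesis
  proof (rule pbdI[of _ "Suc (a + b)"])
    fix x :: 'a
    let ?n = "(sz x + 1) ^ (a + b)"
    have "(sz x + 1) ^ a \<le> ?n" "(sz x + 1) ^ b \<le> ?n"
      by (rule power_increasing; simp)+
    then have "t x \<le> ?n" "u x \<le> ?n"
      using ab[of x] by linarith+
    then have "t x + u x \<le> 2 * ?n" by simp
    also have "\<dots> \<le> (sz x + 1) * ?n" by (rule mult_right_mono) auto
    finally show "t x + u x \<le> (sz x + 1) ^ Suc (a + b)" by simp
  qed
qed

lemma pbd_Suc: "pbd t \<Longrightarrow> pbd (\<lambda>x. Suc (t x))"
  using pbd_add[OF pbd_const[of 1]] by simp

lemma pbd_power: "pbd t \<Longrightarrow> pbd (\<lambda>x. t x ^ c)"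
  by (induction c) (auto intro: pbd_mult pbd_const)

lemma pbd_comp:
  fixes f :: "'a::repr \<Rightarrow> 'b::repr"
  assumes "pbd t" "pbd (\<lambda>x. sz (f x))"
  shows "pbd (\<lambda>x. t (f x))"
proof -
  obtain c where c: "\<And>x. t x \<le> (sz x + 1) ^ c"
    using assms(1) unfolding pbd_def by blast
  have "pbd (\<lambda>x. (sz (f x) + 1) ^ c)"
    by (intro pbd_power pbd_add assms pbd_const)
  then show ?thesis by (rule pbd_mono) (rule c)
qed

lemmas pbd_intros = pbd_const pbd_add pbd_mult pbd_Suc pbd_power pbd_sz

section \<open>Total correctness of programs with time bounds\<close>

definition ex :: "com \<Rightarrow> store \<Rightarrow> nat \<Rightarrow> (store \<Rightarrow> bool) \<Rightarrow> bool" where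
  "ex p s t Q \<longleftrightarrow> (\<exists>t' s'. exec p s t' s' \<and> t' \<le> t \<and> Q s')"

lemma ex_weaken: "ex p s t Q \<Longrightarrow> t \<le> t' \<Longrightarrow> (\<And>s'. Q s' \<Longrightarrow> Q' s') \<Longrightarrow> ex p s t' Q'"
  unfolding ex_def by (meson order_trans)

lemma ex_Seq:
  assumes "ex p s t1 R" "\<And>s'. R s' \<Longrightarrow> ex q s' t2 Q"
  shows "ex (Seq p q) s (t1 + t2) Q"
  using assms unfolding ex_def by (meson exec.Seq add_mono)

lemma ex_CopyI: "Q (s(x := s y)) \<Longrightarrow> ex (Copy x y) s (1 + dsize (s y)) Q"
  and ex_MkNodeI: "Q (s(x := Node (s y) (s z))) \<Longrightarrow>
    ex (MkNode x y z) s (1 + dsize (s y) + dsize (s z)) Q"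
  and ex_LeftI: "Q (s(x := left (s y))) \<Longrightarrow> ex (Left x y) s (1 + dsize (s y)) Q"
  and ex_RightI: "Q (s(x := right (s y))) \<Longrightarrow> ex (Right x y) s (1 + dsize (s y)) Q"
  and ex_ClearI: "Q (s(x := Leaf)) \<Longrightarrow> ex (Clear x) s 1 Q"
  unfolding ex_def by (blast intro: exec.intros)+

lemma ex_Cond:
  assumes "s x \<noteq> Leaf \<Longrightarrow> ex p s t Q" "s x = Leaf \<Longrightarrow> ex q s t Q"
  shows "ex (Cond x p q) s (1 + t) Q"
proof (cases "s x = Leaf")
  case True
  then obtain t' s' where "exec q s t' s'" "t' \<le> t" "Q s'"
    using assms(2) unfolding ex_def by blast
  then show ?thesis
    unfolding ex_def using exec.CondFalse[of s x q t' s' p] True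
    by (intro exI[of _ "1 + t'"] exI[of _ s']) auto
next
  case False
  then obtain t' s' where "exec p s t' s'" "t' \<le> t" "Q s'"
    using assms(1) unfolding ex_def by blast
  then show ?thesis
    unfolding ex_def using exec.CondTrue[of s x p t' s' q] False
    by (intro exI[of _ "1 + t'"] exI[of _ s']) auto
qed

lemma ex_WhileFalse: "s x = Leaf \<Longrightarrow> Q s \<Longrightarrow> ex (While x p) s 1 Q"
  unfolding ex_def by (blast intro: exec.intros)

lemma ex_WhileTrue:
  assumes "s x \<noteq> Leaf" "ex p s t1 R" "\<And>s'. R s' \<Longrightarrow> ex (While x p) s' t2 Q"
  shows "ex (While x p) s (1 + t1 + t2) Q"
proof -
  obtain t1' s1 where 1: "exec p s t1' s1" "t1' \<le> t1" "R s1"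
    using assms(2) unfolding ex_def by blast
  obtain t2' s2 where 2: "exec (While x p) s1 t2' s2" "t2' \<le> t2" "Q s2"
    using assms(3)[OF 1(3)] unfolding ex_def by blast
  show ?thesis
    unfolding ex_def using exec.WhileTrue[OF assms(1) 1(1) 2(1)] 1(2) 2(2,3)
    by (intro exI[of _ "1 + t1' + t2'"] exI[of _ s2]) auto
qed

text \<open>
  A function is realized in every register \<open>r\<close>, by a program that leaves the registers below \<open>r\<close>
  intact and makes no assumption on the initial contents of those above; this is what makes the
  programs composable.
\<close>

definition runs :: "com \<Rightarrow> nat \<Rightarrow> store \<Rightarrow> data \<Rightarrow> nat \<Rightarrow> bool" where
  "runs p r s v t \<longleftrightarrow> ex p s t (\<lambda>s'. s' r = v \<and> (\<forall>j<r. s' j = s j))"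

text \<open>Closure under composition needs a bound on the size of the value, since the time of the
  second program is measured in it. The time bound \<open>t\<close> is fixed before the register
  \<open>r\<close>, so that shifting a program to other registers does not affect it.\<close>

definition ptime :: "('a::repr \<Rightarrow> 'b::repr) \<Rightarrow> bool" where
  "ptime f \<longleftrightarrow> pbd (\<lambda>x. sz (f x)) \<and>
    (\<exists>t. pbd t \<and> (\<forall>r. \<exists>p. \<forall>s x. s r = repr x \<longrightarrow> runs p r s (repr (f x)) (t x)))"

lemma ptimeI:
  assumes "pbd (\<lambda>x. sz (f x))" "pbd t"
    "\<And>r. \<exists>p. \<forall>s x. s r = repr x \<longrightarrow> runs p r s (repr (f x)) (t x)"
  shows "ptime f"
  using assms unfolding ptime_def by blast

lemma ptimeE:
  assumes "ptime f"
  obtains t P where "pbd (\<lambda>x. sz (f x))" "pbd t"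
    "\<And>r s x. s r = repr x \<Longrightarrow> runs (P r) r s (repr (f x)) (t x)"
  using assms unfolding ptime_def by metis

lemma ptime_sz: "ptime f \<Longrightarrow> pbd (\<lambda>x. sz (f x))"
  unfolding ptime_def by blast

text \<open>Covers constructors whose result has the same tree as their packed arguments, such as
  \<open>#\<close> on a pair, and changes of view, such as a number read as a list of units.\<close>

lemma ptime_cast:
  fixes f :: "'a::repr \<Rightarrow> 'b::repr"
  assumes "\<And>x. repr (f x) = repr x"
  shows "ptime f"
proof (rule ptimeI[where t = "\<lambda>x. 1 + sz x"])
  show "\<exists>p. \<forall>s x. s r = repr x \<longrightarrow> runs p r s (repr (f x)) (1 + sz (x :: 'a))" for r
  proof (rule exI[of _ "Copy r r"], intro allI impI)
    fix s and x :: 'a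
    assume *: "s r = repr x"
    show "runs (Copy r r) r s (repr (f x)) (1 + sz x)"
      unfolding runs_def using ex_CopyI[of _ s r r] * assms by simp
  qed
qed (auto simp: assms intro!: pbd_intros)

lemma ptime_id: "ptime (\<lambda>x. x)"
  by (rule ptime_cast) simp

lemma ptime_comp:
  fixes f :: "'a::repr \<Rightarrow> 'b::repr" and g :: "'b \<Rightarrow> 'c::repr"
  assumes "ptime g" "ptime f"
  shows "ptime (\<lambda>x. g (f x))"
proof -
  from assms(2) obtain tf pf where f: "pbd (\<lambda>x. sz (f x))" "pbd tf"
      "\<And>r s x. s r = repr x \<Longrightarrow> runs (pf r) r s (repr (f x)) (tf x)" by (rule ptimeE) blast
  from assms(1) obtain tg pg where g: "pbd (\<lambda>x. sz (g x))" "pbd tg"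
      "\<And>r s x. s r = repr x \<Longrightarrow> runs (pg r) r s (repr (g x)) (tg x)" by (rule ptimeE) blast
  show ?thesis
  proof (rule ptimeI[where t = "\<lambda>x. tf x + tg (f x)"])
    show "pbd (\<lambda>x. sz (g (f x)))" by (rule pbd_comp[OF g(1) f(1)])
    show "pbd (\<lambda>x. tf x + tg (f x))" by (intro pbd_add f(2) pbd_comp[OF g(2) f(1)])
    fix r
    show "\<exists>p. \<forall>s x. s r = repr x \<longrightarrow> runs p r s (repr (g (f x))) (tf x + tg (f x))"
    proof (rule exI[of _ "Seq (pf r) (pg r)"], intro allI impI)
      fix s and x :: 'a
      assume "s r = repr x"
      then have 1: "ex (pf r) s (tf x) (\<lambda>s'. s' r = repr (f x) \<and> (\<forall>j<r. s' j = s j))"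
        using f(3) unfolding runs_def by simp
      have 2: "ex (pg r) s' (tg (f x)) (\<lambda>s'. s' r = repr (g (f x)) \<and> (\<forall>j<r. s' j = s j))"
        if "s' r = repr (f x) \<and> (\<forall>j<r. s' j = s j)" for s'
        using g(3)[of s' r "f x"] that unfolding runs_def by (auto elim: ex_weaken)
      show "runs (Seq (pf r) (pg r)) r s (repr (g (f x))) (tf x + tg (f x))"
        unfolding runs_def by (rule ex_Seq[OF 1 2])
    qed
  qed
qed

lemma ptime_Pair:
  fixes f :: "'a::repr \<Rightarrow> 'b::repr" and g :: "'a \<Rightarrow> 'c::repr"
  assumes "ptime f" "ptime g"
  shows "ptime (\<lambda>x. (f x, g x))"
proof -
  from assms(1) obtain tf pf where f: "pbd (\<lambda>x. sz (f x))" "pbd tf"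
      "\<And>r s x. s r = repr x \<Longrightarrow> runs (pf r) r s (repr (f x)) (tf x)" by (rule ptimeE) blast
  from assms(2) obtain tg pg where g: "pbd (\<lambda>x. sz (g x))" "pbd tg"
      "\<And>r s x. s r = repr x \<Longrightarrow> runs (pg r) r s (repr (g x)) (tg x)" by (rule ptimeE) blast
  let ?t = "\<lambda>x. (1 + sz x) + (tf x + ((1 + sz x) + (tg x + (1 + sz (f x) + sz (g x)))))"
  show ?thesis
  proof (rule ptimeI[where t = ?t])
    show "pbd (\<lambda>x. sz (f x, g x))" using f(1) g(1) by (auto intro!: pbd_intros)
    show "pbd ?t" using f g by (auto intro!: pbd_intros)
    fix r
    show "\<exists>p. \<forall>s x. s r = repr x \<longrightarrow> runs p r s (repr (f x, g x)) (?t x)"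
    proof (rule exI[of _ "Seq (Copy (r+1) r) (Seq (pf (r+1)) (Seq (Copy (r+2) r)
          (Seq (pg (r+2)) (MkNode r (r+1) (r+2)))))"], intro allI impI)
      fix s and x :: 'a
      assume s: "s r = repr x"
      have 1: "ex (Copy (r+1) r) s (1 + sz x)
          (\<lambda>s'. s' (r+1) = repr x \<and> (\<forall>j\<le>r. s' j = s j))"
        using ex_CopyI[of _ s "r+1" r] s by simp
      have 2: "ex (pf (r+1)) s' (tf x) (\<lambda>s'. s' (r+1) = repr (f x) \<and> (\<forall>j\<le>r. s' j = s j))"
        if "s' (r+1) = repr x \<and> (\<forall>j\<le>r. s' j = s j)" for s'
        using f(3)[of s' "r+1" x] that unfolding runs_def
        by (auto elim: ex_weaken)
      have 3: "ex (Copy (r+2) r) s' (1 + sz x) (\<lambda>s'. s' (r+2) = repr x \<and>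
          s' (r+1) = repr (f x) \<and> (\<forall>j\<le>r. s' j = s j))"
        if "s' (r+1) = repr (f x) \<and> (\<forall>j\<le>r. s' j = s j)" for s'
        using ex_CopyI[of _ s' "r+2" r] s that by simp
      have 4: "ex (pg (r+2)) s' (tg x) (\<lambda>s'. s' (r+2) = repr (g x) \<and>
          s' (r+1) = repr (f x) \<and> (\<forall>j\<le>r. s' j = s j))"
        if "s' (r+2) = repr x \<and> s' (r+1) = repr (f x) \<and> (\<forall>j\<le>r. s' j = s j)" for s'
        using g(3)[of s' "r+2" x] that unfolding runs_def
        by (auto elim: ex_weaken)
      have 5: "ex (MkNode r (r+1) (r+2)) s' (1 + sz (f x) + sz (g x))
          (\<lambda>s'. s' r = repr (f x, g x) \<and> (\<forall>j<r. s' j = s j))"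
        if "s' (r+2) = repr (g x) \<and> s' (r+1) = repr (f x) \<and> (\<forall>j\<le>r. s' j = s j)" for s'
        using ex_MkNodeI[of _ s' r "r+1" "r+2"] that by simp
      show "runs (Seq (Copy (r+1) r) (Seq (pf (r+1)) (Seq (Copy (r+2) r)
          (Seq (pg (r+2)) (MkNode r (r+1) (r+2)))))) r s (repr (f x, g x)) (?t x)"
        unfolding runs_def
        by (rule ex_Seq[OF 1 ex_Seq[OF 2 ex_Seq[OF 3 ex_Seq[OF 4 5]]]])
    qed
  qed
qed

lemma ptime_via:
  assumes "ptime F" "\<And>x. repr (f x) = F (repr x)"
  shows "ptime f"
proof -
  from assms(1) obtain t P where F: "pbd (\<lambda>x. sz (F x))" "pbd t"
      "\<And>r s x. s r = repr x \<Longrightarrow> runs (P r) r s (repr (F x)) (t x)" by (rule ptimeE) blast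
  have r: "pbd (\<lambda>x :: 'a. sz (repr x))" by (simp add: pbd_sz)
  show ?thesis
  proof (rule ptimeI)
    show "pbd (\<lambda>x. sz (f x))" using pbd_comp[OF F(1) r] assms(2) by simp
    show "pbd (\<lambda>x :: 'a. t (repr x))" by (rule pbd_comp[OF F(2) r])
    show "\<exists>p. \<forall>s x. s r = repr x \<longrightarrow> runs p r s (repr (f x)) (t (repr x))" for r
      using F(3)[of _ r "repr _"] assms(2) by (intro exI[of _ "P r"]) auto
  qed
qed

lemma dsize_left: "dsize (left d) \<le> dsize d" and dsize_right: "dsize (right d) \<le> dsize d"
  by (cases d; simp)+

lemma ptime_left: "ptime left"
proof (rule ptimeI[where t = "\<lambda>x. 1 + sz x"])
  show "pbd (\<lambda>d. sz (left d))"
    by (rule pbd_mono[OF pbd_sz]) (simp add: dsize_left)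
  show "\<exists>p. \<forall>s x. s r = repr x \<longrightarrow> runs p r s (repr (left x)) (1 + sz x)" for r
    using ex_LeftI[of _ _ r r] by (intro exI[of _ "Left r r"]) (auto simp: runs_def)
qed (intro pbd_intros)

lemma ptime_right: "ptime right"
proof (rule ptimeI[where t = "\<lambda>x. 1 + sz x"])
  show "pbd (\<lambda>d. sz (right d))"
    by (rule pbd_mono[OF pbd_sz]) (simp add: dsize_right)
  show "\<exists>p. \<forall>s x. s r = repr x \<longrightarrow> runs p r s (repr (right x)) (1 + sz x)" for r
    using ex_RightI[of _ _ r r] by (intro exI[of _ "Right r r"]) (auto simp: runs_def)
qed (intro pbd_intros)

fun const_prog :: "nat \<Rightarrow> data \<Rightarrow> com" where
  "const_prog r Leaf = Clear r"
| "const_prog r (Node a b) =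
    Seq (const_prog (r+1) a) (Seq (const_prog (r+2) b) (MkNode r (r+1) (r+2)))"

fun const_time :: "data \<Rightarrow> nat" where
  "const_time Leaf = 1"
| "const_time (Node a b) = const_time a + (const_time b + (1 + dsize a + dsize b))"

lemma runs_const: "runs (const_prog r d) r s d (const_time d)"
proof (induction d arbitrary: r s)
  case Leaf
  show ?case using ex_ClearI[of _ s r] by (simp add: runs_def)
next
  case (Node a b)
  have 1: "ex (const_prog (r+1) a) s (const_time a) (\<lambda>s'. s' (r+1) = a \<and> (\<forall>j\<le>r. s' j = s j))"
    using Node(1)[of "r+1" s] unfolding runs_def by (auto elim: ex_weaken)
  have 2: "ex (const_prog (r+2) b) s' (const_time b)
      (\<lambda>s'. s' (r+2) = b \<and> s' (r+1) = a \<and> (\<forall>j\<le>r. s' j = s j))"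
    if "s' (r+1) = a \<and> (\<forall>j\<le>r. s' j = s j)" for s'
    using Node(2)[of "r+2" s'] that unfolding runs_def by (auto elim: ex_weaken)
  have 3: "ex (MkNode r (r+1) (r+2)) s' (1 + dsize a + dsize b)
      (\<lambda>s'. s' r = Node a b \<and> (\<forall>j<r. s' j = s j))"
    if "s' (r+2) = b \<and> s' (r+1) = a \<and> (\<forall>j\<le>r. s' j = s j)" for s'
    using ex_MkNodeI[of _ s' r "r+1" "r+2"] that by simp
  show ?case
    unfolding runs_def const_prog.simps const_time.simps
    by (rule ex_Seq[OF 1 ex_Seq[OF 2 3]])
qed

lemma ptime_const: "ptime (\<lambda>_. k)"
  by (rule ptimeI[where t = "\<lambda>_. const_time (repr k)"])
    (auto intro!: pbd_intros exI[of _ "const_prog r (repr k)" for r] runs_const)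

text \<open>
  The then-branch may be undefined where the condition fails: it may operate on a decoding
  \<open>d x\<close> of the input \<open>x\<close> that exists only there.
\<close>

lemma ptime_If_decode:
  fixes f :: "'d::repr \<Rightarrow> 'b::repr" and g :: "'a::repr \<Rightarrow> 'b"
  assumes "ptime b" "ptime f" "ptime g" and d: "\<And>x. b x \<Longrightarrow> repr (d x) = repr x"
  shows "ptime (\<lambda>x. if b x then f (d x) else g x)"
proof -
  from assms(1) obtain tb pb where b: "pbd tb"
      "\<And>r s x. s r = repr x \<Longrightarrow> runs (pb r) r s (repr (b x)) (tb x)" by (rule ptimeE) blast
  from assms(2) obtain tf' pf where f': "pbd (\<lambda>x. sz (f x))" "pbd tf'"
      "\<And>r s x. s r = repr x \<Longrightarrow> runs (pf r) r s (repr (f x)) (tf' x)" by (rule ptimeE) blast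
  from f'(2) obtain cf where cf: "\<And>x. tf' x \<le> (sz x + 1) ^ cf" unfolding pbd_def by blast
  from f'(1) obtain df where df: "\<And>x. sz (f x) \<le> (sz x + 1) ^ df" unfolding pbd_def by blast
  \<comment> \<open>\<open>d x\<close> is arbitrary where \<open>b x\<close> fails, so
    \<open>tf' (d x)\<close> may exceed every polynomial there. The polynomial that bounds
    \<open>tf'\<close>, taken at the size of \<open>x\<close>, is harmless everywhere and dominates
    \<open>tf' (d x)\<close> where \<open>b x\<close> holds.\<close>
  define tf :: "'a \<Rightarrow> nat" where "tf = (\<lambda>x. (sz x + 1) ^ cf)"
  have f: "pbd tf" "\<And>r s x. b x \<Longrightarrow> s r = repr x \<Longrightarrow> runs (pf r) r s (repr (f (d x))) (tf x)"
  proof -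
    show "pbd tf" unfolding tf_def by (intro pbd_intros)
    show "runs (pf r) r s (repr (f (d x))) (tf x)" if "b x" "s r = repr x" for r s x
      using f'(3)[of s r "d x"] cf[of "d x"] d[OF that(1)] that(2)
      unfolding runs_def tf_def by (auto elim: ex_weaken)
  qed
  from assms(3) obtain tg pg where g: "pbd (\<lambda>x. sz (g x))" "pbd tg"
      "\<And>r s x. s r = repr x \<Longrightarrow> runs (pg r) r s (repr (g x)) (tg x)" by (rule ptimeE) blast
  let ?t = "\<lambda>x. (1 + sz x) + (tb x + (1 + (tf x + tg x)))"
  show ?thesis
  proof (rule ptimeI[where t = ?t])
    have "pbd (\<lambda>x. (sz x + 1) ^ df + sz (g x))" by (intro pbd_intros g)
    then show "pbd (\<lambda>x. sz (if b x then f (d x) else g x))"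
    proof (rule pbd_mono)
      show "sz (if b x then f (d x) else g x) \<le> (sz x + 1) ^ df + sz (g x)" for x
        using df[of "d x"] d[of x] by auto
    qed
    show "pbd ?t" using b f g by (auto intro!: pbd_intros)
    fix r
    show "\<exists>p. \<forall>s x. s r = repr x \<longrightarrow> runs p r s (repr (if b x then f (d x) else g x)) (?t x)"
    proof (rule exI[of _ "Seq (Copy (r+1) r) (Seq (pb (r+1)) (Cond (r+1) (pf r) (pg r)))"],
        intro allI impI)
      fix s and x :: 'a
      assume s: "s r = repr x"
      have 1: "ex (Copy (r+1) r) s (1 + sz x)
          (\<lambda>s'. s' (r+1) = repr x \<and> (\<forall>j\<le>r. s' j = s j))"
        using ex_CopyI[of _ s "r+1" r] s by simp
      have 2: "ex (pb (r+1)) s' (tb x) (\<lambda>s'. s' (r+1) = repr (b x) \<and> (\<forall>j\<le>r. s' j = s j))"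
        if "s' (r+1) = repr x \<and> (\<forall>j\<le>r. s' j = s j)" for s'
        using b(2)[of s' "r+1" x] that unfolding runs_def
        by (auto elim: ex_weaken)
      have 3: "ex (Cond (r+1) (pf r) (pg r)) s' (1 + (tf x + tg x))
          (\<lambda>s'. s' r = repr (if b x then f (d x) else g x) \<and> (\<forall>j<r. s' j = s j))"
        if s': "s' (r+1) = repr (b x) \<and> (\<forall>j\<le>r. s' j = s j)" for s'
      proof (rule ex_Cond)
        have s'r: "s' r = repr x" using s s' by simp
        {
          assume "s' (r+1) \<noteq> Leaf"
          then have "b x" using s' by (cases "b x") auto
          then show "ex (pf r) s' (tf x + tg x)
              (\<lambda>s'. s' r = repr (if b x then f (d x) else g x) \<and> (\<forall>j<r. s' j = s j))"
            using f(2)[of x s' r, OF _ s'r] s' unfolding runs_def by (auto elim: ex_weaken)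
        }
        {
          assume "s' (r+1) = Leaf"
          then have "\<not> b x" using s' by (cases "b x") auto
          then show "ex (pg r) s' (tf x + tg x)
              (\<lambda>s'. s' r = repr (if b x then f (d x) else g x) \<and> (\<forall>j<r. s' j = s j))"
            using g(3)[of s' r x, OF s'r] s' unfolding runs_def by (auto elim: ex_weaken)
        }
      qed
      show "runs (Seq (Copy (r+1) r) (Seq (pb (r+1)) (Cond (r+1) (pf r) (pg r)))) r s
          (repr (if b x then f (d x) else g x)) (?t x)"
        unfolding runs_def by (rule ex_Seq[OF 1 ex_Seq[OF 2 3]])
    qed
  qed
qed

lemma ptime_If: "ptime b \<Longrightarrow> ptime f \<Longrightarrow> ptime g \<Longrightarrow> ptime (\<lambda>x. if b x then f x else g x)"
  by (rule ptime_If_decode) auto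

text \<open>Iterating a polynomial-time step can blow up the state exponentially, for instance by
  doubling it. A polynomial bound \<open>B\<close> on the states of the actual run, that is, after
  every prefix of the list, keeps each step polynomial.\<close>

lemma ptime_fold_bounded:
  fixes g :: "'e::repr \<Rightarrow> 'a::repr \<Rightarrow> 'b::repr \<Rightarrow> 'b" and xs :: "'e \<Rightarrow> 'a list" and s0 :: "'e \<Rightarrow> 'b"
  assumes "ptime (\<lambda>p. g (fst p) (fst (snd p)) (snd (snd p)))" "ptime xs" "ptime s0" "pbd B"
    and B: "\<And>e ys zs. xs e = ys @ zs \<Longrightarrow> sz (fold (g e) ys (s0 e)) \<le> B e"
  shows "ptime (\<lambda>e. fold (g e) (xs e) (s0 e))"
proof -
  from assms(1) obtain c where c: "\<And>p. sz (g (fst p) (fst (snd p)) (snd (snd p))) \<le> (sz p + 1) ^ c"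
    using ptime_sz unfolding pbd_def by blast
  from assms(1) obtain tg pg where g: "pbd tg"
      "\<And>r s x. s r = repr x \<Longrightarrow>
        runs (pg r) r s (repr (g (fst x) (fst (snd x)) (snd (snd x)))) (tg x)" by (rule ptimeE) blast
  from assms(2) obtain tx px where x: "pbd (\<lambda>x. sz (xs x))" "pbd tx"
      "\<And>r s x. s r = repr x \<Longrightarrow> runs (px r) r s (repr (xs x)) (tx x)" by (rule ptimeE) blast
  from assms(3) obtain ti pi where i: "pbd (\<lambda>x. sz (s0 x))" "pbd ti"
      "\<And>r s x. s r = repr x \<Longrightarrow> runs (pi r) r s (repr (s0 x)) (ti x)" by (rule ptimeE) blast
  from g(1) obtain d where d: "\<And>p. tg p \<le> (sz p + 1) ^ d" unfolding pbd_def by blast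
  let ?K = "\<lambda>e. (1 + sz (xs e)) + ((1 + sz (xs e) + B e) + ((2 + sz e + sz (xs e) + B e) +
      ((sz e + sz (xs e) + B e + 3) ^ d + ((1 + B e) + (1 + sz (xs e))))))"
  let ?t = "\<lambda>e. (1 + sz e) + (tx e + ((1 + sz e) + (ti e + ((sz (xs e) * (?K e + 1) + 1) + (1 + B e)))))"
  show ?thesis
  proof (rule ptimeI[where t = ?t])
    show "pbd (\<lambda>e. sz (fold (g e) (xs e) (s0 e)))"
      by (rule pbd_mono[OF assms(4)]) (rule B[where zs = "[]"], simp)
    show "pbd ?t" using assms(4) x i by (intro pbd_intros) auto
    fix r
    \<comment> \<open>Register \<open>r\<close> keeps the environment, \<open>r+1\<close> the rest
      of the list and \<open>r+2\<close> the state; the argument triple of the step is assembled in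
      \<open>r+3\<close>.\<close>
    let ?body = "Seq (Left (r+3) (r+1)) (Seq (MkNode (r+3) (r+3) (r+2)) (Seq (MkNode (r+3) r (r+3))
        (Seq (pg (r+3)) (Seq (Copy (r+2) (r+3)) (Right (r+1) (r+1))))))"
    have body: "ex ?body s (?K e) (\<lambda>s'. s' (r+1) = repr ys \<and> s' (r+2) = repr (g e y st) \<and>
        (\<forall>j\<le>r. s' j = s j))"
      if s: "s r = repr e" "s (r+1) = repr (y # ys)" "s (r+2) = repr st"
        and b: "sz (y # ys) \<le> sz (xs e)" "sz st \<le> B e" "sz (g e y st) \<le> B e" for e y ys st s
    proof -
      let ?Q = "\<lambda>v s'. s' (r+1) = repr (y # ys) \<and> s' (r+2) = repr st \<and> s' (r+3) = v \<and>
        (\<forall>j\<le>r. s' j = s j)"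
      have 1: "ex (Left (r+3) (r+1)) s (1 + sz (xs e)) (?Q (repr y))"
        by (rule ex_weaken[OF ex_LeftI[of "?Q (repr y)"]]) (use s b in auto)
      have 2: "ex (MkNode (r+3) (r+3) (r+2)) s' (1 + sz (xs e) + B e) (?Q (repr (y, st)))"
        if "?Q (repr y) s'" for s'
        by (rule ex_weaken[OF ex_MkNodeI[of "?Q (repr (y, st))"]]) (use s b that in auto)
      have 3: "ex (MkNode (r+3) r (r+3)) s' (2 + sz e + sz (xs e) + B e) (?Q (repr (e, y, st)))"
        if "?Q (repr (y, st)) s'" for s'
        by (rule ex_weaken[OF ex_MkNodeI[of "?Q (repr (e, y, st))"]]) (use s b that in auto)
      have "sz (e, y, st) + 1 \<le> sz e + sz (xs e) + B e + 3" using b by simp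
      then have "tg (e, y, st) \<le> (sz e + sz (xs e) + B e + 3) ^ d"
        using d[of "(e, y, st)"] power_mono[of _ _ d] by (meson order_trans zero_le)
      then have 4: "ex (pg (r+3)) s' ((sz e + sz (xs e) + B e + 3) ^ d) (?Q (repr (g e y st)))"
        if "?Q (repr (e, y, st)) s'" for s'
        using g(2)[of s' "r+3" "(e, y, st)"] that unfolding runs_def
        by (auto elim!: ex_weaken)
      have 5: "ex (Copy (r+2) (r+3)) s' (1 + B e)
          (\<lambda>s'. s' (r+1) = repr (y # ys) \<and> s' (r+2) = repr (g e y st) \<and> (\<forall>j\<le>r. s' j = s j))"
        if "?Q (repr (g e y st)) s'" for s'
        by (rule ex_weaken[OF ex_CopyI[where Q = "\<lambda>s'. s' (r+1) = repr (y # ys) \<and>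
          s' (r+2) = repr (g e y st) \<and> (\<forall>j\<le>r. s' j = s j)"]]) (use b that in auto)
      have 6: "ex (Right (r+1) (r+1)) s' (1 + sz (xs e))
          (\<lambda>s'. s' (r+1) = repr ys \<and> s' (r+2) = repr (g e y st) \<and> (\<forall>j\<le>r. s' j = s j))"
        if "s' (r+1) = repr (y # ys) \<and> s' (r+2) = repr (g e y st) \<and> (\<forall>j\<le>r. s' j = s j)" for s'
        by (rule ex_weaken[OF ex_RightI[where Q = "\<lambda>s'. s' (r+1) = repr ys \<and>
          s' (r+2) = repr (g e y st) \<and> (\<forall>j\<le>r. s' j = s j)"]]) (use b that in auto)
      show ?thesis
        by (rule ex_Seq[OF 1 ex_Seq[OF 2 ex_Seq[OF 3 ex_Seq[OF 4 ex_Seq[OF 5 6]]]]])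
    qed
    have loop: "ex (While (r+1) ?body) s (length ys * (?K e + 1) + 1)
        (\<lambda>s'. s' (r+2) = repr (fold (g e) ys st) \<and> (\<forall>j\<le>r. s' j = s j))"
      if "s r = repr e" "s (r+1) = repr ys" "s (r+2) = repr st" "sz ys \<le> sz (xs e)"
        "\<And>us vs. ys = us @ vs \<Longrightarrow> sz (fold (g e) us st) \<le> B e" for s e ys st
      using that
    proof (induction ys arbitrary: s st)
      case Nil
      then show ?case by (auto intro!: ex_WhileFalse[unfolded One_nat_def])
    next
      case (Cons y ys)
      have 1: "ex ?body s (?K e) (\<lambda>s'. s' (r+1) = repr ys \<and> s' (r+2) = repr (g e y st) \<and>
          (\<forall>j\<le>r. s' j = s j))"
        using Cons.prems(5)[of "[]"] Cons.prems(5)[of "[y]"] Cons.prems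
        by (intro body) auto
      have 2: "ex (While (r+1) ?body) s' (length ys * (?K e + 1) + 1)
        (\<lambda>s'. s' (r+2) = repr (fold (g e) (y # ys) st) \<and> (\<forall>j\<le>r. s' j = s j))"
        if s': "s' (r+1) = repr ys \<and> s' (r+2) = repr (g e y st) \<and> (\<forall>j\<le>r. s' j = s j)" for s'
      proof -
        have "ex (While (r+1) ?body) s' (length ys * (?K e + 1) + 1)
          (\<lambda>s''. s'' (r+2) = repr (fold (g e) ys (g e y st)) \<and> (\<forall>j\<le>r. s'' j = s' j))"
          using Cons.prems(1,4) Cons.prems(5)[of "y # us" for us] s'
          by (intro Cons.IH) auto
        then show ?thesis using s' by (auto elim!: ex_weaken)
      qed
      have "s (r+1) \<noteq> Leaf" using Cons.prems(2) by simp
      from ex_WhileTrue[OF this 1 2] show ?case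
        by (auto elim!: ex_weaken)
    qed
    let ?p = "Seq (Copy (r+1) r) (Seq (px (r+1)) (Seq (Copy (r+2) r) (Seq (pi (r+2))
        (Seq (While (r+1) ?body) (Copy r (r+2))))))"
    show "\<exists>p. \<forall>s e. s r = repr e \<longrightarrow> runs p r s (repr (fold (g e) (xs e) (s0 e))) (?t e)"
    proof (rule exI[of _ ?p], intro allI impI)
      fix s and e :: 'e
      assume s: "s r = repr e"
      have 1: "ex (Copy (r+1) r) s (1 + sz e)
          (\<lambda>s'. s' (r+1) = repr e \<and> (\<forall>j\<le>r. s' j = s j))"
        using ex_CopyI[of _ s "r+1" r] s by simp
      have 2: "ex (px (r+1)) s' (tx e) (\<lambda>s'. s' (r+1) = repr (xs e) \<and> (\<forall>j\<le>r. s' j = s j))"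
        if "s' (r+1) = repr e \<and> (\<forall>j\<le>r. s' j = s j)" for s'
        using x(3)[of s' "r+1" e] that unfolding runs_def
        by (auto elim: ex_weaken)
      have 3: "ex (Copy (r+2) r) s' (1 + sz e) (\<lambda>s'. s' (r+2) = repr e \<and>
          s' (r+1) = repr (xs e) \<and> (\<forall>j\<le>r. s' j = s j))"
        if "s' (r+1) = repr (xs e) \<and> (\<forall>j\<le>r. s' j = s j)" for s'
        using ex_CopyI[of _ s' "r+2" r] s that by simp
      have 4: "ex (pi (r+2)) s' (ti e) (\<lambda>s'. s' (r+2) = repr (s0 e) \<and>
          s' (r+1) = repr (xs e) \<and> (\<forall>j\<le>r. s' j = s j))"
        if "s' (r+2) = repr e \<and> s' (r+1) = repr (xs e) \<and> (\<forall>j\<le>r. s' j = s j)" for s'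
        using i(3)[of s' "r+2" e] that unfolding runs_def
        by (auto elim: ex_weaken)
      have 5: "ex (While (r+1) ?body) s' (sz (xs e) * (?K e + 1) + 1)
          (\<lambda>s'. s' (r+2) = repr (fold (g e) (xs e) (s0 e)) \<and> (\<forall>j\<le>r. s' j = s j))"
        if "s' (r+2) = repr (s0 e) \<and> s' (r+1) = repr (xs e) \<and> (\<forall>j\<le>r. s' j = s j)" for s'
      proof (rule ex_weaken[OF loop[of s' e "xs e" "s0 e"]])
        show "length (xs e) * (?K e + 1) + 1 \<le> sz (xs e) * (?K e + 1) + 1"
          using length_le_sz by (intro add_mono mult_mono) auto
      qed (use that s B in auto)
      have 6: "ex (Copy r (r+2)) s' (1 + B e)
          (\<lambda>s'. s' r = repr (fold (g e) (xs e) (s0 e)) \<and> (\<forall>j<r. s' j = s j))"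
        if "s' (r+2) = repr (fold (g e) (xs e) (s0 e)) \<and> (\<forall>j\<le>r. s' j = s j)" for s'
        by (rule ex_weaken[OF ex_CopyI[where
          Q = "\<lambda>s'. s' r = repr (fold (g e) (xs e) (s0 e)) \<and> (\<forall>j<r. s' j = s j)"]])
          (use that B[of e "xs e" "[]"] in auto)
      show "runs ?p r s (repr (fold (g e) (xs e) (s0 e))) (?t e)"
        unfolding runs_def
        by (rule ex_Seq[OF 1 ex_Seq[OF 2 ex_Seq[OF 3 ex_Seq[OF 4 ex_Seq[OF 5 6]]]]])
    qed
  qed
qed

text \<open>If a step adds at most \<open>b e\<close> whatever the state is, the whole run adds at
  most the length of the list times \<open>b e\<close>.\<close>

lemma ptime_fold:
  fixes g :: "'e::repr \<Rightarrow> 'a::repr \<Rightarrow> 'b::repr \<Rightarrow> 'b" and xs :: "'e \<Rightarrow> 'a list" and s0 :: "'e \<Rightarrow> 'b"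
  assumes "ptime (\<lambda>p. g (fst p) (fst (snd p)) (snd (snd p)))" "ptime xs" "ptime s0" "pbd b"
    and b: "\<And>e x s. x \<in> set (xs e) \<Longrightarrow> sz (g e x s) \<le> sz s + b e"
  shows "ptime (\<lambda>e. fold (g e) (xs e) (s0 e))"
proof (rule ptime_fold_bounded[OF assms(1-3), where B = "\<lambda>e. sz (s0 e) + sz (xs e) * b e"])
  show "pbd (\<lambda>e. sz (s0 e) + sz (xs e) * b e)"
    by (intro pbd_intros ptime_sz assms)
  have fold: "sz (fold (g e) ys s) \<le> sz s + length ys * b e" if "set ys \<subseteq> set (xs e)" for e ys s
    using that
  proof (induction ys arbitrary: s)
    case (Cons y ys)
    have "sz (fold (g e) (y # ys) s) \<le> sz (g e y s) + length ys * b e"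
      using Cons by simp
    also have "sz (g e y s) \<le> sz s + b e" using b Cons.prems by simp
    finally show ?case by simp
  qed simp
  fix e ys zs
  assume eq: "xs e = ys @ zs"
  then have "length ys \<le> sz (xs e)"
    using length_le_sz[of "xs e"] by simp
  then have "length ys * b e \<le> sz (xs e) * b e" by (rule mult_right_mono) simp
  then show "sz (fold (g e) ys (s0 e)) \<le> sz (s0 e) + sz (xs e) * b e"
    using fold[of ys e "s0 e"] eq by (intro order_trans[OF fold add_left_mono]) auto
qed

subsection \<open>A library of polynomial-time functions\<close>

named_theorems ptime_intros

lemmas [ptime_intros] = ptime_id ptime_const ptime_If ptime_Pair

lemma ptime_comp2:
  assumes "ptime (\<lambda>p. h (fst p) (snd p))" "ptime f" "ptime g"
  shows "ptime (\<lambda>x. h (f x) (g x))"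
  using ptime_comp[OF assms(1) ptime_Pair[OF assms(2,3)]] by simp

lemma ptime_fst [ptime_intros]: "ptime f \<Longrightarrow> ptime (\<lambda>x. fst (f x))"
  by (rule ptime_comp, rule ptime_via[OF ptime_left]) auto

lemma ptime_snd [ptime_intros]: "ptime f \<Longrightarrow> ptime (\<lambda>x. snd (f x))"
  by (rule ptime_comp, rule ptime_via[OF ptime_right]) auto

lemma ptime_Suc [ptime_intros]:
  assumes "ptime f"
  shows "ptime (\<lambda>x. Suc (f x))"
proof -
  \<comment> \<open>The pair \<open>((), n)\<close> and the number \<open>Suc n\<close> are the same
    tree.\<close>
  have "ptime (\<lambda>p. Suc (snd (p :: unit \<times> nat)))"
    by (rule ptime_cast) auto
  from ptime_comp[OF this ptime_Pair[OF ptime_const[of "()"] assms]] show ?thesis by simp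
qed

lemma ptime_Cons [ptime_intros]:
  assumes "ptime f" "ptime g"
  shows "ptime (\<lambda>x. f x # g x)"
proof -
  have "ptime (\<lambda>p. fst p # snd p)"
    by (rule ptime_cast) auto
  from ptime_comp[OF this ptime_Pair[OF assms]] show ?thesis by simp
qed

lemma ptime_tl [ptime_intros]: "ptime f \<Longrightarrow> ptime (\<lambda>x. tl (f x))"
proof (rule ptime_comp[of tl])
  have "repr (tl xs) = right (repr xs)" for xs :: "'b list" by (cases xs) auto
  then show "ptime (tl :: 'b list \<Rightarrow> 'b list)" by (rule ptime_via[OF ptime_right])
qed

text \<open>Numbers are unary, so \<open>n\<close> and \<open>replicate n ()\<close> are the same
  tree. A fold over the latter is a loop with \<open>n\<close> rounds, from which the arithmetic
  below is built.\<close>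

lemma ptime_replicate [ptime_intros]: "ptime f \<Longrightarrow> ptime (\<lambda>x. replicate (f x) ())"
proof (rule ptime_comp[of "\<lambda>n. replicate n ()"], rule ptime_cast)
  show "repr (replicate n ()) = repr n" for n by (induction n) auto
qed

lemma fold_replicate: "fold (\<lambda>_. f) (replicate n ()) x = (f ^^ n) x"
  by (induction n arbitrary: x) (auto simp: funpow_swap1)

lemma ptime_pred: "ptime (\<lambda>n :: nat. n - 1)"
proof (rule ptime_via[OF ptime_right])
  show "repr (n - 1) = right (repr n)" for n :: nat by (cases n) auto
qed

lemma ptime_add [ptime_intros]:
  assumes "ptime f" "ptime g"
  shows "ptime (\<lambda>x. f x + g x :: nat)"
proof -
  have "ptime (\<lambda>x. fold (\<lambda>_. Suc) (replicate (f x) ()) (g x))"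
    by (rule ptime_fold[where b = "\<lambda>_. 2"]) (intro ptime_intros assms pbd_intros | simp)+
  moreover have "(Suc ^^ m) n = m + n" for m n by (induction m) auto
  ultimately show ?thesis by (simp add: fold_replicate)
qed

lemma ptime_diff [ptime_intros]:
  assumes "ptime f" "ptime g"
  shows "ptime (\<lambda>x. f x - g x :: nat)"
proof -
  have "ptime (\<lambda>x. fold (\<lambda>_ n. n - 1) (replicate (g x) ()) (f x))"
    by (rule ptime_fold[where b = "\<lambda>_. 0"])
      (intro ptime_intros ptime_comp[OF ptime_pred] assms pbd_intros | simp add: sz_nat)+
  moreover have "((\<lambda>n. n - 1) ^^ m) n = n - m" for m n :: nat by (induction m) auto
  ultimately show ?thesis by (simp add: fold_replicate)
qed

lemma ptime_mult [ptime_intros]: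
  assumes "ptime f" "ptime g"
  shows "ptime (\<lambda>x. f x * g x :: nat)"
proof -
  have "ptime (\<lambda>x. fold (\<lambda>_ n. n + g x) (replicate (f x) ()) 0)"
    by (rule ptime_fold[where b = "\<lambda>x. sz (g x)"])
      (intro ptime_intros ptime_comp[OF assms(2)] assms ptime_sz | simp add: sz_nat)+
  moreover have "((\<lambda>n. n + k) ^^ m) 0 = m * k" for m k :: nat by (induction m) auto
  ultimately show ?thesis by (simp add: fold_replicate)
qed

lemma ptime_power [ptime_intros]: "ptime f \<Longrightarrow> ptime (\<lambda>x. f x ^ c :: nat)"
  by (induction c) (auto intro!: ptime_intros)

lemma ptime_nonempty: "ptime (\<lambda>xs. xs \<noteq> [])"
proof -
  have "ptime (\<lambda>xs :: 'a list. fold (\<lambda>_ _. True) xs False)"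
    by (rule ptime_fold[where b = "\<lambda>_. 3"]) (intro ptime_intros pbd_intros | simp)+
  moreover have "fold (\<lambda>_ _. True) xs False = (xs \<noteq> [])" for xs :: "'a list"
    by (induction xs rule: rev_induct) auto
  ultimately show ?thesis by simp
qed

lemma ptime_cong: "ptime f \<Longrightarrow> (\<And>x. g x = f x) \<Longrightarrow> ptime g"
  by (metis ext)

lemma ptime_not [ptime_intros]: "ptime f \<Longrightarrow> ptime (\<lambda>x. \<not> f x)"
  by (rule ptime_cong[OF ptime_If[of f "\<lambda>_. False" "\<lambda>_. True"]]) (auto intro: ptime_const)

lemma ptime_conj [ptime_intros]: "ptime f \<Longrightarrow> ptime g \<Longrightarrow> ptime (\<lambda>x. f x \<and> g x)"
  by (rule ptime_cong[OF ptime_If[of f g "\<lambda>_. False"]]) (auto intro: ptime_const)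

lemma ptime_disj [ptime_intros]: "ptime f \<Longrightarrow> ptime g \<Longrightarrow> ptime (\<lambda>x. f x \<or> g x)"
  by (rule ptime_cong[OF ptime_If[of f "\<lambda>_. True" g]]) (auto intro: ptime_const)

lemma ptime_imp [ptime_intros]: "ptime f \<Longrightarrow> ptime g \<Longrightarrow> ptime (\<lambda>x. f x \<longrightarrow> g x)"
  by (rule ptime_cong[OF ptime_If[of f g "\<lambda>_. True"]]) (auto intro: ptime_const)

lemma ptime_Nil_eq [ptime_intros]: "ptime f \<Longrightarrow> ptime (\<lambda>x. f x = [])"
  using ptime_not[OF ptime_comp[OF ptime_nonempty]] by force

lemma ptime_eq_0: "ptime f \<Longrightarrow> ptime (\<lambda>x. f x = (0 :: nat))"
  using ptime_Nil_eq[OF ptime_replicate] by simp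

lemma ptime_le [ptime_intros]: "ptime f \<Longrightarrow> ptime g \<Longrightarrow> ptime (\<lambda>x. f x \<le> (g x :: nat))"
  using ptime_eq_0[OF ptime_diff] by simp

lemma ptime_less [ptime_intros]: "ptime f \<Longrightarrow> ptime g \<Longrightarrow> ptime (\<lambda>x. f x < (g x :: nat))"
  using ptime_le[OF ptime_Suc] by (simp add: Suc_le_eq)

lemma ptime_eq [ptime_intros]: "ptime f \<Longrightarrow> ptime g \<Longrightarrow> ptime (\<lambda>x. f x = (g x :: nat))"
  using ptime_conj[OF ptime_le ptime_le, of f g g f] by (simp add: eq_iff)

lemma ptime_min [ptime_intros]: "ptime f \<Longrightarrow> ptime g \<Longrightarrow> ptime (\<lambda>x. min (f x) (g x :: nat))"
  and ptime_max [ptime_intros]: "ptime f \<Longrightarrow> ptime g \<Longrightarrow> ptime (\<lambda>x. max (f x) (g x :: nat))"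
  unfolding min_def max_def by (intro ptime_intros; assumption)+

lemma ptime_rev [ptime_intros]: "ptime f \<Longrightarrow> ptime (\<lambda>x. rev (f x))"
proof (rule ptime_comp[of rev])
  have "ptime (\<lambda>xs :: 'b list. fold Cons xs [])"
  proof (rule ptime_fold[where b = "\<lambda>xs. 1 + sz xs"])
    show "sz (y # s) \<le> sz s + (1 + sz xs)" if "y \<in> set xs" for xs s and y :: 'b
      using sz_mem[OF that] by simp
  qed (intro ptime_intros pbd_intros)+
  then show "ptime (rev :: 'b list \<Rightarrow> 'b list)" by (simp add: fold_Cons_rev)
qed

lemma ptime_append [ptime_intros]: "ptime f \<Longrightarrow> ptime g \<Longrightarrow> ptime (\<lambda>x. f x @ g x)"
proof (rule ptime_comp2[of "(@)"])
  have "ptime (\<lambda>p :: 'b list \<times> 'b list. fold Cons (rev (fst p)) (snd p))"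
  proof (rule ptime_fold[where b = "\<lambda>p. 1 + sz (fst p)"])
    show "sz (y # s) \<le> sz s + (1 + sz (fst p))" if "y \<in> set (rev (fst p))"
      for p :: "'b list \<times> 'b list" and s y
      using sz_mem[of y "fst p"] that by simp
  qed (intro ptime_intros pbd_intros ptime_sz)+
  then show "ptime (\<lambda>p :: 'b list \<times> 'b list. fst p @ snd p)" by (simp add: fold_Cons_rev)
qed

text \<open>An element is no larger than the list that contains it, so a bound on environment and
  element becomes one on the environment alone, as \<open>ptime_fold\<close> requires.\<close>

lemma pbd_on_list:
  fixes xs :: "'e::repr \<Rightarrow> 'a::repr list"
  assumes "pbd t" "ptime xs"
  obtains b where "pbd b" "\<And>e x. x \<in> set (xs e) \<Longrightarrow> t (e, x) \<le> b e"
proof -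
  obtain c where c: "\<And>p. t p \<le> (sz p + 1) ^ c" using assms(1) unfolding pbd_def by blast
  show ?thesis
  proof (rule that)
    show "pbd (\<lambda>e. (sz e + sz (xs e) + 2) ^ c)" by (intro pbd_intros ptime_sz assms)
    show "t (e, x) \<le> (sz e + sz (xs e) + 2) ^ c" if "x \<in> set (xs e)" for e x
    proof (rule order_trans[OF c power_mono])
      show "sz (e, x) + 1 \<le> sz e + sz (xs e) + 2" using sz_mem[OF that] by simp
    qed simp
  qed
qed

lemma fold_map_rev: "fold (\<lambda>x acc. f x # acc) xs ys = rev (map f xs) @ ys"
  by (induction xs arbitrary: ys) auto

lemma ptime_map [ptime_intros]:
  fixes xs :: "'e::repr \<Rightarrow> 'a::repr list" and g :: "'e \<Rightarrow> 'a \<Rightarrow> 'b::repr"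
  assumes "ptime (\<lambda>p. g (fst p) (snd p))" "ptime xs"
  shows "ptime (\<lambda>e. map (g e) (xs e))"
proof -
  obtain b where b: "pbd b" "\<And>e x. x \<in> set (xs e) \<Longrightarrow> sz (g e x) \<le> b e"
    using pbd_on_list[OF ptime_sz[OF assms(1)] assms(2)] by (metis fst_conv snd_conv)
  have "ptime (\<lambda>e. fold (\<lambda>x acc. g e x # acc) (xs e) [])"
  proof (rule ptime_fold[where b = "\<lambda>e. 1 + b e"])
    show "ptime (\<lambda>p. g (fst p) (fst (snd p)) # snd (snd p))"
      by (intro ptime_intros ptime_comp2[OF assms(1)])
  qed (use b in \<open>auto intro!: assms pbd_intros ptime_const\<close>)
  then have "ptime (\<lambda>e. rev (fold (\<lambda>x acc. g e x # acc) (xs e) []))" by (rule ptime_rev)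
  then show ?thesis by (simp add: fold_map_rev)
qed

lemma fold_filter_rev:
  "fold (\<lambda>x acc. if P x then x # acc else acc) xs ys = rev (filter P xs) @ ys"
  by (induction xs arbitrary: ys) auto

lemma ptime_filter [ptime_intros]:
  fixes xs :: "'e::repr \<Rightarrow> 'a::repr list"
  assumes "ptime (\<lambda>p. P (fst p) (snd p))" "ptime xs"
  shows "ptime (\<lambda>e. filter (P e) (xs e))"
proof -
  have "ptime (\<lambda>e. fold (\<lambda>x acc. if P e x then x # acc else acc) (xs e) [])"
  proof (rule ptime_fold[where b = "\<lambda>e. 1 + sz (xs e)"])
    show "ptime (\<lambda>p. if P (fst p) (fst (snd p)) then fst (snd p) # snd (snd p) else snd (snd p))"
      by (intro ptime_intros ptime_comp2[OF assms(1)])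
    show "sz (if P e x then x # acc else acc) \<le> sz acc + (1 + sz (xs e))"
      if "x \<in> set (xs e)" for e x and acc :: "'a list"
      using sz_mem[OF that] by simp
  qed (intro assms ptime_intros pbd_intros ptime_sz)+
  then have "ptime (\<lambda>e. rev (fold (\<lambda>x acc. if P e x then x # acc else acc) (xs e) []))"
    by (rule ptime_rev)
  then show ?thesis by (simp add: fold_filter_rev)
qed

lemma ptime_concat [ptime_intros]: "ptime f \<Longrightarrow> ptime (\<lambda>x. concat (f x))"
proof (rule ptime_comp[of concat])
  have "ptime (\<lambda>xss :: 'b list list. fold (\<lambda>xs acc. acc @ xs) xss [])"
  proof (rule ptime_fold[where b = sz])
    show "sz (s @ ys) \<le> sz s + sz xss" if "ys \<in> set xss" for xss s and ys :: "'b list"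
      using sz_mem[OF that] sz_append[of s ys] by simp
  qed (intro ptime_intros pbd_intros)+
  moreover have "fold (\<lambda>xs acc. acc @ xs) xss ys = ys @ concat xss"
    for xss and ys :: "'b list"
    by (induction xss arbitrary: ys) auto
  ultimately show "ptime (concat :: 'b list list \<Rightarrow> 'b list)" by simp
qed

lemma ptime_Ball [ptime_intros]:
  fixes xs :: "'e::repr \<Rightarrow> 'a::repr list"
  assumes "ptime (\<lambda>p. P (fst p) (snd p))" "ptime xs"
  shows "ptime (\<lambda>e. \<forall>x\<in>set (xs e). P e x)"
proof -
  have "ptime (\<lambda>e. filter (\<lambda>x. \<not> P e x) (xs e) = [])"
    by (intro ptime_intros assms)
  then show ?thesis by (simp add: filter_empty_conv)
qed

lemma ptime_Bex [ptime_intros]: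
  fixes xs :: "'e::repr \<Rightarrow> 'a::repr list"
  assumes "ptime (\<lambda>p. P (fst p) (snd p))" "ptime xs"
  shows "ptime (\<lambda>e. \<exists>x\<in>set (xs e). P e x)"
proof -
  have "ptime (\<lambda>e. \<not> (\<forall>x\<in>set (xs e). \<not> P e x))"
    by (intro ptime_intros assms)
  then show ?thesis by simp
qed

lemma ptime_length [ptime_intros]: "ptime f \<Longrightarrow> ptime (\<lambda>x. length (f x))"
proof (rule ptime_comp[of length])
  have "ptime (\<lambda>xs :: 'b list. fold (\<lambda>_. Suc) xs 0)"
    by (rule ptime_fold[where b = "\<lambda>_. 2"]) (intro ptime_intros pbd_intros | simp)+
  moreover have "fold (\<lambda>_. Suc) xs n = length xs + n" for n and xs :: "'b list"
    by (induction xs arbitrary: n) auto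
  ultimately show "ptime (length :: 'b list \<Rightarrow> nat)" by simp
qed

text \<open>The operator \<open>!\<close> is unspecified beyond the end of a list, so no program can
  be given for it; the default \<open>d\<close> makes the lookup total.\<close>

definition lk :: "'a \<Rightarrow> 'a list \<Rightarrow> nat \<Rightarrow> 'a" where
  "lk d xs i = (if i < length xs then xs ! i else d)"

lemma fold_const_rev: "fold (\<lambda>x _. x) (rev xs) d = lk d xs 0"
  by (cases xs) (auto simp: lk_def)

lemma ptime_lk [ptime_intros]:
  fixes d :: "'e::repr \<Rightarrow> 'a::repr"
  assumes "ptime d" "ptime xs" "ptime i"
  shows "ptime (\<lambda>e. lk (d e) (xs e) (i e))"
proof -
  have drop: "ptime (\<lambda>e. drop (i e) (xs e))"
  proof -
    have "ptime (\<lambda>e. fold (\<lambda>_. tl) (replicate (i e) ()) (xs e))"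
    proof (rule ptime_fold[where b = "\<lambda>_. 0"])
      show "sz (tl s) \<le> sz s + 0" for s :: "'a list" by (cases s) auto
    qed (intro ptime_intros pbd_intros assms)+
    moreover have "(tl ^^ n) ys = drop n ys" for n and ys :: "'a list"
      by (induction n) (auto simp: drop_Suc tl_drop)
    ultimately show ?thesis by (simp add: fold_replicate)
  qed
  \<comment> \<open>In the reversed list the head of the dropped list comes last, so it is the
    element that survives.\<close>
  have "ptime (\<lambda>e. fold (\<lambda>x _. x) (rev (drop (i e) (xs e))) (d e))"
  proof (rule ptime_fold[where b = "\<lambda>e. sz (drop (i e) (xs e))"])
    show "sz x \<le> sz s + sz (drop (i e) (xs e))"
      if "x \<in> set (rev (drop (i e) (xs e)))" for e x s
      using sz_mem[of x "drop (i e) (xs e)"] that by simp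
  qed (intro ptime_intros pbd_intros drop assms ptime_sz)+
  then show ?thesis by (rule ptime_cong) (auto simp: fold_const_rev lk_def)
qed

text \<open>The entry that is added is the counter inside the state, so the growth of a step is not
  bounded for arbitrary states and \<open>ptime_fold\<close> does not apply. Along the actual run
  the counter stays below \<open>n\<close>.\<close>

lemma ptime_upt0: "ptime (\<lambda>n. [0..<n])"
proof -
  let ?g = "\<lambda>_ s. (Suc (fst s), fst s # snd s)"
  have fold: "fold ?g (replicate n ()) (0, []) = (n, rev [0..<n])" for n
  proof -
    have "(?g () ^^ n) (0, []) = (n, rev [0..<n])" by (induction n) auto
    then show ?thesis by (simp add: fold_replicate)
  qed
  have "ptime (\<lambda>n. fold ?g (replicate n ()) (0, []))"
  proof (rule ptime_fold_bounded[where B = "\<lambda>n. 1 + sz n + (1 + sz n * (1 + sz n))"])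
    fix n :: nat and ys zs
    assume "replicate n () = ys @ zs"
    then have n: "length ys \<le> n" "ys = replicate (length ys) ()"
      by (metis le_add1 length_append length_replicate)
        (metis (full_types) old.unit.exhaust replicate_eqI)
    have len: "sz (rev [0..<m]) \<le> 1 + m * (1 + sz n)" if "m \<le> n" for m
      using that by (induction m) (auto simp: sz_nat)
    have "sz (rev [0..<length ys]) \<le> 1 + length ys * (1 + sz n)"
      by (rule len) (rule n)
    also have "\<dots> \<le> 1 + sz n * (1 + sz n)"
      using n(1) by (intro add_mono mult_mono) (auto simp: sz_nat)
    finally show "sz (fold ?g ys (0, [])) \<le> 1 + sz n + (1 + sz n * (1 + sz n))"
      using n(1) by (subst n(2), subst fold) (simp add: sz_nat)
  qed (intro ptime_intros pbd_intros)+
  then have "ptime (\<lambda>n. rev (snd (fold ?g (replicate n ()) (0, []))))"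
    by (intro ptime_rev ptime_snd)
  then show ?thesis by (rule ptime_cong) (simp only: fold, simp)
qed

lemma ptime_upt [ptime_intros]:
  assumes "ptime f" "ptime g"
  shows "ptime (\<lambda>x. [f x..<g x])"
proof -
  have "ptime (\<lambda>x. map (\<lambda>i. f x + i) [0..<g x - f x])"
    by (intro ptime_intros ptime_comp[OF assms(1)] ptime_comp[OF ptime_upt0] assms)
  moreover have "map (\<lambda>i. m + i) [0..<n - m] = [m..<n]" for m n
    using map_add_upt[of m "n - m"] by (cases "m \<le> n") (auto simp: add.commute)
  ultimately show ?thesis by simp
qed

subsection \<open>Composing reductions\<close>

text \<open>Holds because each operation is charged the sizes of the trees it touches. It bounds the
  output of a reduction in terms of its running time.\<close>

lemma exec_dsize:
  "exec p s t s' \<Longrightarrow> (\<And>j. dsize (s j) \<le> B) \<Longrightarrow> dsize (s' j) \<le> B + t"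
proof (induction arbitrary: B j rule: exec.induct)
  case (Left x y s)
  then show ?case using dsize_left[of "s y"] by (auto intro: trans_le_add1 le_SucI)
next
  case (Right x y s)
  then show ?case using dsize_right[of "s y"] by (auto intro: trans_le_add1 le_SucI)
next
  case (Seq c1 s1 t1 s2 c2 t2 s3)
  from Seq.IH(2)[of "B + t1", OF Seq.IH(1)] Seq.prems show ?case by (simp add: add.assoc)
next
  case (WhileTrue s1 x c t1 s2 t2 s3)
  from WhileTrue.IH(2)[of "B + t1", OF WhileTrue.IH(1)] WhileTrue.prems show ?case
    by (simp add: add.assoc) (meson le_SucI order_trans)
qed (auto intro: trans_le_add1 le_SucI)

fun regs :: "com \<Rightarrow> nat set" where
  "regs (Clear x) = {x}"
| "regs (Copy x y) = {x, y}"
| "regs (MkNode x y z) = {x, y, z}"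
| "regs (Left x y) = {x, y}"
| "regs (Right x y) = {x, y}"
| "regs (Seq c1 c2) = regs c1 \<union> regs c2"
| "regs (Cond x c1 c2) = {x} \<union> regs c1 \<union> regs c2"
| "regs (While x c) = {x} \<union> regs c"

lemma finite_regs: "finite (regs p)"
  by (induction p) auto

text \<open>Allows a register that the program does not mention to keep a value across its
  run.\<close>

lemma exec_frame:
  "exec p s t s' \<Longrightarrow> m \<notin> regs p \<Longrightarrow> exec p (s(m := v)) t (s'(m := v))"
proof (induction rule: exec.induct)
  case (Clear x s)
  then have "(s(x := Leaf))(m := v) = (s(m := v))(x := Leaf)" by (simp add: fun_eq_iff)
  then show ?case using exec.Clear[of x "s(m := v)"] by metis
next
  case (Copy x y s)
  then have "(s(x := s y))(m := v) = (s(m := v))(x := (s(m := v)) y)" "(s(m := v)) y = s y"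
    by (simp_all add: fun_eq_iff)
  then show ?case using exec.Copy[of x y "s(m := v)"] by metis
next
  case (MkNode x y z s)
  then have "(s(x := Node (s y) (s z)))(m := v) =
      (s(m := v))(x := Node ((s(m := v)) y) ((s(m := v)) z))"
      "(s(m := v)) y = s y" "(s(m := v)) z = s z"
    by (simp_all add: fun_eq_iff)
  then show ?case using exec.MkNode[of x y z "s(m := v)"] by metis
next
  case (Left x y s)
  then have "(s(x := left (s y)))(m := v) = (s(m := v))(x := left ((s(m := v)) y))"
      "(s(m := v)) y = s y"
    by (simp_all add: fun_eq_iff)
  then show ?case using exec.Left[of x y "s(m := v)"] by metis
next
  case (Right x y s)
  then have "(s(x := right (s y)))(m := v) = (s(m := v))(x := right ((s(m := v)) y))"
      "(s(m := v)) y = s y"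
    by (simp_all add: fun_eq_iff)
  then show ?case using exec.Right[of x y "s(m := v)"] by metis
next
  case (Seq c1 s1 t1 s2 c2 t2 s3)
  then show ?case using exec.Seq by simp
next
  case (CondTrue s x c1 t s' c2)
  then show ?case using exec.CondTrue[of "s(m := v)" x c1 t "s'(m := v)" c2] by (simp add: fun_upd_def)
next
  case (CondFalse s x c2 t s' c1)
  then show ?case using exec.CondFalse[of "s(m := v)" x c2 t "s'(m := v)" c1] by (simp add: fun_upd_def)
next
  case (WhileFalse s x c)
  then show ?case using exec.WhileFalse[of "s(m := v)" x c] by (simp add: fun_upd_def)
next
  case (WhileTrue s1 x c t1 s2 t2 s3)
  then show ?case using exec.WhileTrue[of "s1(m := v)" x c t1 "s2(m := v)" t2 "s3(m := v)"] by (simp add: fun_upd_def)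
qed

text \<open>Only register 0 is constrained, so the program may be started on whatever another
  program has left in the remaining registers.\<close>

lemma ptime_program:
  assumes "ptime f"
  obtains p c where "\<And>s x. s 0 = repr x \<Longrightarrow>
    \<exists>t s'. exec p s t s' \<and> s' 0 = repr (f x) \<and> t \<le> (sz x + 1) ^ c"
proof -
  obtain t P where *: "pbd t" "\<And>r s x. s r = repr x \<Longrightarrow> runs (P r) r s (repr (f x)) (t x)"
    using assms by (rule ptimeE) blast
  obtain c where c: "\<And>x. t x \<le> (sz x + 1) ^ c" using *(1) unfolding pbd_def by blast
  show ?thesis
  proof (rule that)
    show "\<exists>t s'. exec (P 0) s t s' \<and> s' 0 = repr (f x) \<and> t \<le> (sz x + 1) ^ c"
      if "s 0 = repr x" for s x
      using *(2)[of s 0 x, OF that] c[of x] unfolding runs_def ex_def by (meson order_trans)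
  qed
qed

text \<open>The time bound of a composed reduction depends on both \<open>k\<close> and
  \<open>f k\<close>, while a program for \<open>f\<close> may destroy its argument. A copy is
  therefore kept in a register outside \<open>regs p\<close>.\<close>

lemma computable_nat_comp:
  assumes "computable_nat f" "ptime (\<lambda>p :: nat \<times> nat. h (fst p) (snd p) :: nat)"
  shows "computable_nat (\<lambda>k. h k (f k))"
proof -
  obtain p where p: "\<And>n. \<exists>t. computes_in p (enc_nat n) (enc_nat (f n)) t"
    using assms(1) unfolding computable_nat_def by blast
  obtain q c where q: "\<And>s x. s 0 = repr x \<Longrightarrow>
      \<exists>t s'. exec q s t s' \<and> s' 0 = repr (h (fst x) (snd x)) \<and> t \<le> (sz x + 1) ^ c"
    using ptime_program[OF assms(2)] by blast
  obtain m where m: "m \<notin> regs p \<union> {0}"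
    using ex_new_if_finite[of "regs p \<union> {0}"] finite_regs by auto
  let ?p = "Seq (Copy m 0) (Seq p (Seq (MkNode 0 m 0) q))"
  have "\<exists>t. computes_in ?p (enc_nat n) (enc_nat (h n (f n))) t" for n
  proof -
    let ?s = "(\<lambda>_. Leaf)(0 := enc_nat n)"
    obtain t s' where s': "exec p ?s t s'" "s' 0 = enc_nat (f n)"
      using p[of n] unfolding computes_in_def by blast
    have 1: "exec (Copy m 0) ?s (1 + dsize (?s 0)) (?s(m := enc_nat n))"
      using exec.Copy[of m 0 ?s] by simp
    have 2: "exec p (?s(m := enc_nat n)) t (s'(m := enc_nat n))"
      using exec_frame[OF s'(1)] m by simp
    let ?s2 = "s'(m := enc_nat n)"
    note 3 = exec.MkNode[of 0 m 0 ?s2]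
    let ?s3 = "?s2(0 := Node (?s2 m) (?s2 0))"
    have "?s3 0 = repr (n, f n)" using m s'(2) by (simp add: repr_nat_def)
    from q[of ?s3, OF this] obtain t4 s4 where
      4: "exec q ?s3 t4 s4" "s4 0 = repr (h n (f n))" by auto
    from exec.Seq[OF 1 exec.Seq[OF 2 exec.Seq[OF 3 4(1)]]] 4(2) show ?thesis
      unfolding computes_in_def by (auto simp: repr_nat_def)
  qed
  then show ?thesis unfolding computable_nat_def by blast
qed

lemma fpt_reducible_ptime:
  fixes red :: "data \<times> nat \<Rightarrow> data \<times> nat" and G :: "nat \<Rightarrow> nat"
  assumes "fpt_reducible A B" "ptime red" "ptime G" "mono G"
    and G: "\<And>x k. snd (red (x, k)) \<le> G k"
    and red: "\<And>x k. (x, k) \<in> B \<longleftrightarrow> red (x, k) \<in> C"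
  shows "fpt_reducible A C"
proof -
  obtain p f g c where f: "computable_nat f" and g: "computable_nat g"
    and p: "\<And>x k. \<exists>x' k' t. computes_in p (Node x (enc_nat k)) (Node x' (enc_nat k')) t \<and>
        t \<le> f k * dsize x ^ c \<and> k' \<le> g k \<and> ((x, k) \<in> A \<longleftrightarrow> (x', k') \<in> B)"
    using assms(1) unfolding fpt_reducible_def by blast
  obtain q d where q: "\<And>s x. s 0 = repr x \<Longrightarrow>
      \<exists>t s'. exec q s t s' \<and> s' 0 = repr (red x) \<and> t \<le> (sz x + 1) ^ d"
    using ptime_program[OF assms(2)] by blast
  \<comment> \<open>The intermediate instance has size below
    \<open>?M = (2 * k + 4 + f k) * dsize x ^ (c + 1)\<close>: the input of \<open>p\<close> has
    size \<open>dsize x + 2 * k + 2\<close>, and the output exceeds this by at most the time of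
    \<open>p\<close>. Both times add up to at most \<open>?M + ?M ^ d\<close>, which is at most
    \<open>?M ^ (d + 2)\<close> as \<open>?M\<close> is at least 2.\<close>
  let ?f = "\<lambda>k. (2 * k + 4 + f k) ^ (d + 2)"
  have "ptime (\<lambda>p :: nat \<times> nat. (2 * fst p + 4 + snd p) ^ (d + 2))"
    by (intro ptime_intros)
  from computable_nat_comp[OF f this] have f': "computable_nat ?f" .
  have g': "computable_nat (\<lambda>k. G (g k))"
    by (rule computable_nat_comp[OF g]) (intro ptime_comp[OF assms(3)] ptime_intros)
  have "\<exists>x' k' t. computes_in (Seq p q) (Node x (enc_nat k)) (Node x' (enc_nat k')) t \<and>
      t \<le> ?f k * dsize x ^ ((c + 1) * (d + 2)) \<and> k' \<le> G (g k) \<and>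
      ((x, k) \<in> A \<longleftrightarrow> (x', k') \<in> C)" for x k
  proof -
    obtain x' k' t where 1: "computes_in p (Node x (enc_nat k)) (Node x' (enc_nat k')) t"
      "t \<le> f k * dsize x ^ c" "k' \<le> g k" "(x, k) \<in> A \<longleftrightarrow> (x', k') \<in> B"
      using p by blast
    let ?s = "(\<lambda>_. Leaf)(0 := Node x (enc_nat k))"
    obtain s' where s': "exec p ?s t s'" "s' 0 = repr (x', k')"
      using 1(1) unfolding computes_in_def by (auto simp: repr_nat_def)
    obtain u s'' where s'': "exec q s' u s''" "s'' 0 = repr (red (x', k'))"
        "u \<le> (sz (x', k') + 1) ^ d"
      using q[of s' "(x', k')", OF s'(2)] by blast
    let ?N = "dsize x" let ?M = "(2 * k + 4 + f k) * ?N ^ (c + 1)"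
    have pow: "1 \<le> ?N ^ c" "?N \<le> ?N ^ (c + 1)" "?N ^ c \<le> ?N ^ (c + 1)"
      using power_increasing[of 1 "c + 1" ?N] power_increasing[of c "c + 1" ?N] by simp_all
    have "sz (x', k') \<le> dsize (Node x (enc_nat k)) + t"
      using exec_dsize[OF s'(1), of "dsize (Node x (enc_nat k))" 0] s'(2) by simp
    also have "dsize (enc_nat k) = 2 * k + 1" using sz_nat[of k] by (simp add: repr_nat_def)
    then have "dsize (Node x (enc_nat k)) = ?N + 2 * k + 2" by simp
    also have "?N + 2 * k + 2 + t \<le> ?N + 2 * k + 2 + f k * ?N ^ c" using 1(2) by simp
    finally have "sz (x', k') + 1 \<le> ?N + (2 * k + 3) * 1 + f k * ?N ^ c" by simp
    also have "\<dots> \<le> ?N ^ (c + 1) + (2 * k + 3) * ?N ^ (c + 1) + f k * ?N ^ (c + 1)"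
      using pow by (intro add_mono mult_mono) auto
    also have "\<dots> = ?M" by (simp add: algebra_simps)
    finally have "u \<le> ?M ^ d" using s''(3) power_mono order_trans by blast
    moreover have M: "2 \<le> ?M"
    proof -
      have "2 * 1 \<le> ?M" by (rule mult_mono) (use pow in auto)
      then show ?thesis by simp
    qed
    moreover have "t \<le> ?M"
    proof (rule order_trans[OF 1(2)])
      show "f k * ?N ^ c \<le> ?M" by (rule mult_mono) (use pow in auto)
    qed
    moreover have "?M + ?M ^ d \<le> ?M ^ (d + 2)"
    proof -
      have *: "m + m ^ d \<le> m ^ (d + 2)" if m: "2 \<le> m" for m :: nat
      proof -
        have "m ^ 1 \<le> m ^ (d + 1)" "m ^ d \<le> m ^ (d + 1)"
          by (rule power_increasing; use m in simp)+
        then have "m + m ^ d \<le> 2 * m ^ (d + 1)" unfolding power_one_right by linarith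
        also have "\<dots> \<le> m * m ^ (d + 1)" by (rule mult_right_mono[OF m]) simp
        finally show ?thesis by simp
      qed
      show ?thesis by (rule *[OF M])
    qed
    ultimately have "t + u \<le> ?M ^ (d + 2)" by linarith
    also have "\<dots> = ?f k * ?N ^ ((c + 1) * (d + 2))" by (simp only: power_mult_distrib power_mult)
    finally have time: "t + u \<le> ?f k * ?N ^ ((c + 1) * (d + 2))" .
    obtain y l where yl: "red (x', k') = (y, l)" by (cases "red (x', k')")
    have "l \<le> G k'" using G[of x' k'] yl by simp
    also have "\<dots> \<le> G (g k)" using assms(4) 1(3) by (rule monoD)
    finally have "l \<le> G (g k)" .
    moreover have "computes_in (Seq p q) (Node x (enc_nat k)) (Node y (enc_nat l)) (t + u)"
      unfolding computes_in_def using exec.Seq[OF s'(1) s''(1)] s''(2) yl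
      by (auto simp: repr_nat_def)
    moreover have "(x, k) \<in> A \<longleftrightarrow> (y, l) \<in> C" using 1(4) red[of x' k'] yl by simp
    ultimately show ?thesis using time by blast
  qed
  then show ?thesis unfolding fpt_reducible_def using f' g' by blast
qed

section \<open>Token moving\<close>

text \<open>
  Tokens are identified by their initial vertices: \<open>pos ms x\<close> is the final vertex of the token
  starting on \<open>x\<close>, and \<open>cnt ms x\<close> the number of its moves.
\<close>

fun pos :: "'a move list \<Rightarrow> 'a \<Rightarrow> 'a" where
  "pos [] x = x"
| "pos ((s, t) # ms) x = pos ms (if x = s then t else x)"

fun cnt :: "'a move list \<Rightarrow> 'a \<Rightarrow> nat" where
  "cnt [] x = 0"
| "cnt ((s, t) # ms) x = (if x = s then Suc (cnt ms t) else cnt ms x)"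

lemma pos_Nil [simp]: "pos [] = (\<lambda>x. x)"
  by (simp add: fun_eq_iff)

lemma execute_move_map: "execute_move c (s, t) = map (\<lambda>x. if x = s then t else x) c"
  by (simp add: execute_move_def)

lemma foldl_execute_move: "foldl execute_move c ms = map (pos ms) c"
  by (induction ms arbitrary: c) (auto simp: execute_move_map fun_eq_iff)

lemma pos_append: "pos (ms @ ns) x = pos ns (pos ms x)"
  by (induction ms arbitrary: x) auto

lemma set_execute_move:
  "s \<in> set c \<Longrightarrow> set (execute_move c (s, t)) = insert t (set c - {s})"
  by (auto simp: execute_move_map)

lemma distinct_execute_move:
  "distinct c \<Longrightarrow> t \<notin> set c \<Longrightarrow> distinct (execute_move c (s, t))"
  by (auto simp: execute_move_map distinct_map inj_on_def)

lemma valid_moveE: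
  assumes "valid_move V E c (s, t)"
  obtains p where "s \<in> set c" "t \<in> V" "t \<notin> set c" "p \<noteq> []" "hd p = s" "last p = t"
    "distinct p" "set p \<subseteq> V" "successively (\<lambda>u v. {u, v} \<in> E) p" "set (tl p) \<inter> set c = {}"
proof -
  from assms obtain p where *: "s \<in> set c" "t \<in> V" "t \<notin> set c" "free_path V E c s p t"
    by (auto simp: valid_move_def)
  then have p: "p \<noteq> []" "hd p = s" "last p = t" "distinct p" "set p \<subseteq> V"
      "successively (\<lambda>u v. {u, v} \<in> E) p" "set (butlast (tl p)) \<inter> set c = {}"
    by (auto simp: free_path_def path_between_def)
  have "tl p \<noteq> []" using p(1-3) * by (cases p) auto
  then have "tl p = butlast (tl p) @ [t]" using p(3) by (metis append_butlast_last_id last_tl)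
  then have "set (tl p) = insert t (set (butlast (tl p)))"
    by (metis Un_insert_right list.set(1) list.simps(15) set_append sup_bot_right)
  then have "set (tl p) \<inter> set c = {}" using p(7) *(3) by auto
  with p * that show ?thesis by blast
qed

text \<open>Makes the bound on the length comparable with lower bounds for single tokens.\<close>

lemma sum_cnt:
  "valid_sequence V E c ms \<Longrightarrow> distinct c \<Longrightarrow> (\<Sum>x\<in>set c. cnt ms x) = length ms"
proof (induction ms arbitrary: c)
  case (Cons m ms)
  obtain s t where m: "m = (s, t)" by fastforce
  from Cons.prems m have st: "s \<in> set c" "t \<notin> set c" by (auto elim: valid_moveE)
  let ?c = "execute_move c (s, t)"
  have "(\<Sum>x\<in>set ?c. cnt ms x) = length ms"
    using Cons.prems m st by (intro Cons.IH distinct_execute_move) auto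
  moreover have "(\<Sum>x\<in>set ?c. cnt ms x) = cnt ms t + (\<Sum>x\<in>set c - {s}. cnt ms x)"
    using st by (simp add: set_execute_move)
  moreover have "(\<Sum>x\<in>set c. cnt (m # ms) x) = Suc (cnt ms t) + (\<Sum>x\<in>set c - {s}. cnt ms x)"
    using st by (simp add: m sum.remove[of "set c" s])
  ultimately show ?case by simp
qed simp

lemma cnt_0_pos: "cnt ms x = 0 \<Longrightarrow> pos ms x = x"
  by (induction ms arbitrary: x) (auto split: if_splits)

text \<open>\<open>c'\<close> is the configuration just before the only move of the token, which
  therefore leads straight from its initial to its final vertex. Tokens that never move have not
  left their vertices by then.\<close>

lemma cnt_1E:
  assumes "valid_sequence V E c ms" "configuration V c" "x \<in> set c" "cnt ms x = 1"
  obtains c' where "configuration V c'" "length c' = length c" "valid_move V E c' (x, pos ms x)"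
    "\<And>y. y \<in> set c \<Longrightarrow> cnt ms y = 0 \<Longrightarrow> y \<in> set c'"
proof -
  from assms have "\<exists>c'. configuration V c' \<and> length c' = length c \<and> valid_move V E c' (x, pos ms x) \<and>
      (\<forall>y\<in>set c. cnt ms y = 0 \<longrightarrow> y \<in> set c')"
  proof (induction ms arbitrary: c)
    case (Cons m ms)
    obtain s t where m: "m = (s, t)" by fastforce
    from Cons.prems m have st: "s \<in> set c" "t \<notin> set c" "t \<in> V" by (auto elim: valid_moveE)
    let ?c = "execute_move c (s, t)"
    show ?case
    proof (cases "x = s")
      case True
      then have "pos (m # ms) x = t"
        using Cons.prems(4) cnt_0_pos[of ms t] by (simp add: m)
      then show ?thesis
        using Cons.prems m True by (intro exI[of _ c]) auto
    next
      case False
      have "\<exists>c'. configuration V c' \<and> length c' = length ?c \<and> valid_move V E c' (x, pos ms x) \<and>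
        (\<forall>y\<in>set ?c. cnt ms y = 0 \<longrightarrow> y \<in> set c')"
      proof (rule Cons.IH)
        show "configuration V ?c"
          using Cons.prems(2) st
          by (auto simp: configuration_def distinct_execute_move set_execute_move)
      qed (use Cons.prems m False st in \<open>auto simp: set_execute_move\<close>)
      then show ?thesis
        using False st by (auto simp: m set_execute_move execute_move_map split: if_splits)
    qed
  qed simp
  then show ?thesis using that by blast
qed

text \<open>A single move would end where it started, but the target of a valid move is
  free.\<close>

lemma cnt_ge_2:
  assumes "valid_sequence V E c ms" "configuration V c" "x \<in> set c" "pos ms x = x" "cnt ms x \<noteq> 0"
  shows "cnt ms x \<ge> 2"
proof (rule ccontr)
  assume "\<not> cnt ms x \<ge> 2"
  then have "cnt ms x = 1" using assms(5) by simp
  from cnt_1E[OF assms(1-3) this] obtain c' where "valid_move V E c' (x, pos ms x)" by blast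
  then show False using assms(4) by (auto elim: valid_moveE)
qed

text \<open>The token that moves first cannot go to its destination, which is still occupied, so it has to
  move twice.\<close>

lemma cnt_swap:
  assumes "valid_sequence V E c ms" "x \<in> set c" "y \<in> set c" "x \<noteq> y" "pos ms x = y" "pos ms y = x"
  shows "cnt ms x + cnt ms y \<ge> 3"
  using assms
proof (induction ms arbitrary: c)
  case (Cons m ms)
  obtain s t where m: "m = (s, t)" by fastforce
  from Cons.prems m have st: "s \<in> set c" "t \<notin> set c" "t \<in> V" by (auto elim: valid_moveE)
  consider "s = x" | "s = y" | "s \<noteq> x" "s \<noteq> y" by blast
  then show ?case
  proof cases
    case 1
    then have "pos ms t = y" "pos ms y = x" using Cons.prems m by auto
    then show ?thesis using 1 m cnt_0_pos[of ms t] cnt_0_pos[of ms y] Cons.prems st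
      by (cases "cnt ms t = 0"; cases "cnt ms y = 0") auto
  next
    case 2
    then have "pos ms t = x" "pos ms x = y" using Cons.prems m by auto
    then show ?thesis using 2 m cnt_0_pos[of ms t] cnt_0_pos[of ms x] Cons.prems st
      by (cases "cnt ms t = 0"; cases "cnt ms x = 0") auto
  next
    case 3
    then show ?thesis using Cons.IH[of "execute_move c (s, t)"] Cons.prems st m
      by (auto simp: set_execute_move)
  qed
qed simp

section \<open>Barriers of tokens that never move\<close>

lemma path_leaves:
  assumes "successively R p" "p \<noteq> []" "hd p \<in> A" "last p \<notin> A"
  obtains u w where "u \<in> set p" "w \<in> set (tl p)" "u \<in> A" "w \<notin> A" "R u w"
proof -
  from assms have "\<exists>u w. u \<in> set p \<and> w \<in> set (tl p) \<and> u \<in> A \<and> w \<notin> A \<and> R u w"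
  proof (induction p rule: induct_list012)
    case (3 x y zs)
    then show ?case by (cases "y \<in> A") auto
  qed auto
  then show ?thesis using that by blast
qed

text \<open>Every edge out of \<open>A\<close> ends in \<open>B\<close>, whose vertices remain
  occupied, and all vertices of the path of a move after its start are free. So no path of a move
  leaves \<open>A\<close>.\<close>

lemma pos_confined:
  assumes "valid_sequence V E c ms" "x \<in> set c" "x \<in> A" "B \<subseteq> set c"
    and "\<And>b. b \<in> B \<Longrightarrow> cnt ms b = 0"
    and "\<And>u w. {u, w} \<in> E \<Longrightarrow> u \<in> A \<Longrightarrow> w \<notin> A \<Longrightarrow> w \<in> B"
  shows "pos ms x \<in> A"
  using assms(1-5)
proof (induction ms arbitrary: c x)
  case (Cons m ms)
  obtain s t where m: "m = (s, t)" by fastforce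
  from Cons.prems(1) m obtain p where st: "s \<in> set c" "t \<notin> set c" and
    p: "p \<noteq> []" "hd p = s" "last p = t" "successively (\<lambda>u v. {u, v} \<in> E) p"
      "set (tl p) \<inter> set c = {}"
    by (auto elim: valid_moveE)
  have sB: "s \<notin> B" using Cons.prems(5)[of s] m by auto
  let ?x = "if x = s then t else x"
  have "?x \<in> A"
  proof (cases "x = s")
    case True
    have "t \<in> A"
    proof (rule ccontr)
      assume "t \<notin> A"
      with p True Cons.prems(3) obtain u w where
        "w \<in> set (tl p)" "u \<in> A" "w \<notin> A" "{u, w} \<in> E"
        by (metis (mono_tags, lifting) path_leaves)
      then show False using assms(6) Cons.prems(4) p(5) by blast
    qed
    then show ?thesis using True by simp
  qed (use Cons.prems in auto)
  moreover have "cnt ms b = 0" if "b \<in> B" for b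
    using Cons.prems(5)[OF that] that sB m by (auto split: if_splits)
  ultimately have "pos ms ?x \<in> A"
    using Cons.prems sB st m
    by (intro Cons.IH[of "execute_move c (s, t)"]) (auto simp: set_execute_move)
  then show ?case by (simp add: m)
qed simp

section \<open>Sequences of moves that work for all labellings and can be undone\<close>

text \<open>
  The moves must be valid for every labelling of the occupied set \<open>A\<close>, since an arrangement will be
  undone after the tokens have been permuted.
\<close>

definition tm_reach :: "'a set \<Rightarrow> 'a set set \<Rightarrow> nat \<Rightarrow> 'a set \<Rightarrow> ('a \<Rightarrow> 'a) \<Rightarrow> bool" where
  "tm_reach V E k A f \<longleftrightarrow> (\<exists>ms. length ms = k \<and>
    (\<forall>c. set c = A \<longrightarrow> valid_sequence V E c ms) \<and> (\<forall>x\<in>A. pos ms x = f x))"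

lemma valid_sequence_append:
  "valid_sequence V E c (ms @ ns) \<longleftrightarrow>
    valid_sequence V E c ms \<and> valid_sequence V E (map (pos ms) c) ns"
proof (induction ms arbitrary: c)
  case (Cons m ms)
  have "map (pos (m # ms)) c = map (pos ms) (execute_move c m)"
    by (cases m) (simp add: execute_move_map)
  then show ?case using Cons.IH[of "execute_move c m"] by (simp del: pos.simps)
qed simp

lemma tm_reach_0: "(\<And>x. x \<in> A \<Longrightarrow> f x = x) \<Longrightarrow> tm_reach V E 0 A f"
  unfolding tm_reach_def by (intro exI[of _ "[]"]) auto

lemma tm_reach_trans:
  assumes "tm_reach V E k A f" "tm_reach V E l (f ` A) g" "\<And>x. x \<in> A \<Longrightarrow> h x = g (f x)"
  shows "tm_reach V E (k + l) A h"
proof -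
  obtain ms ns where *: "length ms = k" "length ns = l"
      "\<forall>c. set c = A \<longrightarrow> valid_sequence V E c ms" "\<forall>x\<in>A. pos ms x = f x"
      "\<forall>c. set c = f ` A \<longrightarrow> valid_sequence V E c ns" "\<forall>x\<in>f ` A. pos ns x = g x"
    using assms(1,2) unfolding tm_reach_def by blast
  then show ?thesis
    unfolding tm_reach_def using assms(3)
    by (intro exI[of _ "ms @ ns"]) (auto simp: valid_sequence_append pos_append)
qed

text \<open>Reachability over free vertices composes by transitivity; a simple path is extracted
  only once, in \<open>free_step_path\<close>.\<close>

definition free_step :: "'a set \<Rightarrow> 'a set set \<Rightarrow> 'a set \<Rightarrow> ('a \<times> 'a) set" where
  "free_step V E A = {(u, w). {u, w} \<in> E \<and> w \<in> V \<and> w \<notin> A}"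

lemma free_step_path:
  assumes "(s, t) \<in> (free_step V E A)\<^sup>*" "s \<in> V"
  shows "\<exists>p. p \<noteq> [] \<and> hd p = s \<and> last p = t \<and> set p \<subseteq> V \<and> distinct p \<and>
    successively (\<lambda>u v. {u, v} \<in> E) p \<and> set (tl p) \<inter> A = {}"
  using assms(1)
proof (induction rule: rtrancl_induct)
  case base
  then show ?case using assms(2) by (intro exI[of _ "[s]"]) auto
next
  case (step u w)
  then obtain p where p: "p \<noteq> []" "hd p = s" "last p = u" "set p \<subseteq> V" "distinct p"
      "successively (\<lambda>u v. {u, v} \<in> E) p" "set (tl p) \<inter> A = {}" by blast
  have w: "{u, w} \<in> E" "w \<in> V" "w \<notin> A" using step(2) by (auto simp: free_step_def)
  show ?case
  proof (cases "w \<in> set p")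
    case False
    then show ?thesis
      using p w by (intro exI[of _ "p @ [w]"]) (auto simp: successively_append_iff)
  next
    case True
    \<comment> \<open>A vertex visited before is reached by a prefix of the path; cutting there
      keeps the path simple.\<close>
    then obtain p1 p2 where "p = (p1 @ [w]) @ p2" using split_list[OF True] by auto
    then show ?thesis
      using p w by (intro exI[of _ "p1 @ [w]"])
        (cases p1; auto simp: successively_append_iff successively_Cons hd_append split: if_splits)
  qed
qed

lemma tm_reach_1:
  assumes "s \<in> A" "s \<in> V" "t \<in> V" "t \<notin> A" "(s, t) \<in> (free_step V E A)\<^sup>*"
    and "\<And>x. x \<in> A \<Longrightarrow> f x = (if x = s then t else x)"
  shows "tm_reach V E 1 A f"
proof -
  from free_step_path[OF assms(5,2)] obtain p where p: "p \<noteq> []" "hd p = s" "last p = t"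
    "set p \<subseteq> V" "distinct p" "successively (\<lambda>u v. {u, v} \<in> E) p" "set (tl p) \<inter> A = {}" by blast
  have "set (butlast (tl p)) \<inter> A = {}" using p(7) by (auto dest: in_set_butlastD)
  then have "valid_move V E c (s, t)" if "set c = A" for c
    unfolding valid_move_def free_path_def path_between_def using assms p that by auto
  then show ?thesis
    unfolding tm_reach_def using assms(6) by (intro exI[of _ "[(s, t)]"]) auto
qed

text \<open>A move is undone along the same path backwards: only its two ends have changed their
  state, and the inner vertices are as free as before. The induction undoes the later moves first
  and the first move last.\<close>

lemma tm_reach_reverse:
  assumes "tm_reach V E k A f" "A \<subseteq> V" "finite A"
  shows "\<exists>g. tm_reach V E k (f ` A) g \<and> (\<forall>x\<in>A. g (f x) = x)"
proof -
  have rev: "\<exists>g. tm_reach V E (length ms) (pos ms ` A) g \<and> (\<forall>x\<in>A. g (pos ms x) = x)"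
    if "\<And>c. set c = A \<Longrightarrow> valid_sequence V E c ms" "A \<subseteq> V" "finite A" for ms
    using that
  proof (induction ms arbitrary: A)
    case Nil
    then show ?case by (intro exI[of _ id]) (auto intro: tm_reach_0)
  next
    case (Cons m ms)
    obtain s t where m: "m = (s, t)" by fastforce
    obtain c where c: "set c = A" using Cons.prems(3) finite_list by blast
    then have vm: "valid_move V E c (s, t)" using Cons.prems(1) m by auto
    then obtain p where st: "s \<in> A" "t \<in> V" "t \<notin> A" and
      p: "p \<noteq> []" "hd p = s" "last p = t" "distinct p" "set p \<subseteq> V"
        "successively (\<lambda>u v. {u, v} \<in> E) p" "set (tl p) \<inter> A = {}"
      using c by (auto elim: valid_moveE)
    let ?A = "insert t (A - {s})" let ?h = "\<lambda>x. if x = s then t else x"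
    have hA: "?h ` A = ?A" using st by auto
    \<comment> \<open>A labelling of the occupied set after the first move arises from one of
      \<open>A\<close>: the token on \<open>t\<close> is put back on \<open>s\<close>. This needs
      validity for all labellings of \<open>A\<close>.\<close>
    have vs: "valid_sequence V E d ms" if "set d = ?A" for d
    proof -
      have "execute_move (map (\<lambda>x. if x = t then s else x) d) (s, t) =
          map (\<lambda>x. if (if x = t then s else x) = s then t else if x = t then s else x) d"
        by (simp add: execute_move_map)
      also have "\<dots> = d" by (rule map_idI) (use that in auto)
      finally have "execute_move (map (\<lambda>x. if x = t then s else x) d) (s, t) = d" .
      moreover have "set (map (\<lambda>x. if x = t then s else x) d) = A"
        using that st by auto
      ultimately show ?thesis using Cons.prems(1) m by (metis valid_sequence.simps(2))
    qed
    have "?A \<subseteq> V" "finite ?A" using Cons.prems st by auto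
    from Cons.IH[of ?A, OF vs this] obtain g where
      g: "tm_reach V E (length ms) (pos ms ` ?A) g" "\<forall>x\<in>?A. g (pos ms x) = x"
      by blast
    have gA: "g ` pos ms ` ?A = ?A"
    proof -
      have "(\<lambda>x. g (pos ms x)) ` ?A = (\<lambda>x. x) ` ?A" by (rule image_cong) (use g(2) in blast)+
      then show ?thesis by (simp only: image_image image_ident)
    qed
    have pA: "pos (m # ms) ` A = pos ms ` ?A"
      unfolding hA[symmetric] image_image m by (rule image_cong[OF refl pos.simps(2)])
    have undo: "tm_reach V E 1 ?A (\<lambda>x. if x = t then s else x)"
    proof -
      have sucE: "successively (\<lambda>u v. {u, v} \<in> E) (rev p)"
        using p(6) by (simp add: successively_rev insert_commute)
      have "set (butlast (tl (rev p))) \<inter> ?A = {}"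
      proof -
        obtain q where q: "p = s # q" using p(1,2) by (cases p) auto
        then have "q \<noteq> []" using p(3) st by auto
        then obtain q' where "q = q' @ [t]" using p(3) q by (metis append_butlast_last_id last_ConsR)
        then show ?thesis using p(4,7) q by auto
      qed
      then have "free_path V E d t (rev p) s" if "set d = ?A" for d
        unfolding free_path_def path_between_def that
        using p(1-5) sucE by (simp add: hd_rev last_rev)
      moreover have "t \<in> ?A" "s \<in> V - ?A" using st Cons.prems(2) by auto
      ultimately have "valid_move V E d (t, s)" if "set d = ?A" for d
        unfolding valid_move_def prod.case that using that by blast
      then show ?thesis
        unfolding tm_reach_def by (intro exI[of _ "[(t, s)]"]) auto
    qed
    have "tm_reach V E (length ms + 1) (pos ms ` ?A) (\<lambda>x. if g x = t then s else g x)"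
      by (rule tm_reach_trans[OF g(1), of 1 "\<lambda>x. if x = t then s else x"])
        (simp_all only: gA undo)
    then have "tm_reach V E (length (m # ms)) (pos (m # ms) ` A) (\<lambda>x. if g x = t then s else g x)"
      unfolding pA by (simp only: list.size add_Suc_right add_0_right One_nat_def)
    moreover have "(if g (pos (m # ms) x) = t then s else g (pos (m # ms) x)) = x" if "x \<in> A" for x
    proof (cases "x = s")
      case True
      then show ?thesis using g(2) by (simp add: m)
    next
      case False
      then have "g (pos ms x) = x" using g(2) that by blast
      then show ?thesis using False st that by (auto simp: m)
    qed
    ultimately show ?case by blast
  qed
  obtain ms where ms: "length ms = k" "\<forall>c. set c = A \<longrightarrow> valid_sequence V E c ms" "\<forall>x\<in>A. pos ms x = f x"
    using assms(1) unfolding tm_reach_def by blast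
  have "pos ms ` A = f ` A" using ms(3) by auto
  with rev[of ms] ms assms(2,3) show ?thesis by auto
qed

text \<open>
  Carrying out an arrangement \<open>f\<close>, a rearrangement \<open>w\<close> of the tokens on the occupied vertices, and then \<open>f\<close>
  backwards.
\<close>

lemma tm_reach_conjugate:
  assumes "tm_reach V E k A f" "A \<subseteq> V" "finite A" "tm_reach V E l (f ` A) w"
    and "\<And>x. x \<in> A \<Longrightarrow> w (f x) = f (v x)" "v ` A = A"
  shows "tm_reach V E (k + l + k) A v"
proof -
  obtain g where g: "tm_reach V E k (f ` A) g" "\<forall>x\<in>A. g (f x) = x"
    using tm_reach_reverse[OF assms(1-3)] by blast
  have 1: "tm_reach V E (k + l) A (\<lambda>x. w (f x))"
    by (rule tm_reach_trans[OF assms(1,4)]) simp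
  have "(\<lambda>x. w (f x)) ` A = (\<lambda>x. f (v x)) ` A" using assms(5) by (rule image_cong[OF refl])
  also have "\<dots> = f ` v ` A" by (rule image_image[symmetric])
  also have "\<dots> = f ` A" by (simp only: assms(6))
  finally have 2: "(\<lambda>x. w (f x)) ` A = f ` A" .
  have "g (w (f x)) = v x" if "x \<in> A" for x
  proof -
    have "v x \<in> A" using assms(6) that by blast
    then show ?thesis using g(2) assms(5)[OF that] by simp
  qed
  then show ?thesis
    by (intro tm_reach_trans[OF 1, where g = g]) (simp_all only: 2 g(1))
qed

section \<open>From multicoloured clique to token moving\<close>

text \<open>
  The vertices \<open>0, ..., N - 1\<close> form the graph in which a clique with one vertex of each of the \<open>m\<close>
  colours is sought; \<open>N, ..., N + m + 2\<close> are hubs, the only vertices that are free at the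
  beginning and at the end; \<open>tv N m i j s\<close> for \<open>s \<le> m + 1\<close> belongs to the test of the colours \<open>i\<close> and \<open>j\<close>:
  for \<open>s \<le> m\<close> it is a path whose end \<open>s = m\<close> sees the vertices of colour \<open>i\<close>, and \<open>s = m + 1\<close> is a
  vertex that sees those of colour \<open>j\<close>.
\<close>

definition tv :: "nat \<Rightarrow> nat \<Rightarrow> nat \<Rightarrow> nat \<Rightarrow> nat \<Rightarrow> nat" where
  "tv N m i j s = N + (m + 3) + (i * m + j) * (m + 2) + s"

definition tm_size :: "nat \<Rightarrow> nat \<Rightarrow> nat" where
  "tm_size N m = N + (m + 3) + m * m * (m + 2)"

definition tm_edges :: "nat \<Rightarrow> nat \<Rightarrow> (nat \<Rightarrow> nat) \<Rightarrow> (nat \<Rightarrow> nat \<Rightarrow> bool) \<Rightarrow> (nat \<times> nat) list" where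
  "tm_edges N m col adj =
    concat (map (\<lambda>u. map (\<lambda>v. (u, v)) (filter (\<lambda>v. u \<noteq> v \<and> adj u v) [0..<N])) [0..<N]) @
    concat (map (\<lambda>u. map (\<lambda>h. (u, N + h)) [0..<m + 3]) [0..<N]) @
    concat (map (\<lambda>i. concat (map (\<lambda>j.
      map (\<lambda>s. (tv N m i j s, tv N m i j (Suc s))) [0..<m] @
      map (\<lambda>v. (tv N m i j m, v)) (filter (\<lambda>v. col v = i) [0..<N]) @
      map (\<lambda>v. (tv N m i j (Suc m), v)) (filter (\<lambda>v. col v = j) [0..<N])) [0..<m])) [0..<m])"

definition tflip :: "nat \<Rightarrow> nat \<Rightarrow> nat" where
  "tflip m s = (if s = 0 then Suc m else if s = Suc m then 0 else s)"

definition tm_config :: "nat \<Rightarrow> nat \<Rightarrow> (nat \<Rightarrow> nat) \<Rightarrow> nat list" where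
  "tm_config N m f = [0..<N] @
    concat (map (\<lambda>i. concat (map (\<lambda>j. map (\<lambda>s. tv N m i j (f s)) [0..<m + 2]) [0..<m])) [0..<m])"

text \<open>A test takes \<open>m\<close> moves to park the path tokens, 3 for the exchange and
  \<open>m\<close> to bring the path tokens back. The remaining \<open>2 * m\<close> moves open one
  vertex of every colour at the beginning and close it at the end.\<close>

definition tm_bound :: "nat \<Rightarrow> nat" where
  "tm_bound m = m * m * (2 * m + 3) + 2 * m"

definition tm_instance :: "nat \<Rightarrow> nat \<Rightarrow> (nat \<Rightarrow> nat) \<Rightarrow> (nat \<Rightarrow> nat \<Rightarrow> bool) \<Rightarrow> lutm_instance" where
  "tm_instance N m col adj = (tm_size N m, tm_edges N m col adj,
    tm_config N m (\<lambda>s. s), tm_config N m (tflip m), tm_bound m)"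

lemma concat_upt_blocks:
  "concat (map (\<lambda>i. map (\<lambda>s. b + i * c + s) [0..<c]) [0..<k]) = [b..<b + k * c :: nat]"
proof (induction k)
  case (Suc k)
  have "map (\<lambda>s. b + k * c + s) [0..<c] = [b + k * c..<b + k * c + c]"
    using map_add_upt[of "b + k * c" c] by (simp add: add.commute)
  then show ?case
    using Suc upt_add_eq_append[of b "b + k * c" c] by (simp add: add.commute add.left_commute)
qed simp

lemma in_set_concat_map: "x \<in> set (concat (map f xs)) \<longleftrightarrow> (\<exists>y\<in>set xs. x \<in> set (f y))"
  by auto

locale gadget =
  fixes N m :: nat and col :: "nat \<Rightarrow> nat" and adj :: "nat \<Rightarrow> nat \<Rightarrow> bool"
  assumes m_pos: "0 < m"
    and col_less: "\<And>v. v < N \<Longrightarrow> col v < m"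
    and adj_sym: "\<And>u v. adj u v \<Longrightarrow> adj v u"
begin

abbreviation z :: "nat \<Rightarrow> nat \<Rightarrow> nat \<Rightarrow> nat" where
  "z \<equiv> tv N m"

abbreviation V :: "nat set" where
  "V \<equiv> {..<tm_size N m}"

abbreviation E :: "nat set set" where
  "E \<equiv> edges_of (tm_edges N m col adj)"

abbreviation S :: "nat list" where
  "S \<equiv> tm_config N m (\<lambda>s. s)"

text \<open>\<open>s\<close> and \<open>j\<close> are digits with radices \<open>m + 2\<close> and
  \<open>m\<close>, recovered by \<open>mod\<close> and \<open>div\<close>.\<close>

lemma z_inj:
  assumes "j < m" "j' < m" "s \<le> Suc m" "s' \<le> Suc m" "z i j s = z i' j' s'"
  shows "i = i'" "j = j'" "s = s'"
proof -
  have eq: "(i * m + j) * (m + 2) + s = (i' * m + j') * (m + 2) + s'"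
    using assms(5) by (simp add: tv_def)
  have dm: "(q * c + r) div c = q" "(q * c + r) mod c = r" if "r < c" for q c r :: nat
    using that by simp_all
  have "s < m + 2" "s' < m + 2" using assms(3,4) by simp_all
  note dm[OF this(1), of "i * m + j"] dm[OF this(2), of "i' * m + j'"]
  with eq have *: "i * m + j = i' * m + j'" and "s = s'" by metis+
  then show "s = s'" by simp
  note dm[OF assms(1), of i] dm[OF assms(2), of i']
  with * show "i = i'" "j = j'" by metis+
qed

lemma z_eq [simp]:
  "i < m \<Longrightarrow> j < m \<Longrightarrow> i' < m \<Longrightarrow> j' < m \<Longrightarrow> s \<le> Suc m \<Longrightarrow> s' \<le> Suc m \<Longrightarrow>
    z i j s = z i' j' s' \<longleftrightarrow> i = i' \<and> j = j' \<and> s = s'"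
  using z_inj[of j j' s s' i i'] by auto

lemma z_ge [simp]: "\<not> z i j s < N" "\<not> z i j s < N + (m + 3)"
  "h < m + 3 \<Longrightarrow> N + h \<noteq> z i j s" "h < m + 3 \<Longrightarrow> z i j s \<noteq> N + h"
  by (simp_all add: tv_def)

lemma z_in_V:
  assumes "i < m" "j < m" "s \<le> Suc m"
  shows "z i j s \<in> V"
proof -
  have "i * m + j < m * m"
  proof -
    have "i * m + j < Suc i * m" using assms(2) by simp
    also have "\<dots> \<le> m * m" using assms(1) by (intro mult_right_mono) auto
    finally show ?thesis .
  qed
  then have "Suc (i * m + j) * (m + 2) \<le> m * m * (m + 2)" by (intro mult_right_mono) auto
  then show ?thesis using assms(3) by (simp add: tv_def tm_size_def)
qed

text \<open>The blocks of the tests fill the interval behind the hubs without holes, so everything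
  except the hubs is occupied.\<close>

lemma S_eq: "S = [0..<N] @ [N + (m + 3)..<tm_size N m]"
proof -
  let ?c = "m * (m + 2)"
  have "concat (map (\<lambda>j. map (\<lambda>s. z i j s) [0..<m + 2]) [0..<m]) =
      map (\<lambda>s. N + (m + 3) + i * ?c + s) [0..<?c]" for i
  proof -
    have "map (\<lambda>s. z i j s) [0..<m + 2] =
        map (\<lambda>s. N + (m + 3) + i * ?c + j * (m + 2) + s) [0..<m + 2]" for j
      by (rule map_cong) (simp_all add: tv_def algebra_simps)
    then have "concat (map (\<lambda>j. map (\<lambda>s. z i j s) [0..<m + 2]) [0..<m]) =
        [N + (m + 3) + i * ?c..<N + (m + 3) + i * ?c + ?c]"
      by (simp only: concat_upt_blocks)
    also have "\<dots> = map (\<lambda>s. N + (m + 3) + i * ?c + s) [0..<?c]"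
      by (simp only: map_add_upt add.commute[of "N + (m + 3) + i * ?c"])
    finally show ?thesis .
  qed
  then show ?thesis
    by (simp only: tm_config_def tm_size_def concat_upt_blocks mult.assoc)
qed

lemma distinct_S: "distinct S"
  by (simp add: S_eq)

lemma set_S: "set S = V - {N..<N + (m + 3)}"
  by (auto simp: S_eq tm_size_def)

lemma S_iff: "x \<in> set S \<longleftrightarrow> x < N \<or> (\<exists>i<m. \<exists>j<m. \<exists>s\<le>Suc m. x = z i j s)"
proof -
  have "x \<in> set S \<longleftrightarrow> x < N \<or> (\<exists>i\<in>{0..<m}. \<exists>j\<in>{0..<m}. \<exists>s\<in>{0..<m + 2}. x = z i j s)"
    by (simp only: tm_config_def set_append Un_iff in_set_concat_map set_map set_upt image_iff
        atLeastLessThan_iff zero_le simp_thms)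
  moreover have "{0..<m + 2} = {..Suc m}" by auto
  ultimately show ?thesis by (simp only: Bex_def atLeastLessThan_iff atMost_iff zero_le simp_thms)
qed

lemma S_cases:
  assumes "x \<in> set S"
  obtains "x < N" | i j s where "i < m" "j < m" "s \<le> Suc m" "x = z i j s"
  using assms unfolding S_iff by blast

lemma conf_S: "configuration V S"
  using distinct_S set_S by (auto simp: configuration_def)

lemma card_free: "card (V - set c) = m + 3" if "configuration V c" "length c = length S" for c
proof -
  have "card (V - set c) = card V - card (set c)"
    using that by (intro card_Diff_subset) (auto simp: configuration_def)
  also have "card (set c) = length S"
    using that by (simp add: configuration_def distinct_card)
  finally show ?thesis by (simp add: S_eq tm_size_def)
qed

text \<open>The prescribed vertex of a token as a function of its initial vertex. A test occupies
  \<open>m + 2\<close> consecutive numbers, so the residue is the position within the test that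
  \<open>tflip\<close> acts on.\<close>

definition sw :: "nat \<Rightarrow> nat" where
  "sw x = (if x < N + (m + 3) then x
    else x - (x - (N + (m + 3))) mod (m + 2) + tflip m ((x - (N + (m + 3))) mod (m + 2)))"

lemma sw_z:
  assumes "s \<le> Suc m"
  shows "sw (z i j s) = z i j (tflip m s)"
proof -
  have "(z i j s - (N + (m + 3))) mod (m + 2) = s"
  proof -
    have "z i j s - (N + (m + 3)) = (i * m + j) * (m + 2) + s" by (simp only: tv_def)
    then show ?thesis using assms by (simp only: mod_mult_self3) simp
  qed
  moreover have "z i j s - s + t = z i j t" for t by (simp add: tv_def)
  ultimately show ?thesis unfolding sw_def by (simp only: z_ge if_False)
qed

lemma sw_less: "x < N + (m + 3) \<Longrightarrow> sw x = x"
  by (simp add: sw_def)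

lemma T_eq: "tm_config N m (tflip m) = map sw S"
proof -
  have "map sw [0..<N] = [0..<N]" by (rule map_idI) (auto intro: sw_less)
  moreover have "map sw (map (\<lambda>s. z i j s) [0..<m + 2]) = map (\<lambda>s. z i j (tflip m s)) [0..<m + 2]" for i j
    unfolding map_map by (rule map_cong[OF refl]) (simp add: less_Suc_eq_le sw_z del: upt_Suc)
  ultimately show ?thesis
    by (simp only: tm_config_def map_append map_concat map_map[of "map sw"] comp_def)
qed

lemma E_iff: "{u, w} \<in> E \<longleftrightarrow>
    (u, w) \<in> set (tm_edges N m col adj) \<or> (w, u) \<in> set (tm_edges N m col adj)"
  by (auto simp: edges_of_def doubleton_eq_iff)

lemma edge_iff: "(u, w) \<in> set (tm_edges N m col adj) \<longleftrightarrow>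
    u < N \<and> w < N \<and> u \<noteq> w \<and> adj u w \<or> u < N \<and> (\<exists>h<m + 3. w = N + h) \<or>
    (\<exists>i<m. \<exists>j<m. (\<exists>s<m. u = z i j s \<and> w = z i j (Suc s)) \<or>
      u = z i j m \<and> w < N \<and> col w = i \<or> u = z i j (Suc m) \<and> w < N \<and> col w = j)"
proof -
  have "(u, w) \<in> set (tm_edges N m col adj) \<longleftrightarrow>
    (\<exists>u'\<in>{0..<N}. \<exists>v\<in>{v\<in>{0..<N}. u' \<noteq> v \<and> adj u' v}. (u, w) = (u', v)) \<or>
    (\<exists>u'\<in>{0..<N}. \<exists>h\<in>{0..<m+3}. (u, w) = (u', N + h)) \<or>
    (\<exists>i\<in>{0..<m}. \<exists>j\<in>{0..<m}. (\<exists>s\<in>{0..<m}. (u, w) = (z i j s, z i j (Suc s))) \<or>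
      (\<exists>v\<in>{v\<in>{0..<N}. col v = i}. (u, w) = (z i j m, v)) \<or>
      (\<exists>v\<in>{v\<in>{0..<N}. col v = j}. (u, w) = (z i j (Suc m), v)))"
    by (simp only: tm_edges_def set_append Un_iff in_set_concat_map set_map set_upt set_filter image_iff)
  then show ?thesis
    by (simp del: z_eq z_ge cong: conj_cong) (simp only: Bex_def atLeastLessThan_iff zero_le simp_thms)
qed

lemma edge_cands: "u < N \<Longrightarrow> w < N \<Longrightarrow> {u, w} \<in> E \<Longrightarrow> adj u w"
  using adj_sym by (auto simp: E_iff edge_iff tv_def)

lemma edge_chain:
  assumes "i < m" "j < m" "s \<le> m" "{z i j s, w} \<in> E"
  shows "(\<exists>s'\<le>m. w = z i j s' \<and> (s' = Suc s \<or> s = Suc s')) \<or> s = m \<and> w < N \<and> col w = i"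
  using assms(4) unfolding E_iff
proof
  assume "(z i j s, w) \<in> set (tm_edges N m col adj)"
  then consider i' j' s' where "i' < m" "j' < m" "s' < m" "z i j s = z i' j' s'" "w = z i' j' (Suc s')"
    | i' j' where "i' < m" "j' < m" "z i j s = z i' j' m" "w < N" "col w = i'"
    | i' j' where "i' < m" "j' < m" "z i j s = z i' j' (Suc m)"
    unfolding edge_iff by auto
  then show ?thesis
  proof cases
    case 1
    then have "w = z i j (Suc s)" "Suc s \<le> m" using assms(1-3) by auto
    then show ?thesis by blast
  qed (use assms(1-3) in auto)
next
  assume "(w, z i j s) \<in> set (tm_edges N m col adj)"
  then consider i' j' s' where "i' < m" "j' < m" "s' < m" "z i j s = z i' j' (Suc s')" "w = z i' j' s'"
    unfolding edge_iff by auto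
  then show ?thesis
  proof cases
    case 1
    then have "w = z i j s'" "s' \<le> m" "s = Suc s'" using assms(1-3) by auto
    then show ?thesis by blast
  qed
qed

lemma edge_end:
  assumes "i < m" "j < m" "{z i j (Suc m), w} \<in> E"
  shows "w < N \<and> col w = j"
  using assms(3) unfolding E_iff
proof
  assume "(z i j (Suc m), w) \<in> set (tm_edges N m col adj)"
  then consider i' j' s' where "i' < m" "j' < m" "s' < m" "z i j (Suc m) = z i' j' s'"
    | i' j' where "i' < m" "j' < m" "z i j (Suc m) = z i' j' m"
    | i' j' where "i' < m" "j' < m" "z i j (Suc m) = z i' j' (Suc m)" "w < N" "col w = j'"
    unfolding edge_iff by auto
  then show ?thesis using assms(1,2) by cases auto
next
  assume "(w, z i j (Suc m)) \<in> set (tm_edges N m col adj)"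
  then consider i' j' s' where "i' < m" "j' < m" "s' < m" "z i j (Suc m) = z i' j' (Suc s')"
    unfolding edge_iff by auto
  then show ?thesis using assms(1,2) by cases auto
qed

lemma sw_sw: "x \<in> set S \<Longrightarrow> sw (sw x) = x"
  and sw_in_S: "x \<in> set S \<Longrightarrow> sw x \<in> set S"
proof -
  have "sw (sw x) = x \<and> sw x \<in> set S" if "x \<in> set S"
    using that
  proof (cases rule: S_cases)
    case 1
    then have "sw x = x" by (simp add: sw_less)
    then show ?thesis using that by simp
  next
    case (2 i j s)
    have "tflip m s \<le> Suc m" "tflip m (tflip m s) = s" using 2 by (auto simp: tflip_def)
    then show ?thesis unfolding S_iff using 2 by (auto simp: sw_z)
  qed
  then show "x \<in> set S \<Longrightarrow> sw (sw x) = x" "x \<in> set S \<Longrightarrow> sw x \<in> set S" by auto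
qed

lemma sw_image: "sw ` set S = set S"
  using sw_sw sw_in_S by force

lemma wf_instance: "lutm_wf (tm_instance N m col adj)"
proof -
  have "e \<subseteq> V \<and> card e = 2" if e: "e \<in> E" for e
  proof -
    obtain u w where uw: "e = {u, w}" "(u, w) \<in> set (tm_edges N m col adj)"
      using e by (auto simp: edges_of_def)
    from uw(2) have "u \<in> V" "w \<in> V" "u \<noteq> w"
      unfolding edge_iff using z_in_V by (auto simp: tm_size_def)
    then show ?thesis using uw(1) by simp
  qed
  moreover have "inj_on sw (set S)" by (rule inj_on_inverseI) (rule sw_sw)
  then have "configuration V (map sw S)"
    using conf_S sw_image by (simp add: configuration_def distinct_map)
  ultimately show ?thesis
    using conf_S by (simp add: tm_instance_def ugraph_def T_eq)
qed

lemma param_instance: "lutm_param (tm_instance N m col adj) = tm_bound m + (m + 3)"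
proof -
  have "card (set S \<union> set (tm_config N m (tflip m))) = length S"
    by (simp add: T_eq sw_image distinct_card[OF distinct_S])
  then show ?thesis by (simp add: tm_instance_def S_eq tm_size_def)
qed

subsection \<open>Soundness\<close>

text \<open>The path has to contain all of \<open>z i j 0\<close>, ..., \<open>z i j m\<close>, a
  vertex of colour \<open>i\<close>, one of colour \<open>j\<close> and the other end, which makes
  \<open>m + 4\<close> vertices. Except for the start they are free, and only \<open>m + 3\<close>
  vertices are. So nothing else, in particular no hub, lies on the path.\<close>

lemma direct_path_adjacent:
  assumes ij: "i < m" "j < m" "i \<noteq> j"
    and c: "configuration V c" "length c = length S"
    and p: "p \<noteq> []" "set p \<subseteq> V" "successively (\<lambda>u v. {u, v} \<in> E) p"
      "set (tl p) \<inter> set c = {}"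
    and ends: "hd p = z i j 0 \<and> last p = z i j (Suc m) \<or> hd p = z i j (Suc m) \<and> last p = z i j 0"
  shows "\<exists>a b. a < N \<and> b < N \<and> a \<notin> set c \<and> b \<notin> set c \<and> col a = i \<and> col b = j \<and> adj a b"
proof -
  let ?R = "\<lambda>u v. {u, v} \<in> E"
  \<comment> \<open>A set that separates the two ends is left by some edge of the path, whichever
    end the path starts from.\<close>
  have cut: "\<exists>u w. u \<in> set p \<and> w \<in> set p \<and> u \<in> A \<and> w \<notin> A \<and> {u, w} \<in> E"
    if A: "z i j 0 \<in> A" "z i j (Suc m) \<notin> A" for A
    using ends
  proof
    assume "hd p = z i j 0 \<and> last p = z i j (Suc m)"
    then show ?thesis using path_leaves[OF p(3,1), of A] A list.set_sel(2)[OF p(1)] by metis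
  next
    assume "hd p = z i j (Suc m) \<and> last p = z i j 0"
    then obtain u w where "u \<in> set p" "w \<in> set (tl p)" "u \<in> - A" "w \<notin> - A" "{u, w} \<in> E"
      using path_leaves[OF p(3,1), of "- A"] A by auto
    then show ?thesis using list.set_sel(2)[OF p(1)] by (metis ComplD ComplI insert_commute)
  qed
  have zA: "z i j s \<in> z i j ` {..<t} \<longleftrightarrow> s < t" if "s \<le> Suc m" "t \<le> Suc m" for s t
    using that ij by auto
  \<comment> \<open>The only edge out of the first \<open>s\<close> vertices of the test leads to
    \<open>z i j s\<close>.\<close>
  have chain: "z i j s \<in> set p" if s: "s \<le> m" "s \<noteq> 0" for s
  proof -
    have "z i j 0 \<in> z i j ` {..<s}" "z i j (Suc m) \<notin> z i j ` {..<s}"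
      using zA[of 0 s] zA[of "Suc m" s] s by simp_all
    from cut[OF this] obtain u w where
      uw: "w \<in> set p" "u \<in> z i j ` {..<s}" "w \<notin> z i j ` {..<s}" "{u, w} \<in> E" by blast
    then obtain s' where s': "s' < s" "u = z i j s'" by blast
    have "s' \<le> m" "s' \<noteq> m" using s' s by simp_all
    with edge_chain[OF ij(1,2), of s' w] uw(4) s'(2) obtain s'' where
      s'': "w = z i j s''" "s'' = Suc s' \<or> s' = Suc s''" by blast
    moreover have "\<not> s'' < s" using uw(3) s''(1) by blast
    ultimately have "s'' = s" using s'(1) by linarith
    then show ?thesis using uw(1) s''(1) by simp
  qed
  have "z i j 0 \<in> set p" "z i j (Suc m) \<in> set p"
    using ends hd_in_set[OF p(1)] last_in_set[OF p(1)] by metis+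
  then have "z i j s \<in> set p" if "s \<le> Suc m" for s
    using chain[of s] that by (cases "s = 0"; cases "s = Suc m") auto
  then have K: "z i j ` {..Suc m} \<subseteq> set p" by blast
  obtain a where a: "a \<in> set p" "a < N" "col a = i"
  proof -
    have "z i j 0 \<in> z i j ` {..<Suc m}" "z i j (Suc m) \<notin> z i j ` {..<Suc m}"
      using zA[of 0 "Suc m"] zA[of "Suc m" "Suc m"] by simp_all
    from cut[OF this] obtain u w where
      uw: "w \<in> set p" "u \<in> z i j ` {..<Suc m}" "w \<notin> z i j ` {..<Suc m}" "{u, w} \<in> E" by blast
    then obtain s' where "s' < Suc m" "u = z i j s'" by blast
    then have s': "s' \<le> m" "u = z i j s'" by simp_all
    have "w \<noteq> z i j s''" if "s'' \<le> m" for s'' using uw(3) that by auto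
    with edge_chain[OF ij(1,2) s'(1), of w] uw(4) s'(2) have "w < N" "col w = i" by blast+
    then show ?thesis using that uw by blast
  qed
  obtain b where b: "b \<in> set p" "b < N" "col b = j"
  proof -
    have "z i j 0 \<in> - {z i j (Suc m)}" "z i j (Suc m) \<notin> - {z i j (Suc m)}" using ij by simp_all
    from cut[OF this] obtain u w where uw: "u \<in> set p" "w = z i j (Suc m)" "{u, w} \<in> E" by blast
    with edge_end[OF ij(1,2), of u] have "u < N" "col u = j" by (simp_all add: insert_commute)
    then show ?thesis using that uw by blast
  qed
  have "\<not> hd p < N" using ends z_ge(1) by metis
  then have hd: "a \<noteq> hd p" "b \<noteq> hd p" using a(2) b(2) by blast+
  have set_p: "set p = insert (hd p) (set (tl p))" using p(1) by (cases p) auto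
  have ab: "a \<notin> set c" "b \<notin> set c" using hd a(1) b(1) p(4) set_p by auto
  text \<open>As many vertices are free as the path needs if it has only two vertices outside the test.\<close>
  have "card (set p) \<le> Suc (card (V - set c))"
  proof -
    have "set p \<subseteq> insert (hd p) (V - set c)" using set_p p(2,4) by auto
    from card_mono[OF _ this] show ?thesis by (simp add: card_insert_if split: if_splits)
  qed
  then have card: "card (set p) \<le> m + 4" using card_free[OF c] by simp
  have "inj_on (z i j) {..Suc m}" using ij by (intro inj_onI) auto
  then have "card (z i j ` {..Suc m}) = m + 2" by (simp add: card_image)
  moreover have "\<forall>x\<in>z i j ` {..Suc m}. \<not> x < N" by auto
  then have "a \<notin> z i j ` {..Suc m}" "b \<notin> z i j ` {..Suc m}" "a \<noteq> b" using a b ij(3) by blast+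
  ultimately have "card (insert a (insert b (z i j ` {..Suc m}))) = m + 4" by simp
  then have P: "set p = insert a (insert b (z i j ` {..Suc m}))"
    using K a b card by (intro sym[OF card_seteq]) auto
  \<comment> \<open>The crossing edge ends in \<open>b\<close> or in \<open>z i j (Suc m)\<close>.
    From the test vertices up to \<open>m\<close> neither can be reached, since \<open>b\<close>
    does not have colour \<open>i\<close>; and \<open>a\<close> does not have colour
    \<open>j\<close>, so it does not see \<open>z i j (Suc m)\<close>. The edge from
    \<open>a\<close> to \<open>b\<close> is left.\<close>
  let ?A = "insert a (z i j ` {..<Suc m})"
  have "z i j 0 \<in> ?A" "z i j (Suc m) \<notin> ?A"
    using a(2) zA[of 0 "Suc m"] zA[of "Suc m" "Suc m"] by auto
  from cut[OF this] obtain u w where uw: "w \<in> set p" "u \<in> ?A" "w \<notin> ?A" "{u, w} \<in> E" by blast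
  then have w: "w = z i j (Suc m) \<or> w = b" unfolding P by (auto simp: le_Suc_eq)
  have "u = a"
  proof (rule ccontr)
    assume "u \<noteq> a"
    then obtain s' where "s' < Suc m" "u = z i j s'" using uw(2) by blast
    then have s': "s' \<le> m" "u = z i j s'" by simp_all
    have "w \<noteq> z i j s''" if "s'' \<le> m" for s'' using uw(3) that by auto
    with edge_chain[OF ij(1,2) s'(1), of w] uw(4) s'(2) have "w < N" "col w = i" by blast+
    then show False using w b(3) ij(3) z_ge(1)[of i j "Suc m"] by metis
  qed
  have "w = b"
  proof (rule ccontr)
    assume "w \<noteq> b"
    then have "{z i j (Suc m), a} \<in> E" using w uw(4) \<open>u = a\<close> by (simp add: insert_commute)
    with edge_end[OF ij(1,2)] a(3) ij(3) show False by blast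
  qed
  then have "adj a b" using edge_cands a b uw(4) \<open>u = a\<close> by simp
  then show ?thesis using a b ab by blast
qed

lemma sum_le_eq:
  fixes f g :: "'b \<Rightarrow> nat"
  assumes "finite A" "\<And>a. a \<in> A \<Longrightarrow> g a \<le> f a" "sum f A \<le> sum g A" "a \<in> A"
  shows "f a = g a"
proof -
  have "sum g A = sum f A" using assms(2,3) by (meson le_antisym sum_mono)
  then show ?thesis using sum_mono_inv[of g A f a] assms by simp
qed

lemma sum_S:
  "(\<Sum>x\<in>set S. f x) = (\<Sum>i<m. \<Sum>v\<in>{v\<in>{..<N}. col v = i}. f v) +
    (\<Sum>i<m. \<Sum>j<m. \<Sum>s\<le>Suc m. f (z i j s) :: nat)"
proof -
  let ?I = "{..<m} \<times> {..<m} \<times> {..Suc m}"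
  have S: "set S = {..<N} \<union> (\<lambda>(i, j, s). z i j s) ` ?I"
    by (rule set_eqI) (simp only: S_iff Un_iff lessThan_iff, auto simp: image_iff)
  have "inj_on (\<lambda>(i, j, s). z i j s) ?I" by (rule inj_onI) auto
  moreover have "{..<N} \<inter> (\<lambda>(i, j, s). z i j s) ` ?I = {}" by auto
  ultimately have "(\<Sum>x\<in>set S. f x) = (\<Sum>v<N. f v) + (\<Sum>x\<in>?I. f (case x of (i, j, s) \<Rightarrow> z i j s))"
    unfolding S by (subst sum.union_disjoint) (auto simp: sum.reindex)
  also have "(\<Sum>v<N. f v) = (\<Sum>i<m. \<Sum>v\<in>{v\<in>{..<N}. col v = i}. f v)"
    by (rule sum.group[symmetric]) (auto intro: col_less)
  also have "(\<Sum>x\<in>?I. f (case x of (i, j, s) \<Rightarrow> z i j s)) = (\<Sum>i<m. \<Sum>j<m. \<Sum>s\<le>Suc m. f (z i j s))"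
    by (simp add: sum.cartesian_product split_beta del: sum.atMost_Suc)
  finally show ?thesis .
qed

text \<open>Each colour costs 2 moves, each path token at a position from 1 to \<open>m\<close>
  another 2, and each exchange 3. This adds up to exactly \<open>tm_bound m\<close>, so every one of
  these bounds is attained.\<close>

lemma yes_imp_clique:
  assumes "lutm_yes (tm_instance N m col adj)"
  shows "\<exists>x. (\<forall>i<m. x i < N \<and> col (x i) = i) \<and> (\<forall>i<m. \<forall>j<m. i \<noteq> j \<longrightarrow> adj (x i) (x j))"
proof -
  obtain ms where vs: "valid_sequence V E S ms" and T: "map (pos ms) S = map sw S"
    and len: "length ms \<le> tm_bound m"
    using assms by (auto simp: tm_instance_def transforming_sequence_def foldl_execute_move T_eq)
  have pos: "pos ms x = sw x" if "x \<in> set S" for x using T that by simp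
  have zS: "z i j s \<in> set S" if "i < m" "j < m" "s \<le> Suc m" for i j s
    using that S_iff by blast
  have NS: "v \<in> set S" if "v < N" for v using that S_iff by blast
  have pos_ends: "pos ms (z i j 0) = z i j (Suc m)" "pos ms (z i j (Suc m)) = z i j 0"
    if "i < m" "j < m" for i j
    using that pos zS by (simp_all add: sw_z tflip_def)
  have cnt_ends: "3 \<le> cnt ms (z i j 0) + cnt ms (z i j (Suc m))" if "i < m" "j < m" for i j
    using that by (intro cnt_swap[OF vs] zS pos_ends) auto
  \<comment> \<open>If the token at position \<open>s\<close> never moved, it would lock in the
    token of \<open>z i j 0\<close>, which has to leave for the other end. It also has to come back,
    hence two moves.\<close>
  have cnt_chain: "2 \<le> cnt ms (z i j s)" if "i < m" "j < m" "s \<le> m" "s \<noteq> 0" for i j s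
  proof (rule cnt_ge_2[OF vs conf_S zS])
    show "pos ms (z i j s) = z i j s" using that by (simp add: pos zS sw_z tflip_def)
    show "cnt ms (z i j s) \<noteq> 0"
    proof
      assume 0: "cnt ms (z i j s) = 0"
      have "pos ms (z i j 0) \<in> z i j ` {..<s}"
      proof (rule pos_confined[OF vs, where B = "{z i j s}"])
        fix u w
        assume "{u, w} \<in> E" "u \<in> z i j ` {..<s}" and w: "w \<notin> z i j ` {..<s}"
        then obtain s' where s': "s' < s" "u = z i j s'" by auto
        have "s' \<le> m" "s' \<noteq> m" using s' that by simp_all
        with edge_chain[OF that(1,2), of s' w] \<open>{u, w} \<in> E\<close> s'(2) obtain s'' where
          s'': "w = z i j s''" "s'' = Suc s' \<or> s' = Suc s''" by blast
        moreover have "\<not> s'' < s" using w s''(1) by blast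
        ultimately have "s'' = s" using s'(1) by linarith
        then show "w \<in> {z i j s}" using s''(1) by simp
      next
        show "z i j 0 \<in> set S" "{z i j s} \<subseteq> set S" using zS that by auto
        show "z i j 0 \<in> z i j ` {..<s}" using that by auto
      qed (use 0 in simp)
      then show False using that by (auto simp: pos_ends)
    qed
  qed (use that in auto)
  have cnt_cand: "2 \<le> cnt ms v" if "v < N" "cnt ms v \<noteq> 0" for v
    using that by (intro cnt_ge_2[OF vs conf_S NS]) (auto simp: pos NS sw_less)
  \<comment> \<open>Otherwise the vertices of colour \<open>i\<close> would form a barrier around
    the path of the test \<open>(i, 0)\<close>.\<close>
  have cand: "\<exists>v<N. col v = i \<and> cnt ms v \<noteq> 0" if i: "i < m" for i
  proof (rule ccontr)
    assume no: "\<not> (\<exists>v<N. col v = i \<and> cnt ms v \<noteq> 0)"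
    have "pos ms (z i 0 0) \<in> z i 0 ` {..m}"
    proof (rule pos_confined[OF vs, where B = "{v. v < N \<and> col v = i}"])
      fix u w
      assume "{u, w} \<in> E" "u \<in> z i 0 ` {..m}" and w: "w \<notin> z i 0 ` {..m}"
      then obtain s' where s': "s' \<le> m" "u = z i 0 s'" by blast
      have "w \<noteq> z i 0 s''" if "s'' \<le> m" for s'' using w that by blast
      with edge_chain[OF i m_pos s'(1), of w] \<open>{u, w} \<in> E\<close> s'(2)
      show "w \<in> {v. v < N \<and> col v = i}" by blast
    next
      show "z i 0 0 \<in> set S" "{v. v < N \<and> col v = i} \<subseteq> set S" using zS NS i m_pos by auto
      show "cnt ms b = 0" if "b \<in> {v. v < N \<and> col v = i}" for b using that no by blast
    qed simp
    then show False using i m_pos by (auto simp: pos_ends)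
  qed
  define C where "C i = (\<Sum>v\<in>{v\<in>{..<N}. col v = i}. cnt ms v)" for i
  define Z where "Z i j = (\<Sum>s\<le>Suc m. cnt ms (z i j s))" for i j
  have C2: "2 \<le> C i" if i: "i < m" for i
  proof -
    obtain v where v: "v < N" "col v = i" "cnt ms v \<noteq> 0" using cand[OF i] by blast
    have "cnt ms v \<le> C i" unfolding C_def by (rule member_le_sum) (use v in auto)
    then show ?thesis using cnt_cand v by fastforce
  qed
  have Zge: "cnt ms (z i j 0) + cnt ms (z i j (Suc m)) + 2 * m \<le> Z i j" if "i < m" "j < m" for i j
  proof -
    have "Z i j = cnt ms (z i j 0) + (\<Sum>s\<in>{1..m}. cnt ms (z i j s)) + cnt ms (z i j (Suc m))"
      unfolding Z_def by (simp add: atMost_atLeast0 sum.atLeast_Suc_atMost)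
    moreover have "(\<Sum>s\<in>{1..m}. 2) \<le> (\<Sum>s\<in>{1..m}. cnt ms (z i j s))"
      by (rule sum_mono) (use cnt_chain that in auto)
    ultimately show ?thesis by simp
  qed
  then have Z3: "2 * m + 3 \<le> Z i j" if "i < m" "j < m" for i j
    using cnt_ends[OF that] that by fastforce
  have "(\<Sum>i<m. C i) + (\<Sum>i<m. \<Sum>j<m. Z i j) \<le> m * m * (2 * m + 3) + 2 * m"
    using sum_cnt[OF vs distinct_S] len unfolding sum_S C_def Z_def tm_bound_def by simp
  moreover have "(\<Sum>i<m. 2) \<le> (\<Sum>i<m. C i)" by (rule sum_mono) (use C2 in auto)
  moreover have "(\<Sum>i<m. \<Sum>j<m. 2 * m + 3) \<le> (\<Sum>i<m. \<Sum>j<m. Z i j)"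
    by (intro sum_mono) (use Z3 in auto)
  ultimately have tot: "(\<Sum>i<m. C i) \<le> (\<Sum>i<m. 2)"
      "(\<Sum>i<m. \<Sum>j<m. Z i j) \<le> (\<Sum>i<m. \<Sum>j<m. 2 * m + 3)"
    by (simp_all add: algebra_simps)
  have C: "C i = 2" if "i < m" for i
    by (rule sum_le_eq[OF _ _ tot(1)]) (use C2 that in auto)
  have Z: "Z i j = 2 * m + 3" if ij: "i < m" "j < m" for i j
  proof -
    have "(\<Sum>j<m. Z i j) = (\<Sum>j<m. 2 * m + 3)"
    proof (rule sum_le_eq[OF _ _ tot(2)])
      show "(\<Sum>j<m. 2 * m + 3) \<le> (\<Sum>j<m. Z a j)" if "a \<in> {..<m}" for a
        by (rule sum_mono) (use Z3 that in auto)
    qed (use ij in auto)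
    then show ?thesis
      by (intro sum_le_eq[where A = "{..<m}" and f = "Z i" and g = "\<lambda>_. 2 * m + 3"]) (use Z3 ij in auto)
  qed
  obtain x where x: "\<And>i. i < m \<Longrightarrow> x i < N \<and> col (x i) = i \<and> cnt ms (x i) \<noteq> 0"
    using cand by metis
  \<comment> \<open>A second moved token of the same colour would raise the cost of this colour from
    2 to at least 4.\<close>
  have x_unique: "v = x (col v)" if v: "v < N" "cnt ms v \<noteq> 0" for v
  proof (rule ccontr)
    assume ne: "v \<noteq> x (col v)"
    have i: "col v < m" using col_less v by blast
    have "(\<Sum>v\<in>{v, x (col v)}. cnt ms v) \<le> C (col v)"
      unfolding C_def by (rule sum_mono2) (use v x[OF i] in auto)
    moreover have "2 \<le> cnt ms v" "2 \<le> cnt ms (x (col v))" using cnt_cand v x[OF i] by auto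
    ultimately show False using ne C[OF i] by simp
  qed
  have "adj (x i) (x j)" if ij: "i < m" "j < m" "i \<noteq> j" for i j
  proof -
    \<comment> \<open>Both tokens of the exchange move and they share three moves, so one of them
      goes straight from one end of the test to the other.\<close>
    have "cnt ms (z i j 0) + cnt ms (z i j (Suc m)) \<le> 3"
      using Zge[OF ij(1,2)] Z[OF ij(1,2)] by simp
    moreover have "cnt ms (z i j 0) \<noteq> 0" "cnt ms (z i j (Suc m)) \<noteq> 0"
      using cnt_0_pos[of ms "z i j 0"] cnt_0_pos[of ms "z i j (Suc m)"] pos_ends[OF ij(1,2)] ij by auto
    ultimately have "cnt ms (z i j 0) = 1 \<or> cnt ms (z i j (Suc m)) = 1" by linarith
    moreover have "z i j 0 \<in> set S" "z i j (Suc m) \<in> set S" using zS ij by auto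
    ultimately obtain s t where st: "s = z i j 0 \<and> t = z i j (Suc m) \<or> s = z i j (Suc m) \<and> t = z i j 0"
        "cnt ms s = 1" "pos ms s = t" "s \<in> set S"
      using pos_ends[OF ij(1,2)] by blast
    from cnt_1E[OF vs conf_S st(4,2)] obtain c' where c': "configuration V c'"
      "length c' = length S" "valid_move V E c' (s, t)"
      "\<And>y. y \<in> set S \<Longrightarrow> cnt ms y = 0 \<Longrightarrow> y \<in> set c'" unfolding st(3) by blast
    from c'(3) obtain p where p: "p \<noteq> []" "hd p = s" "last p = t" "set p \<subseteq> V"
      "successively (\<lambda>u v. {u, v} \<in> E) p" "set (tl p) \<inter> set c' = {}"
      by (auto elim: valid_moveE)
    from direct_path_adjacent[OF ij c'(1,2) p(1,4-6)] st(1) p(2,3) obtain a b where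
      ab: "a < N" "b < N" "a \<notin> set c'" "b \<notin> set c'" "col a = i" "col b = j" "adj a b" by blast
    \<comment> \<open>\<open>a\<close> and \<open>b\<close> are free in \<open>c'\<close>, so their
      tokens have moved, and the moved token of a colour is unique.\<close>
    then have "a = x i" "b = x j" using x_unique c'(4) NS by metis+
    then show ?thesis using ab(7) by simp
  qed
  then show ?thesis using x by blast
qed

end

subsection \<open>Completeness\<close>

lemma involution_image:
  assumes "\<And>y. y \<in> A \<Longrightarrow> h y \<in> A" "\<And>y. y \<in> A \<Longrightarrow> h (h y) = y"
  shows "h ` A = A"
proof (intro equalityI subsetI)
  show "y \<in> h ` A" if "y \<in> A" for y
    using imageI[OF assms(1)[OF that], of h] assms(2)[OF that] by simp
qed (use assms(1) in auto)

context gadget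
begin

lemma free_stepI: "{u, w} \<in> E \<Longrightarrow> w \<in> V \<Longrightarrow> w \<notin> B \<Longrightarrow> (u, w) \<in> free_step V E B"
  by (simp add: free_step_def)

lemma edgeI: "(u, w) \<in> set (tm_edges N m col adj) \<Longrightarrow> {u, w} \<in> E"
  by (simp add: E_iff)

lemma edge_chainI: "i < m \<Longrightarrow> j < m \<Longrightarrow> s < m \<Longrightarrow> {z i j s, z i j (Suc s)} \<in> E"
  by (rule edgeI, unfold edge_iff, rule disjI2, rule disjI2,
      rule exI[of _ i], rule conjI, assumption, rule exI[of _ j]) blast

lemma edge_chain_candI: "i < m \<Longrightarrow> j < m \<Longrightarrow> v < N \<Longrightarrow> col v = i \<Longrightarrow> {z i j m, v} \<in> E"
  by (rule edgeI, unfold edge_iff, rule disjI2, rule disjI2,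
      rule exI[of _ i], rule conjI, assumption, rule exI[of _ j]) simp

lemma edge_endI: "i < m \<Longrightarrow> j < m \<Longrightarrow> v < N \<Longrightarrow> col v = j \<Longrightarrow> {z i j (Suc m), v} \<in> E"
  by (rule edgeI, unfold edge_iff, rule disjI2, rule disjI2,
      rule exI[of _ i], rule conjI, assumption, rule exI[of _ j]) simp

lemma edge_hubI: "v < N \<Longrightarrow> h < m + 3 \<Longrightarrow> {v, N + h} \<in> E"
  by (rule edgeI, unfold edge_iff, rule disjI2, rule disjI1) simp

lemma edge_candI: "u < N \<Longrightarrow> v < N \<Longrightarrow> u \<noteq> v \<Longrightarrow> adj u v \<Longrightarrow> {u, v} \<in> E"
  by (rule edgeI, unfold edge_iff, rule disjI1) simp

lemma N_in_V: "v < N + (m + 3) \<Longrightarrow> v \<in> V"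
  by (simp add: tm_size_def)

lemma chain_up:
  assumes "i < m" "j < m" "s \<le> t" "t \<le> m" "\<And>r. s < r \<Longrightarrow> r \<le> t \<Longrightarrow> z i j r \<notin> B"
  shows "(z i j s, z i j t) \<in> (free_step V E B)\<^sup>*"
  using assms(3,4,5)
proof (induction t rule: dec_induct)
  case (step t)
  have "(z i j t, z i j (Suc t)) \<in> free_step V E B"
    using step by (intro free_stepI edge_chainI z_in_V assms(1,2)) auto
  moreover have "(z i j s, z i j t) \<in> (free_step V E B)\<^sup>*" using step by simp
  ultimately show ?case by (rule rtrancl_into_rtrancl[rotated])
qed simp

lemma chain_down:
  assumes "i < m" "j < m" "s \<le> t" "t \<le> m" "\<And>r. s \<le> r \<Longrightarrow> r < t \<Longrightarrow> z i j r \<notin> B"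
  shows "(z i j t, z i j s) \<in> (free_step V E B)\<^sup>*"
  using assms(3,4,5)
proof (induction t rule: dec_induct)
  case (step t)
  have "(z i j (Suc t), z i j t) \<in> free_step V E B"
    using step edge_chainI[OF assms(1,2), of t] by (intro free_stepI z_in_V assms(1,2)) (auto simp: insert_commute)
  moreover have "(z i j t, z i j s) \<in> (free_step V E B)\<^sup>*" using step by simp
  ultimately show ?case by (rule converse_rtrancl_into_rtrancl)
qed simp

definition swp :: "nat \<Rightarrow> nat \<Rightarrow> nat \<Rightarrow> nat" where
  "swp i j v = (if v = z i j 0 then z i j (Suc m) else if v = z i j (Suc m) then z i j 0 else v)"

text \<open>The path is cleared, the ends are exchanged by three moves, and the clearing is undone.
  \<open>park 1\<close>, ..., \<open>park m\<close> take the path tokens, and \<open>park 0\<close>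
  takes one token during the exchange; \<open>a\<close> and \<open>b\<close> have to stay free as
  passages.\<close>

lemma test_swap:
  fixes A :: "nat set" and park :: "nat \<Rightarrow> nat"
  assumes ij: "i < m" "j < m"
    and A: "A \<subseteq> V" "z i j ` {..Suc m} \<subseteq> A"
    and a: "a < N" "a \<notin> A" "col a = i" and b: "b < N" "b \<notin> A" "col b = j"
    and ab: "a = b \<or> {a, b} \<in> E"
    and park: "inj_on park {..m}"
      "\<And>s. s \<le> m \<Longrightarrow> park s \<in> V \<and> park s \<notin> A \<and> park s \<noteq> a \<and> park s \<noteq> b \<and>
        {a, park s} \<in> E \<and> {b, park s} \<in> E"
  shows "tm_reach V E (2 * m + 3) A (swp i j)"
proof -
  have fin: "finite A" using A(1) by (rule finite_subset) simp
  have zA: "z i j s \<in> A" if "s \<le> Suc m" for s using A(2) that by blast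
  have zz: "z i j s = z i j t \<longleftrightarrow> s = t" if "s \<le> Suc m" "t \<le> Suc m" for s t using ij that by simp
  have az: "a \<noteq> z i j s" "b \<noteq> z i j s" if "s \<le> Suc m" for s using a(2) b(2) zA[OF that] by auto
  have pz: "park r \<noteq> z i j s" if "r \<le> m" "s \<le> Suc m" for r s using park(2)[of r] zA[OF that(2)] that by auto
  have pp: "park r = park s \<longleftrightarrow> r = s" if "r \<le> m" "s \<le> m" for r s
    using park(1) that by (auto dest: inj_onD)
  have aV: "a \<in> V" "b \<in> V" using a(1) b(1) by (simp_all add: tm_size_def)
  \<comment> \<open>The arrangement after \<open>k\<close> moves: the path is cleared from its end
    at \<open>a\<close>, so the last \<open>k\<close> positions are empty. The difference
    \<open>v - z i j 0\<close> is the position of \<open>v\<close>.\<close>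
  define e where "e k v = (if v \<in> z i j ` {m - k<..m} then park (v - z i j 0) else v)" for k v
  have e_park: "e k (z i j s) = park s" if "m - k < s" "s \<le> m" for k s
  proof -
    have "z i j s - z i j 0 = s" by (simp add: tv_def)
    moreover have "z i j s \<in> z i j ` {m - k<..m}" using that by simp
    ultimately show ?thesis unfolding e_def by (simp only: if_True)
  qed
  have e_id: "e k v = v" if "\<And>s. m - k < s \<Longrightarrow> s \<le> m \<Longrightarrow> v \<noteq> z i j s" for k v
  proof -
    have "v \<notin> z i j ` {m - k<..m}" using that by (meson greaterThanAtMost_iff imageE)
    then show ?thesis unfolding e_def by (simp only: if_False)
  qed
  have e_z: "e k (z i j s) = z i j s" if s: "s \<le> m - k \<or> s = Suc m" for k s
  proof (rule e_id)
    fix r assume "m - k < r" "r \<le> m"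
    then show "z i j s \<noteq> z i j r" using zz[of s r] s by auto
  qed
  have e_image: "y \<in> e k ` A \<longleftrightarrow>
      (\<exists>s. m - k < s \<and> s \<le> m \<and> y = park s) \<or> y \<in> A \<and> \<not> (\<exists>s. m - k < s \<and> s \<le> m \<and> y = z i j s)" for y k
  proof
    assume "y \<in> e k ` A"
    then obtain v where v: "v \<in> A" "y = e k v" by blast
    show "(\<exists>s. m - k < s \<and> s \<le> m \<and> y = park s) \<or> y \<in> A \<and> \<not> (\<exists>s. m - k < s \<and> s \<le> m \<and> y = z i j s)"
    proof (cases "\<exists>s. m - k < s \<and> s \<le> m \<and> v = z i j s")
      case True
      then obtain s where s: "m - k < s" "s \<le> m" "v = z i j s" by blast
      then have "y = park s" using e_park[OF s(1,2)] v(2) by simp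
      then show ?thesis using s(1,2) by blast
    next
      case False
      have "e k v = v" by (rule e_id) (use False in blast)
      then have "y = v" using v(2) by simp
      then show ?thesis using v(1) False by blast
    qed
  next
    assume "(\<exists>s. m - k < s \<and> s \<le> m \<and> y = park s) \<or> y \<in> A \<and> \<not> (\<exists>s. m - k < s \<and> s \<le> m \<and> y = z i j s)"
    then show "y \<in> e k ` A"
    proof
      assume "\<exists>s. m - k < s \<and> s \<le> m \<and> y = park s"
      then obtain s where s: "m - k < s" "s \<le> m" "y = park s" by blast
      then show ?thesis using e_park[OF s(1,2)] imageI[OF zA[of s], of "e k"] by simp
    next
      assume y: "y \<in> A \<and> \<not> (\<exists>s. m - k < s \<and> s \<le> m \<and> y = z i j s)"
      have "e k y = y" by (rule e_id) (use y in blast)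
      then show ?thesis using imageI[of y A "e k"] y by simp
    qed
  qed
  have free: "a \<notin> e k ` A" "b \<notin> e k ` A" for k
    unfolding e_image using a(2) b(2) park(2) by blast+
  have ez: "z i j r \<notin> e k ` A" if r: "m - k < r" "r \<le> m" for k r
  proof
    assume "z i j r \<in> e k ` A"
    then consider s where "s \<le> m" "z i j r = park s"
      | "\<not> (\<exists>s. m - k < s \<and> s \<le> m \<and> z i j r = z i j s)" unfolding e_image by blast
    then show False
    proof cases
      case (1 s)
      then show ?thesis using pz[of s r] r by simp
    next
      case 2
      then show ?thesis using r by blast
    qed
  qed
  have ep: "park r \<notin> e k ` A" if r: "r \<le> m - k" for k r
  proof
    assume "park r \<in> e k ` A"
    moreover have "park r \<notin> A" using park(2)[of r] r by simp
    ultimately obtain s where "m - k < s" "s \<le> m" "park r = park s" unfolding e_image by blast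
    then show False using pp[of r s] r by simp
  qed
  have reach: "tm_reach V E k A (e k)" if "k \<le> m" for k
    using that
  proof (induction k)
    case 0
    show ?case by (rule tm_reach_0) (rule e_id, simp)
  next
    case (Suc k)
    let ?B = "e k ` A" let ?s = "m - k"
    have s: "?s \<le> m" "?s \<noteq> 0" "m - Suc k < ?s" using Suc.prems by auto
    have step: "tm_reach V E 1 ?B (\<lambda>y. if y = z i j ?s then park ?s else y)"
    proof (rule tm_reach_1[where s = "z i j ?s" and t = "park ?s"])
      show "z i j ?s \<in> ?B"
        using e_z[of ?s k] imageI[OF zA[of ?s], of "e k"] by simp
      show "park ?s \<notin> ?B" by (rule ep) simp
      show "z i j ?s \<in> V" using ij by (intro z_in_V) auto
      show "park ?s \<in> V" using park(2) s by simp
      have "(z i j ?s, z i j m) \<in> (free_step V E ?B)\<^sup>*"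
        by (rule chain_up[OF ij]) (use ez in auto)
      also have "(z i j m, a) \<in> (free_step V E ?B)\<^sup>*"
        by (intro r_into_rtrancl free_stepI edge_chain_candI ij a aV free)
      also have "(a, park ?s) \<in> (free_step V E ?B)\<^sup>*"
        using park(2)[OF s(1)] ep[of ?s k] by (intro r_into_rtrancl free_stepI) simp_all
      finally show "(z i j ?s, park ?s) \<in> (free_step V E ?B)\<^sup>*" .
    qed simp
    have "e (Suc k) v = (if e k v = z i j ?s then park ?s else e k v)" if "v \<in> A" for v
    proof (cases "\<exists>r. m - Suc k < r \<and> r \<le> m \<and> v = z i j r")
      case True
      then obtain r where r: "m - Suc k < r" "r \<le> m" "v = z i j r" by blast
      show ?thesis
      proof (cases "r = ?s")
        case True
        then show ?thesis using r e_park[of "Suc k" r] e_z[of r k] by simp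
      next
        case False
        then have "m - k < r" using r by simp
        then show ?thesis using r e_park[of "Suc k" r] e_park[of k r] pz[of r ?s] by simp
      qed
    next
      case False
      then have "v \<noteq> z i j ?s" using s by blast
      moreover have "e k v = v" by (rule e_id) (use False in auto)
      moreover have "e (Suc k) v = v" by (rule e_id) (use False in auto)
      ultimately show ?thesis by simp
    qed
    from tm_reach_trans[OF Suc.IH step this] Suc.prems show ?case by simp
  qed
  define B where "B = e m ` A"
  have zB: "z i j s \<notin> B" if "0 < s" "s \<le> m" for s unfolding B_def by (rule ez) (use that in auto)
  have endsB: "z i j 0 \<in> B" "z i j (Suc m) \<in> B"
    using e_z[of 0 m] e_z[of "Suc m" m] imageI[OF zA[of 0], of "e m"] imageI[OF zA[of "Suc m"], of "e m"]
    unfolding B_def by simp_all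
  have pB: "park 0 \<notin> B" unfolding B_def by (rule ep) simp
  have abB: "a \<notin> B" "b \<notin> B" unfolding B_def by (rule free)+
  have pz0: "park 0 \<noteq> z i j s" if "s \<le> Suc m" for s using pz[of 0 s] that by simp
  have p0: "park 0 \<in> V" "park 0 \<noteq> a" "park 0 \<noteq> b" "{a, park 0} \<in> E" "{b, park 0} \<in> E"
    using park(2)[of 0] by auto
  \<comment> \<open>The token of \<open>z i j (Suc m)\<close> steps aside over \<open>b\<close>, the
    token of \<open>z i j 0\<close> runs along the empty path and over \<open>a\<close> and
    \<open>b\<close> to the other end, and the parked token enters the path over
    \<open>a\<close>.\<close>
  let ?f1 = "\<lambda>y. if y = z i j (Suc m) then park 0 else y"
  let ?f2 = "\<lambda>y. if y = z i j 0 then z i j (Suc m) else y"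
  let ?f3 = "\<lambda>y. if y = park 0 then z i j 0 else y"
  have e0: "z i j (Suc m) \<noteq> z i j 0" using zz by simp
  have 1: "tm_reach V E 1 B ?f1"
  proof (rule tm_reach_1[where s = "z i j (Suc m)" and t = "park 0"])
    have "(z i j (Suc m), b) \<in> (free_step V E B)\<^sup>*"
      by (intro r_into_rtrancl free_stepI edge_endI ij b aV abB)
    also have "(b, park 0) \<in> (free_step V E B)\<^sup>*" by (intro r_into_rtrancl free_stepI p0 pB)
    finally show "(z i j (Suc m), park 0) \<in> (free_step V E B)\<^sup>*" .
    show "z i j (Suc m) \<in> V" by (rule z_in_V[OF ij]) simp
  qed (simp_all only: endsB p0 pB not_False_eq_True)
  define B1 where "B1 = ?f1 ` B"
  have B1: "y \<in> B1 \<longleftrightarrow> y = park 0 \<or> y \<in> B \<and> y \<noteq> z i j (Suc m)" for y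
    unfolding B1_def using endsB by auto
  have 2: "tm_reach V E 1 B1 ?f2"
  proof (rule tm_reach_1[where s = "z i j 0" and t = "z i j (Suc m)"])
    show "z i j 0 \<in> B1" using B1 endsB e0 by metis
    show n: "z i j (Suc m) \<notin> B1" using B1 pz0[of "Suc m"] by auto
    have "z i j r \<notin> B1" if "0 < r" "r \<le> m" for r using B1 zB[OF that] pz0[of r] that by auto
    then have "(z i j 0, z i j m) \<in> (free_step V E B1)\<^sup>*" using ij by (intro chain_up) auto
    also have "(z i j m, a) \<in> free_step V E B1"
      using ij a aV abB p0 B1 by (intro free_stepI edge_chain_candI) auto
    also have "(a, b) \<in> (free_step V E B1)\<^sup>*"
    proof (cases "a = b")
      case False
      then have "(a, b) \<in> free_step V E B1" using ab aV abB p0 B1 by (intro free_stepI) auto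
      then show ?thesis by blast
    qed simp
    also have "(b, z i j (Suc m)) \<in> free_step V E B1"
      using edge_endI[OF ij b(1,3)] n ij by (intro free_stepI z_in_V) (auto simp: insert_commute)
    finally show "(z i j 0, z i j (Suc m)) \<in> (free_step V E B1)\<^sup>*" .
  qed (use z_in_V ij in auto)
  define B2 where "B2 = ?f2 ` B1"
  have z0: "z i j 0 \<in> B1" using B1 endsB e0 by metis
  have B2: "y \<in> B2 \<longleftrightarrow> y = z i j (Suc m) \<or> y \<in> B1 \<and> y \<noteq> z i j 0" for y
    unfolding B2_def using z0 by auto
  have 3: "tm_reach V E 1 B2 ?f3"
  proof (rule tm_reach_1[where s = "park 0" and t = "z i j 0"])
    show "park 0 \<in> B2" using B2 B1 pz0[of 0] by auto
    show n: "z i j 0 \<notin> B2" using B2 e0 by auto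
    have zB2: "z i j r \<notin> B2" if "r \<le> m" for r
    proof (cases "r = 0")
      case False
      then show ?thesis using B2 B1 zB[of r] pz0[of r] zz[of r "Suc m"] that by auto
    qed (use n in simp)
    have aB2: "a \<notin> B2" using abB p0 B1 B2 az[of "Suc m"] by auto
    have "(park 0, a) \<in> free_step V E B2" using p0 aV aB2 by (intro free_stepI) (auto simp: insert_commute)
    also have "(a, z i j m) \<in> free_step V E B2"
      using edge_chain_candI[OF ij a(1,3)] zB2[of m] ij by (intro free_stepI z_in_V) (auto simp: insert_commute)
    also have "(z i j m, z i j 0) \<in> (free_step V E B2)\<^sup>*"
      using ij zB2 by (intro chain_down) auto
    finally show "(park 0, z i j 0) \<in> (free_step V E B2)\<^sup>*" by (rule trancl_into_rtrancl)
  qed (use z_in_V ij p0 in auto)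
  have 12: "tm_reach V E (1 + 1) B (\<lambda>y. ?f2 (?f1 y))"
    by (rule tm_reach_trans[OF 1 2[unfolded B1_def]]) simp
  have img: "(\<lambda>y. ?f2 (?f1 y)) ` B = B2" unfolding B2_def B1_def image_image ..
  have "tm_reach V E (1 + 1 + 1) B (swp i j)"
  proof (rule tm_reach_trans[OF 12])
    show "tm_reach V E 1 ((\<lambda>y. ?f2 (?f1 y)) ` B) ?f3" unfolding img by (rule 3)
    show "swp i j y = ?f3 (?f2 (?f1 y))" if "y \<in> B" for y
      using that pB pz0[of "Suc m"] pz0[of 0] e0 unfolding swp_def by auto
  qed
  then have swB: "tm_reach V E 3 (e m ` A) (swp i j)" unfolding B_def by (simp add: numeral_3_eq_3)
  have "tm_reach V E (m + 3 + m) A (swp i j)"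
  proof (rule tm_reach_conjugate[OF reach[OF order_refl] A(1) fin swB])
    show "swp i j ` A = A"
    proof (rule involution_image)
      show "swp i j y \<in> A" "swp i j (swp i j y) = y" if "y \<in> A" for y
        using that zA[of 0] zA[of "Suc m"] e0 unfolding swp_def by simp_all
    qed
    \<comment> \<open>Clearing moves only tokens strictly between the ends and the exchange only
      those on the ends, so the two commute.\<close>
    show "swp i j (e m v) = e m (swp i j v)" if "v \<in> A" for v
    proof (cases "\<exists>s. 0 < s \<and> s \<le> m \<and> v = z i j s")
      case True
      then obtain s where s: "0 < s" "s \<le> m" "v = z i j s" by blast
      have "swp i j v = v" using s zz[of s 0] zz[of s "Suc m"] unfolding swp_def by simp
      moreover have "swp i j (park s) = park s"
        using pz[of s 0] pz[of s "Suc m"] s unfolding swp_def by simp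
      moreover have "e m v = park s" using e_park[of m s] s by simp
      ultimately show ?thesis by simp
    next
      case False
      then have "e m v = v" by (intro e_id) auto
      moreover have "e m (z i j 0) = z i j 0" "e m (z i j (Suc m)) = z i j (Suc m)"
        by (rule e_z; simp)+
      ultimately show ?thesis unfolding swp_def by simp
    qed
  qed
  moreover have "m + 3 + m = 2 * m + 3" by simp
  ultimately show ?thesis by (simp only:)
qed

lemma clique_imp_yes:
  assumes x: "\<And>i. i < m \<Longrightarrow> x i < N \<and> col (x i) = i"
    and adj: "\<And>i j. i < m \<Longrightarrow> j < m \<Longrightarrow> i \<noteq> j \<Longrightarrow> adj (x i) (x j)"
  shows "lutm_yes (tm_instance N m col adj)"
proof -
  let ?A = "set S"
  define opn where "opn k v = (if v < N \<and> col v < k \<and> v = x (col v) then N + col v else v)" for k v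
  have xx: "x i = x j \<longleftrightarrow> i = j" if "i < m" "j < m" for i j using x that by metis
  have AV: "?A \<subseteq> V" using set_S by auto
  have hub: "N + h \<notin> ?A" if "h < m + 3" for h unfolding set_S using that by auto
  have xA: "x i \<in> ?A" if "i < m" for i using x[OF that] S_iff by blast
  have reach: "tm_reach V E k ?A (opn k)" if "k \<le> m" for k
    using that
  proof (induction k)
    case 0
    show ?case by (rule tm_reach_0) (simp add: opn_def)
  next
    case (Suc k)
    then have k: "k < m" by simp
    let ?B = "opn k ` ?A"
    have n: "N + k \<notin> ?B"
    proof
      assume "N + k \<in> ?B"
      then obtain v where v: "v \<in> ?A" "N + k = opn k v" by blast
      then show False using hub[of k] k by (cases "v < N \<and> col v < k \<and> v = x (col v)") (auto simp: opn_def)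
    qed
    have step: "tm_reach V E 1 ?B (\<lambda>y. if y = x k then N + k else y)"
    proof (rule tm_reach_1[where s = "x k" and t = "N + k"])
      have "opn k (x k) = x k" using x[OF k] by (simp add: opn_def)
      then show "x k \<in> ?B" using xA[OF k] by force
      show "(x k, N + k) \<in> (free_step V E ?B)\<^sup>*"
        using n x[OF k] k by (intro r_into_rtrancl free_stepI edge_hubI N_in_V) auto
    qed (use n x[OF k] k in \<open>auto simp: tm_size_def\<close>)
    have "opn (Suc k) v = (if opn k v = x k then N + k else opn k v)" if "v \<in> ?A" for v
      using x[OF k] by (auto simp: opn_def less_Suc_eq)
    from tm_reach_trans[OF Suc.IH step this] Suc.prems show ?case by simp
  qed
  define X where "X = opn m ` ?A"
  have X_cases: "y \<in> ?A \<and> \<not> (\<exists>i<m. y = x i) \<or> (\<exists>h<m. y = N + h)" if y: "y \<in> X" for y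
  proof -
    obtain v where v: "v \<in> ?A" "y = opn m v" using y unfolding X_def by blast
    show ?thesis
    proof (cases "v < N \<and> col v < m \<and> v = x (col v)")
      case False
      then have "y = v" using v(2) unfolding opn_def by (simp only: if_False)
      moreover have "\<not> (\<exists>i<m. v = x i)" using False x by metis
      ultimately show ?thesis using v(1) by blast
    qed (use v(2) in \<open>auto simp: opn_def\<close>)
  qed
  have xX: "x i \<notin> X" if "i < m" for i using X_cases[of "x i"] x[OF that] that by auto
  have hX: "N + h \<notin> X" if "m \<le> h" "h < m + 3" for h using X_cases[of "N + h"] hub[of h] that by auto
  have zX: "z i j s \<in> X" if "i < m" "j < m" "s \<le> Suc m" for i j s
  proof -
    have "z i j s \<in> ?A" using S_iff that by blast
    moreover have "opn m (z i j s) = z i j s" by (simp add: opn_def)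
    ultimately show ?thesis unfolding X_def by force
  qed
  have XV: "X \<subseteq> V" using X_cases AV by (fastforce simp: tm_size_def)
  have swap: "tm_reach V E (2 * m + 3) X (swp i j)" if ij: "i < m" "j < m" for i j
  proof -
    \<comment> \<open>The parking places of this test: three hubs and the opened vertices of the
      other colours, at least \<open>3 + (m - 2)\<close> in total. The latter are adjacent to
      \<open>x i\<close> and \<open>x j\<close> because of the clique.\<close>
    let ?F = "{N + m..<N + m + 3} \<union> x ` ({..<m} - {i, j})"
    have "m + 1 \<le> card ?F"
    proof -
      have "card ?F = card {N + m..<N + m + 3} + card (x ` ({..<m} - {i, j}))"
        using x by (intro card_Un_disjoint) force+
      also have "card (x ` ({..<m} - {i, j})) = card ({..<m} - {i, j})"
        by (rule card_image) (use xx in \<open>auto simp: inj_on_def\<close>)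
      finally have "card ?F = 3 + card ({..<m} - {i, j})" by simp
      moreover have "card {..<m} - card {i, j} \<le> card ({..<m} - {i, j})"
        by (rule diff_card_le_card_Diff) simp
      moreover have "card {i, j} \<le> 2" by (simp add: card_insert_if)
      ultimately show ?thesis by simp
    qed
    then obtain D where D: "D \<subseteq> ?F" "card D = m + 1" by (meson obtain_subset_with_card_n)
    then have "finite D" by (intro card_ge_0_finite) simp
    then obtain park where park: "bij_betw park {0..<m + 1} D"
      using ex_bij_betw_nat_finite[of D] D(2) by auto
    show ?thesis
    proof (rule test_swap[OF ij XV, where a = "x i" and b = "x j" and park = park])
      show "z i j ` {..Suc m} \<subseteq> X" using zX ij by auto
      show "x i = x j \<or> {x i, x j} \<in> E"
        using x[OF ij(1)] x[OF ij(2)] adj[OF ij] xx[OF ij] edge_candI by metis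
      show "inj_on park {..m}"
        using park by (simp add: bij_betw_def atLeast0LessThan lessThan_Suc_atMost)
      fix s assume "s \<le> m"
      then have "s \<in> {0..<m + 1}" by simp
      then have "park s \<in> D" using bij_betwE[OF park] by blast
      then have "park s \<in> ?F" using D(1) by blast
      then show "park s \<in> V \<and> park s \<notin> X \<and> park s \<noteq> x i \<and> park s \<noteq> x j \<and>
        {x i, park s} \<in> E \<and> {x j, park s} \<in> E"
      proof
        assume s: "park s \<in> {N + m..<N + m + 3}"
        define h where "h = park s - N"
        have h: "park s = N + h" "m \<le> h" "h < m + 3" using s by (auto simp: h_def)
        show ?thesis
          unfolding h(1)
          using hX[OF h(2,3)] x[OF ij(1)] x[OF ij(2)] edge_hubI[OF _ h(3)] N_in_V[of "N + h"] h(3) by simp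
      next
        assume "park s \<in> x ` ({..<m} - {i, j})"
        then obtain l where l: "park s = x l" "l < m" "l \<noteq> i" "l \<noteq> j" by blast
        have "x l \<noteq> x i" "x l \<noteq> x j" using xx[OF l(2) ij(1)] xx[OF l(2) ij(2)] l by simp_all
        moreover have "adj (x i) (x l)" "adj (x j) (x l)" using adj ij l by metis+
        ultimately have "{x i, x l} \<in> E" "{x j, x l} \<in> E"
          using x[OF ij(1)] x[OF ij(2)] x[OF l(2)] edge_candI by metis+
        then show ?thesis
          unfolding l(1) using xX[OF l(2)] x[OF l(2)] \<open>x l \<noteq> x i\<close> \<open>x l \<noteq> x j\<close> N_in_V[of "x l"] by simp
      qed
    qed (use x[OF ij(1)] x[OF ij(2)] xX[OF ij(1)] xX[OF ij(2)] in simp_all)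
  qed
  \<comment> \<open>The arrangement once the tests in \<open>P\<close> are done. Different tests
    have different ends, so a further exchange leaves the finished ones intact.\<close>
  define g where "g P v = (if \<exists>(i, j)\<in>P. v = z i j 0 \<or> v = z i j (Suc m) then sw v else v)" for P v
  have all: "tm_reach V E (length ps * (2 * m + 3)) X (g (set ps)) \<and> g (set ps) ` X = X"
    if "distinct ps" "set ps \<subseteq> {..<m} \<times> {..<m}" for ps
    using that
  proof (induction ps)
    case Nil
    have "g {} = (\<lambda>v. v)" by (simp add: g_def fun_eq_iff)
    then show ?case by (simp add: tm_reach_0)
  next
    case (Cons p ps)
    obtain i j where p: "p = (i, j)" by fastforce
    with Cons.prems have ij: "i < m" "j < m" "(i, j) \<notin> set ps" and ps: "set ps \<subseteq> {..<m} \<times> {..<m}" by auto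
    have g: "g (set (p # ps)) v = swp i j (g (set ps) v)" for v
    proof (cases "\<exists>(i', j')\<in>set ps. v = z i' j' 0 \<or> v = z i' j' (Suc m)")
      case True
      then obtain i' j' where ij': "(i', j') \<in> set ps" "v = z i' j' 0 \<or> v = z i' j' (Suc m)" by blast
      then have "i' < m" "j' < m" "i' \<noteq> i \<or> j' \<noteq> j" using ps ij(3) by auto
      then have "swp i j (sw v) = sw v"
        using ij'(2) ij(1,2) by (elim disjE) (simp_all add: swp_def sw_z tflip_def)
      moreover have "g (set ps) v = sw v" unfolding g_def using True by (rule if_P)
      moreover have "g (set (p # ps)) v = sw v" unfolding g_def by (rule if_P) (use True in auto)
      ultimately show ?thesis by simp
    next
      case False
      then have 1: "g (set ps) v = v" unfolding g_def by (rule if_not_P)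
      have 2: "sw (z i j 0) = z i j (Suc m)" "sw (z i j (Suc m)) = z i j 0"
        by (simp_all add: sw_z tflip_def)
      have "g (set (p # ps)) v = swp i j v"
      proof (cases "v = z i j 0 \<or> v = z i j (Suc m)")
        case True
        then have "g (set (p # ps)) v = sw v" unfolding g_def p by (intro if_P) auto
        then show ?thesis using True 2 unfolding swp_def by auto
      next
        case no: False
        then have "g (set (p # ps)) v = v" unfolding g_def p using False by (intro if_not_P) auto
        then show ?thesis using no unfolding swp_def by simp
      qed
      then show ?thesis using 1 by simp
    qed
    have IH: "tm_reach V E (length ps * (2 * m + 3)) X (g (set ps))" "g (set ps) ` X = X"
      using Cons by auto
    have "tm_reach V E (length ps * (2 * m + 3) + (2 * m + 3)) X (g (set (p # ps)))"
      by (rule tm_reach_trans[OF IH(1), where g = "swp i j"]) (simp_all only: IH(2) swap[OF ij(1,2)] g)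
    moreover have "swp i j ` X = X"
    proof (rule involution_image)
      show "swp i j y \<in> X" "swp i j (swp i j y) = y" if "y \<in> X" for y
        using that zX[OF ij(1,2), of 0] zX[OF ij(1,2), of "Suc m"] ij(1,2) unfolding swp_def by simp_all
    qed
    then have "g (set (p # ps)) ` X = X" by (metis (no_types, lifting) g IH(2) image_cong image_image)
    ultimately show ?case by (simp add: add.commute add.left_commute)
  qed
  let ?ps = "List.product [0..<m] [0..<m]"
  have "tm_reach V E (m * m * (2 * m + 3)) X (g (set ?ps))"
    using all[of ?ps] by (simp add: distinct_product atLeast0LessThan)
  moreover have "g (set ?ps) v = sw v" if "v \<in> X" for v
  proof -
    have "v < N + (m + 3) \<or> (\<exists>i<m. \<exists>j<m. \<exists>s\<le>Suc m. v = z i j s)"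
      using X_cases[OF that] S_iff[of v] by auto
    then show ?thesis
    proof
      assume "v < N + (m + 3)"
      then show ?thesis by (simp add: g_def sw_less)
    next
      assume "\<exists>i<m. \<exists>j<m. \<exists>s\<le>Suc m. v = z i j s"
      then obtain i j s where "i < m" "j < m" "s \<le> Suc m" "v = z i j s" by blast
      then show ?thesis by (auto simp: g_def sw_z tflip_def)
    qed
  qed
  ultimately have "tm_reach V E (m * m * (2 * m + 3)) X sw"
    unfolding tm_reach_def by (metis (no_types, lifting))
  then have swX: "tm_reach V E (m * m * (2 * m + 3)) (opn m ` ?A) sw" unfolding X_def .
  have "tm_reach V E (m + m * m * (2 * m + 3) + m) ?A sw"
  proof (rule tm_reach_conjugate[OF reach[OF order_refl] AV _ swX])
    show "sw (opn m v) = opn m (sw v)" if v: "v \<in> ?A" for v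
    proof (cases "v < N")
      case True
      then have "opn m v < N + (m + 3)" using col_less[OF True] by (simp add: opn_def)
      then show ?thesis using True by (simp add: sw_less)
    next
      case False
      then obtain i j s where "i < m" "j < m" "s \<le> Suc m" "v = z i j s" using v S_iff by blast
      then show ?thesis by (simp add: opn_def sw_z)
    qed
  qed (use sw_image in auto)
  then obtain ms where ms: "length ms = m + m * m * (2 * m + 3) + m"
    "valid_sequence V E S ms" "\<forall>x\<in>set S. pos ms x = sw x" unfolding tm_reach_def by blast
  then have "map (pos ms) S = map sw S" by simp
  with ms show ?thesis
    by (auto simp: tm_instance_def transforming_sequence_def foldl_execute_move T_eq tm_bound_def
        intro!: exI[of _ ms])
qed

end

section \<open>Circuits of weft one\<close>

text \<open>Dynamic programming along the topological order: \<open>h\<close> receives the values of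
  all earlier nodes. Weft, depth and partial evaluation are all computed in this way, so one fold
  settles their complexity.\<close>

definition dyn :: "('a list \<Rightarrow> gate \<Rightarrow> 'a) \<Rightarrow> circuit \<Rightarrow> 'a list" where
  "dyn h C = fold (\<lambda>g vs. vs @ [h vs g]) C []"

lemma dyn_snoc: "dyn h (C @ [g]) = dyn h C @ [h (dyn h C) g]"
  by (simp add: dyn_def)

lemma length_dyn [simp]: "length (dyn h C) = length C"
  by (induction C rule: rev_induct) (simp_all add: dyn_snoc, simp add: dyn_def)

lemma nth_dyn: "i < length C \<Longrightarrow> dyn h C ! i = h (take i (dyn h C)) (C ! i)"
proof (induction C rule: rev_induct)
  case (snoc g C)
  then show ?case by (cases "i < length C") (auto simp: dyn_snoc nth_append less_Suc_eq)
qed simp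

lemma lk_take: "j < i \<Longrightarrow> i \<le> length vs \<Longrightarrow> lk d (take i vs) j = vs ! j"
  by (simp add: lk_def)

definition maxl :: "nat list \<Rightarrow> nat" where
  "maxl xs = fold max xs 0"

lemma maxl_le: "maxl xs \<le> e \<longleftrightarrow> (\<forall>x\<in>set xs. x \<le> e)"
proof -
  have "fold max xs a \<le> e \<longleftrightarrow> a \<le> e \<and> (\<forall>x\<in>set xs. x \<le> e)" for a
    by (induction xs arbitrary: a) auto
  then show ?thesis by (simp add: maxl_def)
qed

section \<open>Weft and depth as longest weighted paths\<close>

lemma wf_circuit_arg: "wf_circuit C \<Longrightarrow> i < length C \<Longrightarrow> j \<in> set (gate_args (C ! i)) \<Longrightarrow> j < i"
  and wf_circuit_args: "wf_circuit C \<Longrightarrow> i < length C \<Longrightarrow> C ! i \<noteq> Input \<Longrightarrow> gate_args (C ! i) \<noteq> []"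
  and wf_circuit_nonempty: "wf_circuit C \<Longrightarrow> C \<noteq> []"
  unfolding wf_circuit_def by blast+

text \<open>\<open>circuit_path\<close> with an arbitrary last node, as the induction over the nodes
  requires.\<close>

definition ipath :: "circuit \<Rightarrow> nat list \<Rightarrow> nat \<Rightarrow> bool" where
  "ipath C p i \<longleftrightarrow> p \<noteq> [] \<and> set p \<subseteq> {..<length C} \<and> C ! hd p = Input \<and> last p = i \<and>
    successively (\<lambda>i j. i \<in> set (gate_args (C ! j))) p"

lemma circuit_path_iff: "circuit_path C p \<longleftrightarrow> ipath C p (length C - 1)"
  by (simp add: circuit_path_def ipath_def)

lemma ipath_Input: "C ! i = Input \<Longrightarrow> i < length C \<Longrightarrow> ipath C p i \<longleftrightarrow> p = [i]"
proof (cases p rule: rev_cases)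
  case (snoc q j)
  then show "C ! i = Input \<Longrightarrow> i < length C \<Longrightarrow> ipath C p i \<longleftrightarrow> p = [i]"
    by (cases q rule: rev_cases) (auto simp: ipath_def successively_append_iff)
qed (simp add: ipath_def)

lemma ipath_noninput:
  assumes "C ! i \<noteq> Input" "i < length C"
  shows "ipath C p i \<longleftrightarrow> (\<exists>q j. p = q @ [i] \<and> j \<in> set (gate_args (C ! i)) \<and> ipath C q j)"
proof (cases p rule: rev_cases)
  case (snoc q j)
  then show ?thesis
    using assms
    by (cases q rule: rev_cases) (auto simp: ipath_def successively_append_iff hd_append split: if_splits)
qed (simp add: ipath_def)

text \<open>Going from gate to argument ends in an input, since every other gate has arguments with
  smaller numbers. Hence a bound on all paths to a node never holds vacuously.\<close>

lemma ex_ipath: "wf_circuit C \<Longrightarrow> i < length C \<Longrightarrow> \<exists>p. ipath C p i"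
proof (induction i rule: less_induct)
  case (less i)
  show ?case
  proof (cases "C ! i = Input")
    case False
    then obtain j where j: "j \<in> set (gate_args (C ! i))"
      using wf_circuit_args[OF less.prems] by (cases "gate_args (C ! i)") auto
    then have "j < i" using wf_circuit_arg less.prems by blast
    then obtain q where "ipath C q j" using less by fastforce
    then show ?thesis using ipath_noninput[OF False less.prems(2)] j by blast
  qed (use ipath_Input less.prems in blast)
qed

text \<open>Length of a longest path to each node, counting the gates with property
  \<open>P\<close>: \<open>large\<close> gives the weft and \<open>g \<noteq> Input\<close> the
  depth. The values are cut off at \<open>c\<close> because \<open>ptime_dyn\<close> asks for a
  constant bound.\<close>

definition pathc :: "(gate \<Rightarrow> bool) \<Rightarrow> nat \<Rightarrow> circuit \<Rightarrow> nat list" where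
  "pathc P c = dyn (\<lambda>vs g. let a = maxl (map (lk 0 vs) (gate_args g)) in
    if P g then min c (Suc a) else a)"

lemma nth_pathc:
  assumes "wf_circuit C" "i < length C"
  shows "pathc P c C ! i = (let a = maxl (map (\<lambda>j. pathc P c C ! j) (gate_args (C ! i))) in
    if P (C ! i) then min c (Suc a) else a)"
proof -
  have "map (lk 0 (take i (pathc P c C))) (gate_args (C ! i)) = map (\<lambda>j. pathc P c C ! j) (gate_args (C ! i))"
    using wf_circuit_arg[OF assms] assms by (auto simp: pathc_def intro!: lk_take)
  moreover have "pathc P c C ! i = (let a = maxl (map (lk 0 (take i (pathc P c C))) (gate_args (C ! i))) in
    if P (C ! i) then min c (Suc a) else a)"
    unfolding pathc_def by (rule nth_dyn[OF assms(2)])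
  ultimately show ?thesis by (simp only:)
qed

text \<open>A path to a gate is a path to one of its arguments followed by the gate, which matches
  the maximum in \<open>pathc\<close>. Because of the cut-off only thresholds below \<open>c\<close>
  are meaningful.\<close>

lemma pathc_le:
  assumes wf: "wf_circuit C" and P: "\<not> P Input"
  shows "e < c \<Longrightarrow> i < length C \<Longrightarrow>
    pathc P c C ! i \<le> e \<longleftrightarrow> (\<forall>p. ipath C p i \<longrightarrow> length (filter (\<lambda>j. P (C ! j)) p) \<le> e)"
proof (induction i arbitrary: e rule: less_induct)
  case (less i)
  let ?w = "\<lambda>p. length (filter (\<lambda>j. P (C ! j)) p)"
  show ?case
  proof (cases "C ! i = Input")
    case True
    then show ?thesis
      using P less.prems by (simp add: nth_pathc[OF wf] ipath_Input maxl_le)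
  next
    case False
    let ?a = "maxl (map (\<lambda>j. pathc P c C ! j) (gate_args (C ! i)))"
    have a: "?a \<le> e' \<longleftrightarrow> (\<forall>j\<in>set (gate_args (C ! i)). \<forall>q. ipath C q j \<longrightarrow> ?w q \<le> e')" if "e' < c" for e'
    proof -
      have "pathc P c C ! j \<le> e' \<longleftrightarrow> (\<forall>q. ipath C q j \<longrightarrow> ?w q \<le> e')" if "j \<in> set (gate_args (C ! i))" for j
        using less.IH[OF wf_circuit_arg[OF wf less.prems(2) that] \<open>e' < c\<close>]
          wf_circuit_arg[OF wf less.prems(2) that] less.prems(2) by simp
      then show ?thesis by (simp add: maxl_le)
    qed
    note ip = ipath_noninput[OF False less.prems(2)]
    show ?thesis
    proof (cases "P (C ! i)")
      case True
      have v: "pathc P c C ! i \<le> e \<longleftrightarrow> Suc ?a \<le> e"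
        using True less.prems by (simp add: nth_pathc[OF wf] Let_def min_def)
      show ?thesis
      proof (cases e)
        case 0
        obtain p where p: "ipath C p i" using ex_ipath[OF wf less.prems(2)] by blast
        then have "?w p \<noteq> 0" using ip True by auto
        then show ?thesis using v 0 p by auto
      next
        case (Suc e')
        then have "pathc P c C ! i \<le> e \<longleftrightarrow>
            (\<forall>j\<in>set (gate_args (C ! i)). \<forall>q. ipath C q j \<longrightarrow> ?w q \<le> e')"
          using v a[of e'] less.prems(1) by simp
        also have "\<dots> \<longleftrightarrow> (\<forall>p. ipath C p i \<longrightarrow> ?w p \<le> e)"
          unfolding ip using True Suc by fastforce
        finally show ?thesis .
      qed
    next
      case no: False
      then have v: "pathc P c C ! i \<le> e \<longleftrightarrow> ?a \<le> e"
        using less.prems by (simp add: nth_pathc[OF wf])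
      show ?thesis unfolding v a[OF less.prems(1)] ip using no by fastforce
    qed
  qed
qed

text \<open>An input has no arguments, so only the first node of a path can be one.\<close>

lemma ipath_depth:
  assumes "ipath C p i"
  shows "length (filter (\<lambda>j. C ! j \<noteq> Input) p) = length p - 1"
proof -
  obtain h q where p: "p = h # q" using assms by (cases p) (auto simp: ipath_def)
  have "successively (\<lambda>i j. i \<in> set (gate_args (C ! j))) (h # q) \<Longrightarrow> \<forall>j\<in>set q. C ! j \<noteq> Input" for h q
    by (induction q arbitrary: h) (auto simp: successively_Cons)
  then have "\<forall>j\<in>set q. C ! j \<noteq> Input" "C ! h = Input"
    using assms p by (auto simp: ipath_def)
  then show ?thesis using p by simp
qed

lemma depth_at_most_iff:
  assumes "wf_circuit C"
  shows "depth_at_most d C \<longleftrightarrow> pathc (\<lambda>g. g \<noteq> Input) (Suc d) C ! (length C - 1) \<le> d"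
  using wf_circuit_nonempty[OF assms]
  by (subst pathc_le[OF assms]) (auto simp: depth_at_most_def circuit_path_iff ipath_depth)

lemma not_large_Input [simp]: "\<not> large Input"
  by (simp add: large_def)

lemma weft_at_most_iff:
  assumes "wf_circuit C"
  shows "weft_at_most t C \<longleftrightarrow> pathc large (Suc t) C ! (length C - 1) \<le> t"
  using wf_circuit_nonempty[OF assms]
  by (subst pathc_le[OF assms]) (auto simp: weft_at_most_def circuit_path_iff)

section \<open>Evaluation under partial assignments and certificates\<close>

text \<open>
  Evaluation under a partial assignment \<open>a\<close>, with the truth values \<open>0\<close> (false), \<open>2\<close> (true) and \<open>1\<close>
  (unknown).  A large gate ignores unknown arguments, as if they were neutral.
\<close>

definition geval :: "nat \<Rightarrow> (nat \<Rightarrow> nat) \<Rightarrow> gate \<Rightarrow> nat" where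
  "geval x f g = (case g of
      Input \<Rightarrow> x
    | Neg j \<Rightarrow> 2 - f j
    | And js \<Rightarrow> if \<exists>j\<in>set js. f j = 0 then 0 else if large g \<or> (\<forall>j\<in>set js. f j = 2) then 2 else 1
    | Or js \<Rightarrow> if \<exists>j\<in>set js. f j = 2 then 2 else if large g \<or> (\<forall>j\<in>set js. f j = 0) then 0 else 1)"

lemma geval_cong: "(\<And>j. j \<in> set (gate_args g) \<Longrightarrow> f j = f' j) \<Longrightarrow> geval x f g = geval x f' g"
  by (cases g) (auto simp: geval_def)

definition peval :: "(nat \<Rightarrow> nat) \<Rightarrow> circuit \<Rightarrow> nat list" where
  "peval a = dyn (\<lambda>vs. geval (a (length vs)) (lk 0 vs))"

lemma nth_peval:
  assumes "wf_circuit C" "i < length C"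
  shows "peval a C ! i = geval (a i) (\<lambda>j. peval a C ! j) (C ! i)"
proof -
  have "peval a C ! i = geval (a i) (lk 0 (take i (peval a C))) (C ! i)"
    using nth_dyn[OF assms(2), where h = "\<lambda>vs. geval (a (length vs)) (lk 0 vs)"] assms(2)
    unfolding peval_def by simp
  also have "\<dots> = geval (a i) (\<lambda>j. peval a C ! j) (C ! i)"
    using wf_circuit_arg[OF assms] assms(2) by (intro geval_cong lk_take) (auto simp: peval_def)
  finally show ?thesis .
qed

definition tval :: "bool \<Rightarrow> nat" where
  "tval b = (if b then 2 else 0)"

definition approximates :: "(nat \<Rightarrow> nat) \<Rightarrow> circuit \<Rightarrow> (nat \<Rightarrow> bool) \<Rightarrow> bool" where
  "approximates a C v \<longleftrightarrow> (\<forall>i<length C. C ! i = Input \<longrightarrow> a i = 1 \<or> a i = tval (v i))"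

lemma valuationD:
  assumes "circuit_valuation C v" "i < length C"
  shows "C ! i = Neg j \<Longrightarrow> v i \<longleftrightarrow> \<not> v j"
    and "C ! i = And js \<Longrightarrow> v i \<longleftrightarrow> (\<forall>j\<in>set js. v j)"
    and "C ! i = Or js \<Longrightarrow> v i \<longleftrightarrow> (\<exists>j\<in>set js. v j)"
  using assms unfolding circuit_valuation_def by (auto split: gate.splits)

context
  fixes C :: circuit and v :: "nat \<Rightarrow> bool"
  assumes wf: "wf_circuit C" and val: "circuit_valuation C v"
begin

text \<open>No large gate lies below a node of weft zero, and on small gates the evaluation is
  Kleene's three-valued logic, in which an unknown argument never produces a wrong value.\<close>

lemma peval_sound:
  assumes a: "approximates a C v"
  shows "i < length C \<Longrightarrow> pathc large 2 C ! i = 0 \<Longrightarrow> peval a C ! i = 1 \<or> peval a C ! i = tval (v i)"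
proof (induction i rule: less_induct)
  case (less i)
  have nl: "\<not> large (C ! i)" and args0: "\<And>j. j \<in> set (gate_args (C ! i)) \<Longrightarrow> pathc large 2 C ! j = 0"
  proof -
    let ?a = "maxl (map (\<lambda>j. pathc large 2 C ! j) (gate_args (C ! i)))"
    have "(if large (C ! i) then min 2 (Suc ?a) else ?a) = 0"
      using nth_pathc[OF wf less.prems(1), of large 2] less.prems(2) unfolding Let_def by metis
    then have "\<not> large (C ! i)" "?a \<le> 0" by (simp_all split: if_splits)
    then show "\<not> large (C ! i)" "\<And>j. j \<in> set (gate_args (C ! i)) \<Longrightarrow> pathc large 2 C ! j = 0"
      unfolding maxl_le by auto
  qed
  have IH: "peval a C ! j = 1 \<or> peval a C ! j = tval (v j)" if "j \<in> set (gate_args (C ! i))" for j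
    using less.IH[of j] wf_circuit_arg[OF wf less.prems(1) that] args0[OF that] less.prems by auto
  then have IH0: "v j \<Longrightarrow> peval a C ! j \<noteq> 0" and IH2: "\<not> v j \<Longrightarrow> peval a C ! j \<noteq> 2"
    if "j \<in> set (gate_args (C ! i))" for j
    using that by (force simp: tval_def)+
  note vD = valuationD[OF val less.prems(1)]
  show ?case
  proof (cases "C ! i")
    case Input
    then show ?thesis using a less.prems by (simp add: nth_peval[OF wf] geval_def approximates_def)
  next
    case (Neg j)
    then show ?thesis using IH[of j] vD(1)[OF Neg] less.prems
      by (auto simp: nth_peval[OF wf] geval_def tval_def)
  next
    case (And js)
    then have e: "peval a C ! i = (if \<exists>j\<in>set js. peval a C ! j = 0 then 0
        else if \<forall>j\<in>set js. peval a C ! j = 2 then 2 else 1)"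
      using nl less.prems(1) by (simp add: nth_peval[OF wf, of i] geval_def)
    show ?thesis
    proof (cases "v i")
      case True
      then have "\<not> (\<exists>j\<in>set js. peval a C ! j = 0)" using IH0 vD(2)[OF And] And by auto
      then show ?thesis using e True by (auto simp: tval_def)
    next
      case False
      then have "\<not> (\<forall>j\<in>set js. peval a C ! j = 2)" using IH2 vD(2)[OF And] And by auto
      then show ?thesis using e False by (auto simp: tval_def)
    qed
  next
    case (Or js)
    then have e: "peval a C ! i = (if \<exists>j\<in>set js. peval a C ! j = 2 then 2
        else if \<forall>j\<in>set js. peval a C ! j = 0 then 0 else 1)"
      using nl less.prems(1) by (simp add: nth_peval[OF wf, of i] geval_def)
    show ?thesis
    proof (cases "v i")
      case False
      then have "\<not> (\<exists>j\<in>set js. peval a C ! j = 2)" using IH2 vD(3)[OF Or] Or by auto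
      then show ?thesis using e False by (auto simp: tval_def)
    next
      case True
      then have "\<not> (\<forall>j\<in>set js. peval a C ! j = 0)" using IH0 vD(3)[OF Or] Or by auto
      then show ?thesis using e True by (auto simp: tval_def)
    qed
  qed
qed

text \<open>
  In weft one the correct value of a gate is certified by boundedly many inputs: a large gate with
  the non-default value has one argument responsible for it, and with the default value it needs
  no certificate, since partial assignments never err on its arguments, which have weft zero.
\<close>

lemma peval_certificate:
  "i < length C \<Longrightarrow> pathc large 2 C ! i \<le> 1 \<Longrightarrow> pathc (\<lambda>g. g \<noteq> Input) (Suc d) C ! i \<le> d \<Longrightarrow>
    \<exists>W. W \<subseteq> {p. p < length C \<and> C ! p = Input} \<and> card W \<le> 2 ^ (pathc (\<lambda>g. g \<noteq> Input) (Suc d) C ! i) \<and>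
      (\<forall>a. approximates a C v \<longrightarrow> (\<forall>p\<in>W. a p \<noteq> 1) \<longrightarrow> peval a C ! i = tval (v i))"
proof (induction i rule: less_induct)
  case (less i)
  let ?D = "\<lambda>i. pathc (\<lambda>g. g \<noteq> Input) (Suc d) C ! i" and ?w = "\<lambda>i. pathc large 2 C ! i"
  let ?I = "{p. p < length C \<and> C ! p = Input}" and ?js = "gate_args (C ! i)"
  let ?cert = "\<lambda>W i. \<forall>a. approximates a C v \<longrightarrow> (\<forall>p\<in>W. a p \<noteq> 1) \<longrightarrow> peval a C ! i = tval (v i)"
  show ?case
  proof (cases "C ! i = Input")
    case True
    then show ?thesis using less.prems
      by (intro exI[of _ "{i}"]) (auto simp: nth_peval[OF wf] geval_def approximates_def)
  next
    case False
    have jI: "j < i" "j < length C" if "j \<in> set ?js" for j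
      using wf_circuit_arg[OF wf less.prems(1) that] less.prems(1) by auto
    have Dj: "?D j < ?D i" if "j \<in> set ?js" for j
    proof -
      let ?a = "maxl (map ?D ?js)"
      have "?D i = min (Suc d) (Suc ?a)"
        using False nth_pathc[OF wf less.prems(1), of "\<lambda>g. g \<noteq> Input" "Suc d"] by (simp add: Let_def)
      then have "?a < ?D i" using less.prems(3) by linarith
      moreover have "?D j \<le> ?a" using maxl_le[of "map ?D ?js" ?a] that by auto
      ultimately show ?thesis by simp
    qed
    let ?a = "maxl (map ?w ?js)"
    have wi: "?w i = (if large (C ! i) then min 2 (Suc ?a) else ?a)"
      using nth_pathc[OF wf less.prems(1), of large 2] by (simp add: Let_def)
    have wa: "?w j \<le> ?a" if "j \<in> set ?js" for j using maxl_le[of "map ?w ?js" ?a] that by auto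
    have "?a \<le> 1" using wi less.prems(2) by (auto split: if_splits)
    then have w1: "?w j \<le> 1" if "j \<in> set ?js" for j using wa[OF that] by simp
    define cert where "cert j W \<longleftrightarrow> W \<subseteq> ?I \<and> card W \<le> 2 ^ ?D j \<and> ?cert W j" for j W
    have "\<exists>W. cert j W" if "j \<in> set ?js" for j
    proof -
      have "?D j \<le> d" using Dj[OF that] less.prems(3) by simp
      then show ?thesis unfolding cert_def by (rule less.IH[OF jI[OF that] w1[OF that]])
    qed
    then obtain W where "\<forall>j\<in>set ?js. cert j (W j)"
      using bchoice[of "set ?js" cert] by blast
    then have W: "W j \<subseteq> ?I" "card (W j) \<le> 2 ^ ?D j" "?cert (W j) j" if "j \<in> set ?js" for j
      using that unfolding cert_def by simp_all
    \<comment> \<open>Depth strictly decreases towards the arguments, so a gate with two arguments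
      can afford the certificates of both.\<close>
    have pow: "2 * 2 ^ ?D j \<le> (2::nat) ^ ?D i" if "j \<in> set ?js" for j
      using power_increasing[of "Suc (?D j)" "?D i" "2::nat"] Dj[OF that] by simp
    show ?thesis
    proof (cases "large (C ! i)")
      case True
      then have "?a = 0" using wi less.prems(2) by simp
      then have w0: "?w j = 0" if "j \<in> set ?js" for j using wa[OF that] by simp
      have snd: "peval a C ! j = 1 \<or> peval a C ! j = tval (v j)" if "approximates a C v" "j \<in> set ?js" for a j
        using peval_sound[OF that(1) jI(2)[OF that(2)] w0[OF that(2)]] .
      have snd0: "v j \<Longrightarrow> peval a C ! j \<noteq> 0" and snd2: "\<not> v j \<Longrightarrow> peval a C ! j \<noteq> 2"
        if "approximates a C v" "j \<in> set ?js" for a j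
        using snd[OF that] by (auto simp: tval_def)
      have via: ?thesis if j: "j \<in> set ?js" "\<And>a. peval a C ! j = tval (v j) \<Longrightarrow> peval a C ! i = tval (v i)" for j
        using W[OF j(1)] pow[OF j(1)] j(2) by (intro exI[of _ "W j"]) auto
      have triv: ?thesis if "\<And>a. approximates a C v \<Longrightarrow> peval a C ! i = tval (v i)"
        using that by (intro exI[of _ "{}"]) auto
      show ?thesis
      proof (cases "C ! i")
        case (And js)
        note vD = valuationD(2)[OF val less.prems(1) And]
        show ?thesis
        proof (cases "v i")
          case v: True
          show ?thesis
            by (rule triv) (use snd0 snd2 And vD v True less.prems(1) in
              \<open>auto simp: nth_peval[OF wf, of i] geval_def tval_def\<close>)
        next
          case v: False
          then obtain j where j: "j \<in> set js" "\<not> v j" using vD by blast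
          show ?thesis
          proof (rule via)
            show "j \<in> set ?js" using j And by simp
            fix a
            assume "peval a C ! j = tval (v j)"
            then have "\<exists>j\<in>set js. peval a C ! j = 0" using j by (auto simp: tval_def)
            then show "peval a C ! i = tval (v i)"
              using v And less.prems(1) by (simp add: nth_peval[OF wf, of i] geval_def tval_def)
          qed
        qed
      next
        case (Or js)
        note vD = valuationD(3)[OF val less.prems(1) Or]
        show ?thesis
        proof (cases "v i")
          case v: False
          show ?thesis
            by (rule triv) (use snd0 snd2 Or vD v True less.prems(1) in
              \<open>auto simp: nth_peval[OF wf, of i] geval_def tval_def\<close>)
        next
          case v: True
          then obtain j where j: "j \<in> set js" "v j" using vD by blast
          show ?thesis
          proof (rule via)
            show "j \<in> set ?js" using j Or by simp
            fix a
            assume "peval a C ! j = tval (v j)"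
            then have "\<exists>j\<in>set js. peval a C ! j = 2" using j by (auto simp: tval_def)
            then show "peval a C ! i = tval (v i)"
              using v Or less.prems(1) by (simp add: nth_peval[OF wf, of i] geval_def tval_def)
          qed
        qed
      qed (use True False in \<open>simp_all add: large_def\<close>)
    next
      case nl: False
      let ?W = "\<Union>j\<in>set ?js. W j"
      have ne: "?js \<noteq> []" using wf_circuit_args[OF wf less.prems(1) False] .
      have "card ?W \<le> (\<Sum>j\<in>set ?js. card (W j))" by (rule card_UN_le) simp
      also have "\<dots> \<le> 2 ^ ?D i"
      proof -
        have l: "length ?js \<le> 2" using nl by (simp add: large_def)
        have "2 * (\<Sum>j\<in>set ?js. card (W j)) \<le> (\<Sum>j\<in>set ?js. 2 ^ ?D i)"
          unfolding sum_distrib_left using W(2) pow by (intro sum_mono) (meson mult_le_mono2 order_trans)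
        also have "\<dots> \<le> 2 * 2 ^ ?D i" using card_length[of ?js] l by simp
        finally show ?thesis by simp
      qed
      finally have card: "card ?W \<le> 2 ^ ?D i" .
      have "peval a C ! i = tval (v i)" if a: "approximates a C v" "\<forall>p\<in>?W. a p \<noteq> 1" for a
      proof -
        have e: "peval a C ! j = tval (v j)" if "j \<in> set ?js" for j using W(3)[OF that] a that by auto
        have "geval (a i) (\<lambda>j. peval a C ! j) (C ! i) = geval (a i) (\<lambda>j. tval (v j)) (C ! i)"
          by (rule geval_cong) (rule e)
        moreover have "geval (a i) (\<lambda>j. tval (v j)) (C ! i) = tval (v i)"
          using valuationD[OF val less.prems(1)] nl False ne
          by (cases "C ! i") (auto simp: geval_def tval_def)
        ultimately show ?thesis using nth_peval[OF wf less.prems(1)] by simp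
      qed
      moreover have "?W \<subseteq> ?I" using W(1) by blast
      ultimately show ?thesis using card by (intro exI[of _ ?W]) simp
    qed
  qed
qed

end

lemma valuation_extends:
  assumes wf: "wf_circuit C"
  shows "\<exists>v. circuit_valuation C v \<and> (\<forall>i<length C. C ! i = Input \<longrightarrow> v i = b i)"
proof -
  define h where "h = (\<lambda>vs g. case g of Input \<Rightarrow> b (length vs) | Neg j \<Rightarrow> \<not> lk False vs j
    | And js \<Rightarrow> \<forall>j\<in>set js. lk False vs j | Or js \<Rightarrow> \<exists>j\<in>set js. lk False vs j)"
  let ?v = "\<lambda>i. dyn h C ! i"
  have lk: "lk False (take i (dyn h C)) j = ?v j" if "i < length C" "j \<in> set (gate_args (C ! i))" for i j
    using wf_circuit_arg[OF wf that] that(1) by (simp add: lk_take)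
  have "circuit_valuation C ?v"
    unfolding circuit_valuation_def
  proof (intro allI impI)
    fix i assume i: "i < length C"
    show "case C ! i of Input \<Rightarrow> True | Neg j \<Rightarrow> ?v i \<longleftrightarrow> \<not> ?v j
      | And js \<Rightarrow> ?v i \<longleftrightarrow> (\<forall>j\<in>set js. ?v j) | Or js \<Rightarrow> ?v i \<longleftrightarrow> (\<exists>j\<in>set js. ?v j)"
      using nth_dyn[OF i, of h] lk[OF i] by (cases "C ! i") (auto simp: h_def)
  qed
  moreover have "\<forall>i<length C. C ! i = Input \<longrightarrow> ?v i = b i"
    by (auto simp: nth_dyn h_def)
  ultimately show ?thesis by blast
qed

subsection \<open>Gaps between true inputs\<close>

text \<open>
  Number the nodes of a circuit with \<open>n\<close> nodes from \<open>1\<close>, let \<open>y 1 < \<dots> < y k\<close> be the true inputs, \<open>y 0 = 0\<close>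
  and \<open>y (k + 1) = n + 1\<close>.  The gap \<open>(i, y i, y (i + 1))\<close> determines all inputs in \<open>[y i, y (i + 1))\<close>:
  only \<open>y i\<close> is true, unless \<open>i = 0\<close>.
\<close>

type_synonym gap = "nat \<times> nat \<times> nat"

text \<open>The default is a gate other than \<open>Input\<close>, so positions outside the circuit
  do not count as inputs.\<close>

definition is_input :: "circuit \<Rightarrow> nat \<Rightarrow> bool" where
  "is_input C p \<longleftrightarrow> lk (Neg 0) C p = Input"

lemma is_input_iff: "is_input C p \<longleftrightarrow> p < length C \<and> C ! p = Input"
  by (simp add: is_input_def lk_def)

text \<open>Only what a single gap can show, including both sentinels; how gaps fit together is left
  to \<open>compat\<close>.\<close>

definition gap_ok :: "circuit \<Rightarrow> nat \<Rightarrow> gap \<Rightarrow> bool" where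
  "gap_ok C k g \<longleftrightarrow> fst g \<le> k \<and> fst (snd g) < snd (snd g) \<and>
    (if fst g = 0 then fst (snd g) = 0 else 0 < fst (snd g) \<and> is_input C (fst (snd g) - 1)) \<and>
    (fst g = k \<longrightarrow> snd (snd g) = Suc (length C))"

definition follows :: "gap \<Rightarrow> gap \<Rightarrow> bool" where
  "follows g h \<longleftrightarrow> (fst h = Suc (fst g) \<longrightarrow> snd (snd g) = fst (snd h))"

text \<open>A condition on pairs, as edges of a graph demand. It suffices: gaps of all indices up to
  \<open>k\<close> that agree pairwise, on equal and on successive indices, fit together into one
  increasing sequence.\<close>

definition compat :: "gap \<Rightarrow> gap \<Rightarrow> bool" where
  "compat g h \<longleftrightarrow> (fst g = fst h \<longrightarrow> fst (snd g) = fst (snd h) \<and> snd (snd g) = snd (snd h)) \<and>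
    follows g h \<and> follows h g"

lemma compat_sym: "compat g h \<Longrightarrow> compat h g"
  by (simp add: compat_def)

lemma compat_eq: "compat g h \<Longrightarrow> fst g = fst h \<Longrightarrow> g = h"
  by (simp add: compat_def prod_eq_iff)

text \<open>Positions are shifted by one since nodes are numbered from 1 in gaps. A gap of index 0
  starts at 0, which is no \<open>Suc p\<close>, and so contributes no true input. Positions outside
  the given gaps stay unknown.\<close>

definition inp :: "gap list \<Rightarrow> nat \<Rightarrow> nat" where
  "inp gs p = (if \<exists>g\<in>set gs. fst (snd g) = Suc p then 2
    else if \<exists>g\<in>set gs. fst (snd g) \<le> Suc p \<and> Suc p < snd (snd g) then 0 else 1)"

definition ysys :: "circuit \<Rightarrow> nat \<Rightarrow> (nat \<Rightarrow> nat) \<Rightarrow> bool" where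
  "ysys C k y \<longleftrightarrow> y 0 = 0 \<and> y (Suc k) = Suc (length C) \<and> (\<forall>i\<le>k. y i < y (Suc i)) \<and>
    (\<forall>i. 0 < i \<longrightarrow> i \<le> k \<longrightarrow> is_input C (y i - 1))"

definition ytrue :: "nat \<Rightarrow> (nat \<Rightarrow> nat) \<Rightarrow> nat \<Rightarrow> bool" where
  "ytrue k y p \<longleftrightarrow> (\<exists>i. 0 < i \<and> i \<le> k \<and> y i = Suc p)"

definition gp :: "(nat \<Rightarrow> nat) \<Rightarrow> nat \<Rightarrow> gap" where
  "gp y i = (i, y i, y (Suc i))"

lemma gp_simps [simp]: "fst (gp y i) = i" "fst (snd (gp y i)) = y i" "snd (snd (gp y i)) = y (Suc i)"
  by (simp_all add: gp_def)

lemma ysys_less: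
  assumes "ysys C k y"
  shows "i < j \<Longrightarrow> j \<le> Suc k \<Longrightarrow> y i < y j"
proof (induction j)
  case (Suc j)
  have "y j < y (Suc j)" using assms Suc.prems unfolding ysys_def by simp
  then show ?case using Suc by (cases "i = j") auto
qed simp

lemma ysys_less_iff: "ysys C k y \<Longrightarrow> i \<le> Suc k \<Longrightarrow> j \<le> Suc k \<Longrightarrow> y i < y j \<longleftrightarrow> i < j"
  by (metis ysys_less linorder_neqE_nat not_less_iff_gr_or_eq)

lemma card_ytrue:
  assumes "ysys C k y"
  shows "card {p. p < length C \<and> C ! p = Input \<and> ytrue k y p} = k"
proof -
  have pos: "0 < y i" if "0 < i" "i \<le> k" for i
    using ysys_less[OF assms that(1)] that(2) by simp
  have "{p. p < length C \<and> C ! p = Input \<and> ytrue k y p} = (\<lambda>i. y i - 1) ` {1..k}" (is "?A = ?B")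
  proof
    show "?A \<subseteq> ?B"
    proof
      fix p
      assume "p \<in> ?A"
      then obtain i where "0 < i" "i \<le> k" "y i = Suc p" unfolding ytrue_def by blast
      then show "p \<in> ?B" by (intro image_eqI[of _ _ i]) auto
    qed
    show "?B \<subseteq> ?A"
    proof
      fix p
      assume "p \<in> ?B"
      then obtain i where "i \<in> {1..k}" "p = y i - 1" by blast
      then have "0 < i" "i \<le> k" "p = y i - 1" by simp_all
      then show "p \<in> ?A" using assms pos[of i] unfolding ysys_def ytrue_def is_input_iff by auto
    qed
  qed
  moreover have "inj_on (\<lambda>i. y i - 1) {1..k}"
  proof (rule inj_onI)
    fix i j
    assume *: "i \<in> {1..k}" "j \<in> {1..k}" "y i - 1 = y j - 1"
    then have "y i = y j" using pos[of i] pos[of j] by simp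
    then show "i = j" using * ysys_less_iff[OF assms, of i j] ysys_less_iff[OF assms, of j i] by simp
  qed
  ultimately show ?thesis by (simp add: card_image)
qed

text \<open>All gaps come from the same \<open>y\<close>: their starts other than \<open>y 0\<close>
  are true inputs, and no true input lies strictly between successive values of
  \<open>y\<close>.\<close>

lemma approximates_inp:
  assumes y: "ysys C k y" and gs: "\<And>g. g \<in> set gs \<Longrightarrow> \<exists>i\<le>k. g = gp y i"
    and v: "\<And>p. p < length C \<Longrightarrow> C ! p = Input \<Longrightarrow> v p = ytrue k y p"
  shows "approximates (inp gs) C v"
  unfolding approximates_def
proof (intro allI impI)
  fix p
  assume p: "p < length C" "C ! p = Input"
  show "inp gs p = 1 \<or> inp gs p = tval (v p)"
  proof (cases "\<exists>g\<in>set gs. fst (snd g) = Suc p")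
    case True
    then obtain g where g: "g \<in> set gs" "fst (snd g) = Suc p" by blast
    then obtain i where i: "i \<le> k" "y i = Suc p" using gs[OF g(1)] by auto
    moreover have "i \<noteq> 0" using y i(2) unfolding ysys_def by (metis nat.distinct(1))
    ultimately have "v p" using v[OF p] unfolding ytrue_def by auto
    then show ?thesis using True by (simp add: inp_def tval_def)
  next
    case no: False
    show ?thesis
    proof (cases "\<exists>g\<in>set gs. fst (snd g) \<le> Suc p \<and> Suc p < snd (snd g)")
      case True
      then obtain i where i: "i \<le> k" "y i \<le> Suc p" "Suc p < y (Suc i)" "gp y i \<in> set gs"
        using gs by fastforce
      have "y i \<noteq> Suc p" using no i(4) by force
      then have lt: "y i < Suc p" using i(2) by simp
      have "\<not> v p"
      proof
        assume "v p"
        then obtain j where j: "j \<le> k" "y j = Suc p" using v[OF p] unfolding ytrue_def by blast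
        then have "i < j" "j < Suc i"
          using ysys_less_iff[OF y, of i j] ysys_less_iff[OF y, of j "Suc i"] i lt by simp_all
        then show False by simp
      qed
      then show ?thesis using no True by (simp add: inp_def tval_def)
    qed (use no in \<open>auto simp: inp_def\<close>)
  qed
qed

lemma ysys_covers:
  assumes "ysys C k y" "p < length C"
  shows "\<exists>i\<le>k. y i \<le> Suc p \<and> Suc p < y (Suc i)"
proof -
  let ?P = "\<lambda>i. Suc p < y i"
  have "?P (Suc k)" using assms unfolding ysys_def by simp
  moreover have "\<not> ?P 0" using assms unfolding ysys_def by simp
  ultimately obtain i where "i < Suc k" "\<forall>j\<le>i. \<not> ?P j" "?P (Suc i)"
    using ex_least_nat_less[of ?P "Suc k"] by blast
  then show ?thesis by (intro exI[of _ i]) (auto simp: not_less)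
qed

lemma inp_resolved:
  assumes "gp y i \<in> set gs" "y i \<le> Suc p" "Suc p < y (Suc i)"
  shows "inp gs p \<noteq> 1"
proof -
  have "\<exists>g\<in>set gs. fst (snd g) \<le> Suc p \<and> Suc p < snd (snd g)"
    using assms by (intro bexI[of _ "gp y i"]) simp_all
  then show ?thesis by (simp add: inp_def)
qed

lemma gap_ok_gp: "ysys C k y \<Longrightarrow> i \<le> k \<Longrightarrow> gap_ok C k (gp y i)"
  using ysys_less[of C k y 0 i] unfolding gap_ok_def ysys_def by auto

lemma compat_gp: "compat (gp y i) (gp y j)"
  by (auto simp: compat_def follows_def)

lemma ysys_exists:
  assumes A: "A \<subseteq> {p. p < length C \<and> C ! p = Input}"
  obtains y where "ysys C (card A) y" "\<And>p. ytrue (card A) y p \<longleftrightarrow> p \<in> A"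
proof -
  have fin: "finite A" using A finite_subset by fastforce
  define xs where "xs = sorted_list_of_set A"
  have xs: "set xs = A" "length xs = card A" "sorted_wrt (<) xs"
    using fin by (simp_all add: xs_def)
  define y where "y i = (if i = 0 then 0 else if i \<le> card A then Suc (xs ! (i - 1)) else Suc (length C))" for i
  have nth: "xs ! i \<in> A" if "i < card A" for i using xs that nth_mem by metis
  then have nthC: "xs ! i < length C \<and> C ! (xs ! i) = Input" if "i < card A" for i using A that by blast
  show ?thesis
  proof (rule that)
    have "y i < y (Suc i)" if "i \<le> card A" for i
    proof (cases "i = 0 \<or> i = card A")
      case True
      then show ?thesis using nthC[of "i - 1"] by (auto simp: y_def)
    next
      case False
      then have "xs ! (i - 1) < xs ! i"
        using that xs(2,3) by (intro sorted_wrt_nth_less[OF xs(3)]) auto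
      then show ?thesis using False that by (simp add: y_def)
    qed
    then show "ysys C (card A) y"
      unfolding ysys_def is_input_iff using nthC by (auto simp: y_def)
    fix p
    show "ytrue (card A) y p \<longleftrightarrow> p \<in> A"
    proof
      assume "ytrue (card A) y p"
      then obtain i where "0 < i" "i \<le> card A" "y i = Suc p" unfolding ytrue_def by blast
      then show "p \<in> A" using nth[of "i - 1"] by (auto simp: y_def)
    next
      assume "p \<in> A"
      then obtain i where "i < card A" "xs ! i = p" using xs by (metis in_set_conv_nth)
      then show "ytrue (card A) y p" unfolding ytrue_def by (intro exI[of _ "Suc i"]) (simp add: y_def)
    qed
  qed
qed

text \<open>The indices of the first \<open>q\<close> gaps, as digits in base \<open>k + 1\<close>.\<close>

fun gcol :: "nat \<Rightarrow> nat \<Rightarrow> gap list \<Rightarrow> nat" where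
  "gcol 0 k gs = 0"
| "gcol (Suc q) k gs = fst (lk (0, 0, 0) gs 0) + Suc k * gcol q k (tl gs)"

lemma gcol_less: "\<forall>g\<in>set gs. fst g \<le> k \<Longrightarrow> gcol q k gs < Suc k ^ q"
proof (induction q arbitrary: gs)
  case (Suc q)
  have "\<forall>g\<in>set (tl gs). fst g \<le> k" using Suc.prems by (cases gs) auto
  then have "Suc (gcol q k (tl gs)) \<le> Suc k ^ q" using Suc.IH[of "tl gs"] by simp
  then have "Suc k * Suc (gcol q k (tl gs)) \<le> Suc k * Suc k ^ q" by (rule mult_le_mono2)
  moreover have "fst (lk (0, 0, 0) gs 0) \<le> k" using Suc.prems by (auto simp: lk_def)
  ultimately show ?case by simp
qed simp

text \<open>\<open>t\<close> consists of the base \<open>k + 1\<close> digits of the colour,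
  \<open>f\<close> turns a digit into any gap of that index, and \<open>hs\<close> stands for the
  further gaps, which do not influence the colour.\<close>

lemma gcol_surj:
  "c < Suc k ^ q \<Longrightarrow> \<exists>t. length t = q \<and> (\<forall>i\<in>set t. i \<le> k) \<and>
    (\<forall>f hs. (\<forall>i. fst (f i) = i) \<longrightarrow> gcol q k (map f t @ hs) = c)"
proof (induction q arbitrary: c)
  case (Suc q)
  have "c div Suc k < Suc k ^ q" using Suc.prems by (simp add: less_mult_imp_div_less mult.commute del: mult_Suc)
  then obtain t where t: "length t = q" "\<forall>i\<in>set t. i \<le> k"
    "\<And>f hs. (\<forall>i. fst (f i) = i) \<Longrightarrow> gcol q k (map f t @ hs) = c div Suc k" using Suc.IH by blast
  have "c mod Suc k \<le> k" using mod_less_divisor[of "Suc k" c] by simp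
  moreover have "gcol (Suc q) k (map f (c mod Suc k # t) @ hs) = c" if "\<forall>i. fst (f i) = i" for f hs
    using t(3)[OF that] that by (simp add: lk_def del: mult_Suc)
  ultimately show ?case using t(1,2) by (intro exI[of _ "c mod Suc k # t"]) auto
qed simp

lemma gcol_inj:
  "gcol q k gs = gcol q k hs \<Longrightarrow> \<forall>g\<in>set gs. fst g \<le> k \<Longrightarrow> \<forall>g\<in>set hs. fst g \<le> k \<Longrightarrow>
    q \<le> length gs \<Longrightarrow> q \<le> length hs \<Longrightarrow> map fst (take q gs) = map fst (take q hs)"
proof (induction q arbitrary: gs hs)
  case (Suc q)
  obtain g gs' h hs' where eq: "gs = g # gs'" "hs = h # hs'"
    using Suc.prems(4,5) by (cases gs; cases hs) auto
  have *: "fst g + Suc k * gcol q k gs' = fst h + Suc k * gcol q k hs'"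
    using Suc.prems(1) eq by (simp add: lk_def del: mult_Suc)
  have lt: "fst g < Suc k" "fst h < Suc k" using Suc.prems(2,3) eq by (simp_all add: less_Suc_eq_le)
  have dm: "(r + c * q) mod c = r" "(r + c * q) div c = q" if "r < c" for r c q :: nat
    using that by simp_all
  have "fst g = fst h" "gcol q k gs' = gcol q k hs'"
    using * dm[OF lt(1)] dm[OF lt(2)] by metis+
  then show ?case using Suc.IH[of gs' hs'] Suc.prems eq by simp
qed simp

section \<open>Candidates, and the equivalence of satisfiability and clique\<close>

definition gaps :: "circuit \<Rightarrow> nat \<Rightarrow> gap list" where
  "gaps C k = filter (gap_ok C k) (concat (map (\<lambda>i. concat (map (\<lambda>u. map (\<lambda>v. (i, u, v))
    [0..<length C + 2]) [0..<length C + 2])) [0..<Suc k]))"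

lemma in_set_triples: "(i, u, v) \<in> set (concat (map (\<lambda>i. concat (map (\<lambda>u. map (\<lambda>v. (i, u, v)) zs) ys)) xs))
    \<longleftrightarrow> i \<in> set xs \<and> u \<in> set ys \<and> v \<in> set zs"
  by auto

lemma in_gaps: "g \<in> set (gaps C k) \<longleftrightarrow>
    gap_ok C k g \<and> fst (snd g) < length C + 2 \<and> snd (snd g) < length C + 2"
proof (cases g)
  case (fields i u v)
  have "i \<le> k" if "gap_ok C k (i, u, v)" using that by (simp add: gap_ok_def)
  then show ?thesis unfolding fields gaps_def set_filter mem_Collect_eq in_set_triples
    by (auto simp only: set_upt atLeastLessThan_iff less_Suc_eq_le fst_conv snd_conv)
qed

definition cand_ok :: "circuit \<Rightarrow> gap list \<Rightarrow> bool" where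
  "cand_ok C gs \<longleftrightarrow> (\<forall>g\<in>set gs. \<forall>h\<in>set gs. compat g h) \<and> lk 0 (peval (inp gs) C) (length C - 1) = 2"

text \<open>
  The first \<open>q\<close> gaps of a candidate have the indices prescribed by its colour; the other \<open>q\<close> are free
  to be chosen such that they certify the output.
\<close>

definition cands :: "nat \<Rightarrow> circuit \<Rightarrow> nat \<Rightarrow> gap list list" where
  "cands q C k = filter (cand_ok C) (List.n_lists (2 * q) (gaps C k))"

definition cand_adj :: "gap list list \<Rightarrow> nat \<Rightarrow> nat \<Rightarrow> bool" where
  "cand_adj V a b \<longleftrightarrow> (\<forall>g\<in>set (lk [] V a). \<forall>h\<in>set (lk [] V b). compat g h)"

definition cand_instance :: "nat \<Rightarrow> circuit \<Rightarrow> nat \<Rightarrow> lutm_instance" where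
  "cand_instance q C k = tm_instance (length (cands q C k)) (Suc k ^ q)
    (\<lambda>a. gcol q k (lk [] (cands q C k) a)) (cand_adj (cands q C k))"

lemma in_cands: "gs \<in> set (cands q C k) \<longleftrightarrow> length gs = 2 * q \<and> set gs \<subseteq> set (gaps C k) \<and> cand_ok C gs"
  by (auto simp: cands_def set_n_lists)

lemma cand_mem: "a < length (cands q C k) \<Longrightarrow> lk [] (cands q C k) a \<in> set (cands q C k)"
  by (simp add: lk_def)

lemma gadget_cands: "gadget (length (cands q C k)) (Suc k ^ q)
    (\<lambda>a. gcol q k (lk [] (cands q C k) a)) (cand_adj (cands q C k))"
proof
  show "gcol q k (lk [] (cands q C k) a) < Suc k ^ q" if "a < length (cands q C k)" for a
  proof (rule gcol_less, rule ballI)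
    fix g
    assume "g \<in> set (lk [] (cands q C k) a)"
    then have "g \<in> set (gaps C k)" using cand_mem[OF that] in_cands by blast
    then show "fst g \<le> k" by (simp add: in_gaps gap_ok_def)
  qed
  show "cand_adj (cands q C k) a b \<Longrightarrow> cand_adj (cands q C k) b a" for a b
    unfolding cand_adj_def using compat_sym by blast
qed simp

lemma pad_list:
  assumes "finite W" "card W \<le> q"
  obtains ws where "length ws = q" "W \<subseteq> set ws" "set ws \<subseteq> insert z W"
proof -
  obtain xs where xs: "set xs = W" "distinct xs" using finite_distinct_list[OF assms(1)] by blast
  then have "length xs = card W" using distinct_card by fastforce
  then show ?thesis using xs assms(2) by (intro that[of "xs @ replicate (q - card W) z"]) auto
qed

context
  fixes C :: circuit and d k :: nat
  assumes wf: "wf_circuit C" and weft: "weft_at_most 1 C" and depth: "depth_at_most d C"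
begin

lemma output_certificate:
  assumes "circuit_valuation C v"
  obtains W where "W \<subseteq> {p. p < length C \<and> C ! p = Input}" "finite W" "card W \<le> 2 ^ d"
    "\<And>a. approximates a C v \<Longrightarrow> (\<And>p. p \<in> W \<Longrightarrow> a p \<noteq> 1) \<Longrightarrow>
      lk 0 (peval a C) (length C - 1) = tval (v (length C - 1))"
proof -
  let ?o = "length C - 1" let ?D = "pathc (\<lambda>g. g \<noteq> Input) (Suc d) C ! ?o"
  have o: "?o < length C" using wf_circuit_nonempty[OF wf] by simp
  have w: "pathc large 2 C ! ?o \<le> 1" using weft weft_at_most_iff[OF wf, of 1] by (simp add: numeral_2_eq_2)
  have D: "?D \<le> d" using depth depth_at_most_iff[OF wf] by simp
  from peval_certificate[OF wf assms o w D] obtain W where W: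
    "W \<subseteq> {p. p < length C \<and> C ! p = Input}" "card W \<le> 2 ^ ?D"
    "\<forall>a. approximates a C v \<longrightarrow> (\<forall>p\<in>W. a p \<noteq> 1) \<longrightarrow> peval a C ! ?o = tval (v ?o)" by blast
  have "lk 0 (peval a C) ?o = peval a C ! ?o" for a using o by (simp add: lk_def peval_def)
  moreover have "(2::nat) ^ ?D \<le> 2 ^ d" using D by (intro power_increasing) auto
  moreover have "finite W" using W(1) finite_subset by fastforce
  moreover have "card W \<le> 2 ^ d" using W(2) calculation(2) by (rule order_trans)
  ultimately show ?thesis using W(1,3) by (intro that[of W]) simp_all
qed

lemma satisfiable_imp_yes:
  assumes "weighted_satisfiable C k"
  shows "lutm_yes (cand_instance (2 ^ d) C k)"
proof -
  let ?q = "2 ^ d" let ?V = "cands ?q C k"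
  interpret gadget "length ?V" "Suc k ^ ?q" "\<lambda>a. gcol ?q k (lk [] ?V a)" "cand_adj ?V"
    by (rule gadget_cands)
  obtain v where v: "circuit_valuation C v" "v (length C - 1)"
    "card {i. i < length C \<and> C ! i = Input \<and> v i} = k"
    using assms unfolding weighted_satisfiable_def by blast
  let ?A = "{i. i < length C \<and> C ! i = Input \<and> v i}"
  obtain y where y: "ysys C k y" "\<And>p. ytrue k y p \<longleftrightarrow> p \<in> ?A"
    using ysys_exists[of ?A C] v(3) by auto
  obtain W where W: "W \<subseteq> {p. p < length C \<and> C ! p = Input}" "finite W" "card W \<le> ?q"
    "\<And>a. approximates a C v \<Longrightarrow> (\<And>p. p \<in> W \<Longrightarrow> a p \<noteq> 1) \<Longrightarrow>
      lk 0 (peval a C) (length C - 1) = tval (v (length C - 1))" using output_certificate[OF v(1)] by metis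
  have "\<forall>p\<in>W. \<exists>i. i \<le> k \<and> y i \<le> Suc p \<and> Suc p < y (Suc i)"
    using ysys_covers[OF y(1)] W(1) by blast
  then obtain ix where ix: "\<forall>p\<in>W. ix p \<le> k \<and> y (ix p) \<le> Suc p \<and> Suc p < y (Suc (ix p))"
    using bchoice[of W "\<lambda>p i. i \<le> k \<and> y i \<le> Suc p \<and> Suc p < y (Suc i)"] by blast
  have "card (ix ` W) \<le> ?q" using card_image_le[OF W(2), of ix] W(3) by simp
  then obtain ws where ws: "length ws = ?q" "ix ` W \<subseteq> set ws" "set ws \<subseteq> insert 0 (ix ` W)"
    using pad_list[of "ix ` W"] W(2) by blast
  \<comment> \<open>The second half is the same for all colours: the gaps that contain the
    certificate. So the output evaluates to true under each of these candidates.\<close>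
  define K where "K t = map (gp y) t @ map (gp y) ws" for t
  have gpK: "\<exists>i\<le>k. g = gp y i" if "g \<in> set (K t)" "\<forall>i\<in>set t. i \<le> k" for g t
  proof -
    have "\<forall>i\<in>set ws. i \<le> k" using ws(3) ix by blast
    then show ?thesis using that unfolding K_def by auto
  qed
  have compatK: "compat g h"
    if "g \<in> set (K t)" "h \<in> set (K t')" "\<forall>i\<in>set t. i \<le> k" "\<forall>i\<in>set t'. i \<le> k" for g h t t'
    using gpK[OF that(1,3)] gpK[OF that(2,4)] compat_gp by blast
  have K: "K t \<in> set ?V" if t: "length t = ?q" "\<forall>i\<in>set t. i \<le> k" for t
  proof -
    have "g \<in> set (gaps C k)" if g: "g \<in> set (K t)" for g
    proof -
      obtain i where i: "i \<le> k" "g = gp y i" using gpK[OF g t(2)] by blast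
      have "y i < length C + 2" "y (Suc i) < length C + 2"
        using ysys_less[OF y(1), of i "Suc k"] ysys_less[OF y(1), of "Suc i" "Suc k"] i(1) y(1)
        unfolding ysys_def by (cases "i = k"; simp)+
      then show ?thesis using i gap_ok_gp[OF y(1) i(1)] by (simp add: in_gaps)
    qed
    moreover have "lk 0 (peval (inp (K t)) C) (length C - 1) = tval (v (length C - 1))"
    proof (rule W(4))
      show "approximates (inp (K t)) C v"
        by (rule approximates_inp[OF y(1) gpK[OF _ t(2)]]) (use y(2) in auto)
      show "inp (K t) p \<noteq> 1" if "p \<in> W" for p
        using ws(2) ix that unfolding K_def by (intro inp_resolved[of y "ix p"]) auto
    qed
    moreover have "\<forall>g\<in>set (K t). \<forall>h\<in>set (K t). compat g h" using compatK t(2) by blast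
    moreover have "length (K t) = 2 * ?q" using t(1) ws(1) by (simp add: K_def)
    ultimately show ?thesis
      unfolding in_cands cand_ok_def using v(2) by (simp add: tval_def subset_iff)
  qed
  have "\<exists>t. length t = ?q \<and> (\<forall>i\<in>set t. i \<le> k) \<and> gcol ?q k (K t) = c" if "c < Suc k ^ ?q" for c
    using gcol_surj[OF that] unfolding K_def by (metis gp_simps(1))
  then obtain t where t: "length (t c) = ?q" "\<forall>i\<in>set (t c). i \<le> k" "gcol ?q k (K (t c)) = c"
    if "c < Suc k ^ ?q" for c by metis
  have "\<exists>a<length ?V. lk [] ?V a = K (t c)" if "c < Suc k ^ ?q" for c
    using K[OF t(1,2)[OF that]] by (auto simp: in_set_conv_nth lk_def)
  then obtain x where x: "x c < length ?V" "lk [] ?V (x c) = K (t c)" if "c < Suc k ^ ?q" for c by metis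
  show ?thesis
    unfolding cand_instance_def
  proof (rule clique_imp_yes)
    show "x i < length ?V \<and> gcol ?q k (lk [] ?V (x i)) = i" if "i < Suc k ^ ?q" for i
      using x[OF that] t[OF that] by simp
    show "cand_adj ?V (x i) (x j)" if "i < Suc k ^ ?q" "j < Suc k ^ ?q" for i j
      unfolding cand_adj_def x(2)[OF that(1)] x(2)[OF that(2)]
      using compatK t(2)[OF that(1)] t(2)[OF that(2)] by blast
  qed
qed

lemma yes_imp_satisfiable:
  assumes "lutm_yes (cand_instance (2 ^ d) C k)"
  shows "weighted_satisfiable C k"
proof -
  let ?q = "2 ^ d :: nat" let ?V = "cands ?q C k" let ?m = "Suc k ^ ?q"
  interpret gadget "length ?V" "?m" "\<lambda>a. gcol ?q k (lk [] ?V a)" "cand_adj ?V"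
    by (rule gadget_cands)
  obtain x where x: "\<forall>i<?m. x i < length ?V \<and> gcol ?q k (lk [] ?V (x i)) = i"
    "\<forall>i<?m. \<forall>j<?m. i \<noteq> j \<longrightarrow> cand_adj ?V (x i) (x j)"
    using yes_imp_clique[OF assms[unfolded cand_instance_def]] by blast
  \<comment> \<open>The colour with digits \<open>t\<close>. As \<open>gcol\<close> reads indices
    only, the ends of these gaps are dummies.\<close>
  define c where "c t = gcol ?q k (map (\<lambda>i. (i, 0, 0)) t)" for t
  define K where "K t = lk [] ?V (x (c t))" for t
  let ?T = "{t. length t = ?q \<and> (\<forall>i\<in>set t. i \<le> k)}"
  have c: "c t < ?m" if "t \<in> ?T" for t unfolding c_def using that by (intro gcol_less) auto
  have KV: "K t \<in> set ?V" if "t \<in> ?T" for t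
    unfolding K_def using x(1) c[OF that] by (intro cand_mem) simp
  have Kgap: "gap_ok C k g" if "g \<in> set (K t)" "t \<in> ?T" for g t
    using KV[OF that(2)] that(1) in_cands in_gaps by blast
  have Kfst: "fst ` set (take ?q (K t)) = set t" if t: "t \<in> ?T" for t
  proof -
    have "gcol ?q k (K t) = gcol ?q k (map (\<lambda>i. (i, 0, 0)) t)"
      using x(1) c[OF t] unfolding K_def c_def by simp
    then have "map fst (take ?q (K t)) = map fst (take ?q (map (\<lambda>i. (i, 0 :: nat, 0 :: nat)) t))"
    proof (rule gcol_inj)
      show "\<forall>g\<in>set (K t). fst g \<le> k" using Kgap t by (auto simp: gap_ok_def)
      show "?q \<le> length (K t)" using KV[OF t] in_cands by simp
    qed (use t in auto)
    then have "map fst (take ?q (K t)) = t" using t by (simp add: comp_def)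
    then show ?thesis by (metis list.set_map)
  qed
  have Kcompat: "compat g h" if "g \<in> set (K t)" "h \<in> set (K t')" "t \<in> ?T" "t' \<in> ?T" for g h t t'
  proof (cases "c t = c t'")
    case True
    then have "K t = K t'" by (simp add: K_def)
    then show ?thesis using KV[OF that(4)] that(1,2) in_cands cand_ok_def by metis
  next
    case False
    then have "cand_adj ?V (x (c t)) (x (c t'))" using x(2) c[OF that(3)] c[OF that(4)] by blast
    then show ?thesis using that(1,2) unfolding cand_adj_def K_def by blast
  qed
  define R where "R i p \<longleftrightarrow> snd p \<in> ?T \<and> fst p \<in> set (K (snd p)) \<and> fst (fst p) = i" for i p
  have "\<exists>p. R i p" if "i \<le> k" for i
  proof -
    \<comment> \<open>A constant tuple, nonempty as \<open>?q\<close> is a power of two, forces its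
      candidate to contain a gap of index \<open>i\<close>.\<close>
    have t: "replicate ?q i \<in> ?T" using that by simp
    have "i \<in> fst ` set (take ?q (K (replicate ?q i)))" using Kfst[OF t] by simp
    then obtain g where g: "g \<in> set (take ?q (K (replicate ?q i)))" "fst g = i" by blast
    have "R i (g, replicate ?q i)" unfolding R_def using t in_set_takeD[OF g(1)] g(2) by simp
    then show ?thesis by blast
  qed
  then have "\<forall>i\<in>{..k}. \<exists>p. R i p" by simp
  then obtain f where f: "\<forall>i\<in>{..k}. R i (f i)" using bchoice[of "{..k}" R] by blast
  define \<gamma> where "\<gamma> i = fst (f i)" for i
  have \<gamma>: "snd (f i) \<in> ?T" "\<gamma> i \<in> set (K (snd (f i)))" "fst (\<gamma> i) = i" if "i \<le> k" for i
    using f that unfolding \<gamma>_def R_def by simp_all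
  have uniq: "g = \<gamma> (fst g)" "fst g \<le> k" if "g \<in> set (K t)" "t \<in> ?T" for g t
  proof -
    show "fst g \<le> k" using Kgap[OF that] by (simp add: gap_ok_def)
    then show "g = \<gamma> (fst g)"
      using Kcompat[OF that(1) \<gamma>(2) that(2) \<gamma>(1)] \<gamma>(3) by (intro compat_eq) auto
  qed
  \<comment> \<open>The starts suffice: by compatibility each gap ends where the gap of the next
    index starts, and the last one ends at the sentinel.\<close>
  define y where "y i = (if i \<le> k then fst (snd (\<gamma> i)) else Suc (length C))" for i
  have \<gamma>_ok: "gap_ok C k (\<gamma> i)" if "i \<le> k" for i using Kgap \<gamma> that by blast
  have y_Suc: "snd (snd (\<gamma> i)) = y (Suc i)" if i: "i \<le> k" for i
  proof (cases "i = k")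
    case True
    then show ?thesis using \<gamma>_ok[OF i] \<gamma>(3)[OF i] by (simp add: y_def gap_ok_def)
  next
    case False
    then have Si: "Suc i \<le> k" using i by simp
    have "compat (\<gamma> i) (\<gamma> (Suc i))" using Kcompat \<gamma> i Si by blast
    then show ?thesis using \<gamma>(3)[OF i] \<gamma>(3)[OF Si] Si by (simp add: y_def compat_def follows_def)
  qed
  have \<gamma>_gp: "\<gamma> i = gp y i" if "i \<le> k" for i
    using y_Suc[OF that] \<gamma>(3)[OF that] that by (simp add: prod_eq_iff) (simp add: y_def)
  have ok: "gap_ok C k (gp y i)" if "i \<le> k" for i using \<gamma>_ok[OF that] \<gamma>_gp[OF that] by simp
  have y: "ysys C k y"
    unfolding ysys_def
  proof (intro conjI allI impI)
    show "y 0 = 0" using ok[of 0] by (simp add: gap_ok_def)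
    show "y (Suc k) = Suc (length C)" by (simp add: y_def)
    show "y i < y (Suc i)" if "i \<le> k" for i using ok[OF that] by (simp add: gap_ok_def)
    show "is_input C (y i - 1)" if "0 < i" "i \<le> k" for i using ok[OF that(2)] that(1) by (simp add: gap_ok_def)
  qed
  obtain v where v: "circuit_valuation C v" "\<forall>i<length C. C ! i = Input \<longrightarrow> v i = ytrue k y i"
    using valuation_extends[OF wf] by blast
  have "{i. i < length C \<and> C ! i = Input \<and> v i} = {p. p < length C \<and> C ! p = Input \<and> ytrue k y p}"
    using v(2) by auto
  then have card: "card {i. i < length C \<and> C ! i = Input \<and> v i} = k" using card_ytrue[OF y] by simp
  obtain W where W: "W \<subseteq> {p. p < length C \<and> C ! p = Input}" "finite W" "card W \<le> ?q"
    "\<And>a. approximates a C v \<Longrightarrow> (\<And>p. p \<in> W \<Longrightarrow> a p \<noteq> 1) \<Longrightarrow>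
      lk 0 (peval a C) (length C - 1) = tval (v (length C - 1))" using output_certificate[OF v(1)] by metis
  have "\<forall>p\<in>W. \<exists>i. i \<le> k \<and> y i \<le> Suc p \<and> Suc p < y (Suc i)"
    using ysys_covers[OF y] W(1) by blast
  then obtain ix where ix: "\<forall>p\<in>W. ix p \<le> k \<and> y (ix p) \<le> Suc p \<and> Suc p < y (Suc (ix p))"
    using bchoice[of W "\<lambda>p i. i \<le> k \<and> y i \<le> Suc p \<and> Suc p < y (Suc i)"] by blast
  have "card (ix ` W) \<le> ?q" using card_image_le[OF W(2), of ix] W(3) by simp
  then obtain t where t: "length t = ?q" "ix ` W \<subseteq> set t" "set t \<subseteq> insert 0 (ix ` W)"
    using pad_list[of "ix ` W"] W(2) by blast
  have T: "t \<in> ?T" using t ix by auto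
  \<comment> \<open>The gaps of \<open>K t\<close> settle every input in \<open>W\<close>, so the
    value 2 that made \<open>K t\<close> a candidate is the value of the output under
    \<open>v\<close>.\<close>
  have "lk 0 (peval (inp (K t)) C) (length C - 1) = tval (v (length C - 1))"
  proof (rule W(4))
    show "approximates (inp (K t)) C v"
    proof (rule approximates_inp[OF y])
      show "\<exists>i\<le>k. g = gp y i" if "g \<in> set (K t)" for g
        using uniq[OF that T] \<gamma>_gp[of "fst g"] by (intro exI[of _ "fst g"]) simp
    qed (use v(2) in auto)
    show "inp (K t) p \<noteq> 1" if p: "p \<in> W" for p
    proof -
      have "ix p \<in> fst ` set (take ?q (K t))" using Kfst[OF T] t(2) p by blast
      then obtain g where "g \<in> set (take ?q (K t))" and gi: "fst g = ix p" by auto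
      then have g: "g \<in> set (K t)" using in_set_takeD by fast
      have "g = gp y (ix p)" using uniq[OF g T] \<gamma>_gp[of "fst g"] gi by simp
      then have "gp y (ix p) \<in> set (K t)" using g by simp
      then show ?thesis using ix p by (intro inp_resolved[of y "ix p"]) auto
    qed
  qed
  moreover have "lk 0 (peval (inp (K t)) C) (length C - 1) = 2"
    using KV[OF T] by (simp add: in_cands cand_ok_def)
  ultimately have "v (length C - 1)" by (simp add: tval_def split: if_splits)
  then show ?thesis using v(1) card unfolding weighted_satisfiable_def by blast
qed

end

section \<open>The reduction is computable in polynomial time\<close>

lemma ptime_comp3:
  assumes "ptime (\<lambda>p. h (fst p) (fst (snd p)) (snd (snd p)))" "ptime f" "ptime g" "ptime l"
  shows "ptime (\<lambda>x. h (f x) (g x) (l x))"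
  using ptime_comp[OF assms(1) ptime_Pair[OF assms(2) ptime_Pair[OF assms(3,4)]]] by simp

lemma ptime_repr [ptime_intros]: "ptime f \<Longrightarrow> ptime (\<lambda>x. repr (f x))"
  by (rule ptime_comp[of repr], rule ptime_cast) simp_all

lemma ptime_reprD: "ptime (\<lambda>x. repr (f x)) \<Longrightarrow> ptime f"
  by (simp add: ptime_def)

definition kind :: "gate \<Rightarrow> nat" where
  "kind g = (case g of Input \<Rightarrow> 0 | Neg _ \<Rightarrow> 1 | And _ \<Rightarrow> 2 | Or _ \<Rightarrow> 3)"

lemma repr_gate: "repr g = Node (repr (kind g)) (case g of Input \<Rightarrow> Leaf | Neg j \<Rightarrow> repr j
    | And js \<Rightarrow> repr js | Or js \<Rightarrow> repr js)"
  by (cases g) (simp_all add: repr_gate_def kind_def repr_nat_def repr_list_def)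

lemma ptime_kind [ptime_intros]: "ptime f \<Longrightarrow> ptime (\<lambda>x. kind (f x))"
  by (rule ptime_comp[of kind], rule ptime_via[OF ptime_left]) (simp_all add: repr_gate)

lemma kind_eq [simp]: "kind g = 0 \<longleftrightarrow> g = Input"
  by (cases g) (simp_all add: kind_def)

text \<open>The second component of an encoded gate already is its encoded argument list, except for
  \<open>Neg\<close>, whose argument has to be wrapped. As the component has no uniform type, the
  computation is done on trees.\<close>

lemma ptime_gate_args [ptime_intros]: "ptime f \<Longrightarrow> ptime (\<lambda>x. gate_args (f x))"
proof (rule ptime_comp[of gate_args])
  have r: "ptime (\<lambda>g :: gate. right (repr g))"
    by (rule ptime_comp[OF ptime_right]) (intro ptime_intros)
  have "ptime (\<lambda>g :: gate. if kind g = 1 then repr [right (repr g)] else right (repr g))"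
    by (intro ptime_intros r)
  moreover have "repr (gate_args g) = (if kind g = 1 then repr [right (repr g)] else right (repr g))" for g
    by (cases g) (simp_all add: repr_gate kind_def)
  ultimately show "ptime gate_args" by (intro ptime_reprD[of gate_args]) simp
qed

lemma ptime_large [ptime_intros]: "ptime f \<Longrightarrow> ptime (\<lambda>x. large (f x))"
  unfolding large_def by (intro ptime_intros)

lemma ptime_maxl [ptime_intros]: "ptime f \<Longrightarrow> ptime (\<lambda>x. maxl (f x))"
proof (rule ptime_comp[of maxl])
  have "ptime (\<lambda>xs :: nat list. fold max xs 0)"
  proof (rule ptime_fold[where b = sz])
    show "sz (max y s) \<le> sz s + sz xs" if "y \<in> set xs" for xs s and y :: nat
      using sz_mem[OF that] by (simp add: sz_nat)
  qed (intro ptime_intros pbd_intros)+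
  then show "ptime maxl" by (simp add: maxl_def[abs_def])
qed

text \<open>The constant \<open>K\<close> keeps the list of values linear in the size of the
  circuit. It is provided by the cut-off in \<open>pathc\<close> and by the three truth values of
  \<open>peval\<close>.\<close>

lemma ptime_dyn:
  fixes h :: "'e::repr \<Rightarrow> nat list \<Rightarrow> gate \<Rightarrow> nat"
  assumes "ptime (\<lambda>p. h (fst p) (fst (snd p)) (snd (snd p)))" "ptime C"
    and K: "\<And>e D v. v \<in> set (dyn (h e) D) \<Longrightarrow> v \<le> K"
  shows "ptime (\<lambda>e. dyn (h e) (C e))"
  unfolding dyn_def
proof (rule ptime_fold_bounded[where B = "\<lambda>e. 1 + sz (C e) * (2 * K + 2)"])
  show "ptime (\<lambda>p. snd (snd p) @ [h (fst p) (snd (snd p)) (fst (snd p))])"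
    by (intro ptime_intros ptime_comp3[OF assms(1)])
  show "pbd (\<lambda>e. 1 + sz (C e) * (2 * K + 2))" by (intro pbd_intros ptime_sz assms)
  fix e ys zs
  assume eq: "C e = ys @ zs"
  have len: "sz vs \<le> 1 + length vs * (2 * K + 2)" if "\<forall>v\<in>set vs. v \<le> K" for vs :: "nat list"
    using that by (induction vs) (auto simp: sz_nat)
  have "sz (dyn (h e) ys) \<le> 1 + length ys * (2 * K + 2)"
    using len[of "dyn (h e) ys"] K by auto
  also have "\<dots> \<le> 1 + sz (C e) * (2 * K + 2)"
    using length_le_sz[of "C e"] eq by (intro add_left_mono mult_right_mono) simp_all
  finally show "sz (fold (\<lambda>g vs. vs @ [h e vs g]) ys []) \<le> 1 + sz (C e) * (2 * K + 2)"
    by (simp add: dyn_def)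
qed (intro ptime_intros assms)+

lemma lk_le: "(\<And>v. v \<in> set vs \<Longrightarrow> v \<le> K) \<Longrightarrow> lk 0 vs j \<le> (K :: nat)"
  by (simp add: lk_def)

lemma ptime_pathc [ptime_intros]:
  assumes "\<And>e. ptime (e :: circuit \<times> nat list \<times> gate \<Rightarrow> gate) \<Longrightarrow> ptime (\<lambda>x. P (e x))" "ptime f"
  shows "ptime (\<lambda>x. pathc P c (f x))"
proof (rule ptime_comp[of "pathc P c", OF _ assms(2)])
  let ?h = "\<lambda>vs g. let a = maxl (map (lk 0 vs) (gate_args g)) in if P g then min c (Suc a) else a"
  show "ptime (pathc P c)"
    unfolding pathc_def
  proof (rule ptime_dyn[where h = "\<lambda>_. ?h" and K = c])
    show "ptime (\<lambda>p :: circuit \<times> nat list \<times> gate. ?h (fst (snd p)) (snd (snd p)))"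
      unfolding Let_def by (intro ptime_intros assms(1))
    show "v \<le> c" if "v \<in> set (dyn ?h D)" for v D
      using that
    proof (induction D arbitrary: v rule: rev_induct)
      case (snoc g D)
      have "maxl (map (lk 0 (dyn ?h D)) (gate_args g)) \<le> c"
        unfolding maxl_le using lk_le[of "dyn ?h D" c] snoc.IH by auto
      then have "?h (dyn ?h D) g \<le> c" by (simp add: Let_def)
      then show ?case using snoc by (auto simp: dyn_snoc simp del: Let_def)
    qed (simp add: dyn_def)
  qed (rule ptime_id)
qed

lemma ptime_distinct [ptime_intros]: "ptime f \<Longrightarrow> ptime (\<lambda>x. distinct (f x :: nat list))"
proof (rule ptime_comp[of distinct])
  have "ptime (\<lambda>xs :: nat list. \<forall>i\<in>set [0..<length xs]. \<forall>j\<in>set [0..<length xs].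
      i = j \<or> lk 0 xs i \<noteq> lk 0 xs j)"
    by (intro ptime_intros)
  then show "ptime (distinct :: nat list \<Rightarrow> bool)"
    by (rule ptime_cong) (force simp: distinct_conv_nth lk_def)
qed

lemma ptime_wf_circuit [ptime_intros]: "ptime f \<Longrightarrow> ptime (\<lambda>x. wf_circuit (f x))"
proof (rule ptime_comp[of wf_circuit])
  have "ptime (\<lambda>C :: circuit. C \<noteq> [] \<and> (\<forall>i\<in>set [0..<length C].
      distinct (gate_args (lk Input C i)) \<and> (\<forall>j\<in>set (gate_args (lk Input C i)). j < i) \<and>
      (kind (lk Input C i) = 0 \<or> gate_args (lk Input C i) \<noteq> [])))"
    by (intro ptime_intros)
  then show "ptime wf_circuit"
    by (rule ptime_cong) (auto simp: wf_circuit_def lk_def)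
qed

lemma ptime_is_input [ptime_intros]: "ptime f \<Longrightarrow> ptime g \<Longrightarrow> ptime (\<lambda>x. is_input (f x) (g x))"
  unfolding is_input_def kind_eq[symmetric] by (intro ptime_intros)

lemma ptime_gap_ok [ptime_intros]:
  assumes "ptime f" "ptime g" "ptime h"
  shows "ptime (\<lambda>x. gap_ok (f x) (g x) (h x))"
  unfolding gap_ok_def by (intro ptime_intros assms)

lemma ptime_compat [ptime_intros]: "ptime f \<Longrightarrow> ptime g \<Longrightarrow> ptime (\<lambda>x. compat (f x) (g x))"
  unfolding compat_def follows_def by (intro ptime_intros)

lemma ptime_inp [ptime_intros]: "ptime f \<Longrightarrow> ptime g \<Longrightarrow> ptime (\<lambda>x. inp (f x) (g x))"
proof (rule ptime_comp2[of inp])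
  show "ptime (\<lambda>p. inp (fst p) (snd p))"
    unfolding inp_def by (intro ptime_intros)
qed

text \<open>Replaces the case distinction on gates by \<open>kind\<close> and
  \<open>gate_args\<close>, for which there are programs.\<close>

lemma geval_kind: "geval x f g = (if kind g = 0 then x else if kind g = 1 then 2 - f (lk 0 (gate_args g) 0)
    else if kind g = 2 then (if \<exists>j\<in>set (gate_args g). f j = 0 then 0
      else if large g \<or> (\<forall>j\<in>set (gate_args g). f j = 2) then 2 else 1)
    else (if \<exists>j\<in>set (gate_args g). f j = 2 then 2
      else if large g \<or> (\<forall>j\<in>set (gate_args g). f j = 0) then 0 else 1))"
  by (cases g) (auto simp: geval_def kind_def lk_def)

lemma ptime_peval_inp [ptime_intros]:
  "ptime f \<Longrightarrow> ptime g \<Longrightarrow> ptime (\<lambda>x. peval (inp (f x)) (g x))"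
proof (rule ptime_comp2[of "\<lambda>gs. peval (inp gs)"])
  let ?h = "\<lambda>(p :: gap list \<times> circuit) vs. geval (inp (fst p) (length vs)) (lk 0 vs)"
  show "ptime (\<lambda>p. peval (inp (fst p)) (snd p))"
    unfolding peval_def
  proof (rule ptime_dyn[where h = ?h and K = 2])
    show "ptime (\<lambda>p. ?h (fst p) (fst (snd p)) (snd (snd p)))"
      unfolding geval_kind by (intro ptime_intros)
    show "v \<le> 2" if "v \<in> set (dyn (?h e) D)" for v e D
      using that
      by (induction D rule: rev_induct) (auto simp: dyn_snoc geval_kind inp_def, simp add: dyn_def)
  qed (intro ptime_intros)
qed

lemma ptime_gcol [ptime_intros]:
  "ptime f \<Longrightarrow> ptime g \<Longrightarrow> ptime (\<lambda>x. gcol q (f x) (g x))"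
proof (induction q arbitrary: g)
  case (Suc q)
  show ?case unfolding gcol.simps by (intro ptime_intros Suc ptime_tl)
qed (simp add: ptime_const)

text \<open>\<open>n\<close> is fixed, so there is one program for every \<open>n\<close>, built by
  induction. The number of lists is the length of the argument to the power \<open>n\<close>, hence
  polynomial.\<close>

lemma ptime_n_lists [ptime_intros]: "ptime f \<Longrightarrow> ptime (\<lambda>x. List.n_lists n (f x))"
proof (rule ptime_comp[of "List.n_lists n"])
  show "ptime (List.n_lists n :: 'b list \<Rightarrow> _)"
  proof (induction n)
    case (Suc n)
    have "ptime (\<lambda>xs :: 'b list. concat (map (\<lambda>ys. map (\<lambda>y. y # ys) xs) (List.n_lists n xs)))"
      by (intro ptime_intros Suc)
    then show ?case by (rule ptime_cong) simp
  qed (simp add: ptime_const)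
qed

lemma ptime_gaps [ptime_intros]: "ptime f \<Longrightarrow> ptime g \<Longrightarrow> ptime (\<lambda>x. gaps (f x) (g x))"
proof (rule ptime_comp2[of gaps])
  show "ptime (\<lambda>p. gaps (fst p) (snd p))"
    unfolding gaps_def by (intro ptime_intros)
qed

lemma ptime_cands [ptime_intros]: "ptime f \<Longrightarrow> ptime g \<Longrightarrow> ptime (\<lambda>x. cands q (f x) (g x))"
proof (rule ptime_comp2[of "cands q"])
  show "ptime (\<lambda>p. cands q (fst p) (snd p))"
    unfolding cands_def cand_ok_def by (intro ptime_intros)
qed

lemma ptime_cand_adj [ptime_intros]:
  "ptime f \<Longrightarrow> ptime g \<Longrightarrow> ptime h \<Longrightarrow> ptime (\<lambda>x. cand_adj (f x) (g x) (h x))"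
proof (rule ptime_comp3[of cand_adj])
  show "ptime (\<lambda>p. cand_adj (fst p) (fst (snd p)) (snd (snd p)))"
    unfolding cand_adj_def by (intro ptime_intros)
qed

lemma ptime_cand_instance: "ptime (\<lambda>p. cand_instance q (fst p) (snd p))"
proof -
  let ?I = "\<lambda>V k. tm_instance (length V) (Suc k ^ q) (\<lambda>a. gcol q k (lk [] V a)) (cand_adj V)"
  have "ptime (\<lambda>p. ?I (fst p) (snd p))"
    unfolding tm_instance_def tm_size_def tm_edges_def tm_config_def tflip_def tm_bound_def tv_def
    by (intro ptime_intros)
  from ptime_comp2[OF this, of "\<lambda>p. cands q (fst p) (snd p)" snd] show ?thesis
    unfolding cand_instance_def by (simp add: ptime_cands ptime_fst ptime_snd ptime_id)
qed

section \<open>Recognition of the trees that encode circuits\<close>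

fun spine :: "data \<Rightarrow> data list" where
  "spine Leaf = []"
| "spine (Node a b) = a # spine b"

text \<open>Every tree is the encoding of the list of left subtrees along its right spine, so a copy
  is all that is needed.\<close>

lemma ptime_spine [ptime_intros]: "ptime f \<Longrightarrow> ptime (\<lambda>x. spine (f x))"
proof (rule ptime_comp[of spine], rule ptime_cast)
  show "repr (spine d) = repr d" for d by (induction d) auto
qed

lemma range_repr_list: "(\<exists>xs :: 'a::repr list. d = repr xs) \<longleftrightarrow> (\<forall>x\<in>set (spine d). \<exists>y :: 'a. x = repr y)"
proof (induction d)
  case (Node a b)
  have "(\<exists>xs :: 'a list. Node a b = repr xs) \<longleftrightarrow> (\<exists>(x :: 'a) xs. Node a b = repr (x # xs))"
    by (metis data.distinct(1) list.exhaust repr_simps(3))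
  then show ?case using Node by auto
qed (auto intro: exI[of _ "[]"])

text \<open>\<open>spine x = []\<close> expresses \<open>x = Leaf\<close> by functions already known
  to be polynomial.\<close>

definition is_nat :: "data \<Rightarrow> bool" where
  "is_nat d \<longleftrightarrow> (\<forall>x\<in>set (spine d). spine x = [])"

lemma spine_Nil: "spine d = [] \<longleftrightarrow> d = Leaf"
  by (cases d) auto

lemma range_repr_nat: "(\<exists>n :: nat. d = repr n) \<longleftrightarrow> is_nat d"
proof (induction d)
  case (Node a b)
  have "(\<exists>n :: nat. Node a b = repr n) \<longleftrightarrow> (\<exists>n :: nat. Node a b = repr (Suc n))"
    by (metis data.distinct(1) not0_implies_Suc repr_simps(1))
  then show ?case using Node by (auto simp: is_nat_def spine_Nil)
qed (auto simp: is_nat_def intro: exI[of _ 0])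

lemma length_spine_nat: "length (spine (repr (n :: nat))) = n"
  by (induction n) auto

definition is_gate :: "data \<Rightarrow> bool" where
  "is_gate d \<longleftrightarrow> spine d \<noteq> [] \<and> is_nat (left d) \<and> length (spine (left d)) \<le> 3 \<and>
    (if length (spine (left d)) = 0 then spine (right d) = []
     else if length (spine (left d)) = 1 then is_nat (right d)
     else \<forall>x\<in>set (spine (right d)). is_nat x)"

lemma range_repr_gate: "(\<exists>g :: gate. d = repr g) \<longleftrightarrow> is_gate d"
proof
  assume "\<exists>g :: gate. d = repr g"
  then obtain g :: gate where d: "d = repr g" by blast
  have "is_nat (repr n)" for n :: nat using range_repr_nat by blast
  moreover have "\<forall>x\<in>set (spine (repr js)). is_nat x" for js :: "nat list"
    using range_repr_list[of "repr js", where ?'a = nat] range_repr_nat by blast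
  moreover have "is_nat Leaf" "is_nat (Node Leaf Leaf)" by (simp_all add: is_nat_def)
  ultimately show "is_gate d"
    unfolding d repr_gate is_gate_def by (cases g) (simp_all add: length_spine_nat kind_def)
next
  assume g: "is_gate d"
  then obtain a b where d: "d = Node a b" by (cases d) (auto simp: is_gate_def)
  obtain n :: nat where n: "a = repr n" using g d range_repr_nat by (auto simp: is_gate_def)
  then have "n = 0 \<or> n = 1 \<or> n = 2 \<or> n = 3"
    using g unfolding is_gate_def d by (auto simp: length_spine_nat)
  then show "\<exists>g :: gate. d = repr g"
  proof (elim disjE)
    assume "n = 0"
    then have "d = repr Input" using g unfolding repr_gate is_gate_def d n by (simp add: kind_def spine_Nil)
    then show ?thesis by blast
  next
    assume n1: "n = 1"
    then obtain j :: nat where "b = repr j"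
      using g range_repr_nat[of b] unfolding is_gate_def d n by (auto simp: length_spine_nat)
    then have "d = repr (Neg j)" unfolding repr_gate d n n1 by (simp add: kind_def)
    then show ?thesis by blast
  next
    assume n2: "n = 2"
    then obtain js :: "nat list" where "b = repr js"
      using g range_repr_nat range_repr_list[of b, where ?'a = nat]
      unfolding is_gate_def d n by (auto simp: length_spine_nat)
    then have "d = repr (And js)" unfolding repr_gate d n n2 by (simp add: kind_def)
    then show ?thesis by blast
  next
    assume n3: "n = 3"
    then obtain js :: "nat list" where "b = repr js"
      using g range_repr_nat range_repr_list[of b, where ?'a = nat]
      unfolding is_gate_def d n by (auto simp: length_spine_nat)
    then have "d = repr (Or js)" unfolding repr_gate d n n3 by (simp add: kind_def)
    then show ?thesis by blast
  qed
qed

definition is_circuit :: "data \<Rightarrow> bool" where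
  "is_circuit d \<longleftrightarrow> (\<forall>x\<in>set (spine d). is_gate x)"

lemma range_repr_circuit: "is_circuit d \<longleftrightarrow> (\<exists>C :: circuit. d = repr C)"
  unfolding is_circuit_def range_repr_list range_repr_gate ..

lemma ptime_is_nat [ptime_intros]: "ptime f \<Longrightarrow> ptime (\<lambda>x. is_nat (f x))"
  unfolding is_nat_def by (intro ptime_intros)

lemma ptime_is_circuit [ptime_intros]: "ptime f \<Longrightarrow> ptime (\<lambda>x. is_circuit (f x))"
proof (rule ptime_comp[of is_circuit])
  have *: "ptime (\<lambda>x. left (f x))" "ptime (\<lambda>x. right (f x))" if "ptime f" for f :: "'c::repr \<Rightarrow> data"
    using ptime_comp[OF ptime_left that] ptime_comp[OF ptime_right that] .
  show "ptime is_circuit"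
    unfolding is_circuit_def is_gate_def by (intro ptime_intros *)
qed

text \<open>Arbitrary unless the argument encodes a circuit.\<close>

definition decode :: "data \<Rightarrow> circuit" where
  "decode d = (SOME C. repr C = d)"

lemma decode_repr: "decode (repr C) = C"
  unfolding decode_def using repr_inj by (intro some_equality) auto

lemma repr_decode: "is_circuit d \<Longrightarrow> repr (decode d) = d"
  using decode_repr range_repr_circuit by auto

definition red_param :: "nat \<Rightarrow> nat \<Rightarrow> nat" where
  "red_param q k = tm_bound (Suc k ^ q) + (Suc k ^ q + 3)"

text \<open>The limits on weft and depth belong to the language and have to be tested, through
  \<open>pathc\<close> since the original conditions quantify over all paths. \<open>Leaf\<close>
  encodes no instance and serves as the negative answer.\<close>

definition red_circuit :: "nat \<Rightarrow> circuit \<times> nat \<Rightarrow> data \<times> nat" where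
  "red_circuit d p = (if wf_circuit (fst p) \<and>
      pathc large 2 (fst p) ! (length (fst p) - 1) \<le> 1 \<and>
      pathc (\<lambda>g. g \<noteq> Input) (Suc d) (fst p) ! (length (fst p) - 1) \<le> d
    then (repr (cand_instance (2 ^ d) (fst p) (snd p)), red_param (2 ^ d) (snd p)) else (Leaf, 0))"

definition red :: "nat \<Rightarrow> data \<times> nat \<Rightarrow> data \<times> nat" where
  "red d p = (if is_circuit (fst p) then red_circuit d (decode (fst p), snd p) else (Leaf, 0))"

lemma ptime_red_param: "ptime f \<Longrightarrow> ptime (\<lambda>x. red_param q (f x))"
  unfolding red_param_def tm_bound_def by (intro ptime_intros)

lemma ptime_red_circuit: "ptime (red_circuit d)"
proof -
  let ?lk = "\<lambda>P c p. lk 0 (pathc P c (fst p)) (length (fst p) - 1)"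
  have "ptime (\<lambda>p :: circuit \<times> nat. if wf_circuit (fst p) \<and> ?lk large 2 p \<le> 1 \<and>
      ?lk (\<lambda>g. \<not> kind g = 0) (Suc d) p \<le> d
    then (repr (cand_instance (2 ^ d) (fst p) (snd p)), red_param (2 ^ d) (snd p)) else (Leaf, 0))"
    by (intro ptime_intros ptime_cand_instance ptime_red_param)
  moreover have "lk 0 (pathc P c C) (length C - 1) = pathc P c C ! (length C - 1)" if "wf_circuit C" for P c C
    using wf_circuit_nonempty[OF that] by (simp add: lk_def pathc_def)
  ultimately show ?thesis
    by (elim ptime_cong) (auto simp: red_circuit_def)
qed

lemma ptime_red: "ptime (red d)"
proof -
  have "ptime (\<lambda>p :: data \<times> nat. if is_circuit (fst p) then red_circuit d (decode (fst p), snd p) else (Leaf, 0))"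
  proof (rule ptime_If_decode[where d = "\<lambda>p. (decode (fst p), snd p)"])
    show "repr (decode (fst p), snd p) = repr p" if "is_circuit (fst p)" for p :: "data \<times> nat"
      using repr_decode[OF that] by (cases p) simp
  qed (intro ptime_intros ptime_red_circuit)+
  then show ?thesis unfolding red_def[abs_def] .
qed

lemma enc_lutm_repr: "enc_lutm I = repr I"
  by (simp add: enc_lutm_def repr_prod_def repr_list_def repr_nat_def)

lemma LUTM_iff: "(repr I, l) \<in> LUTM \<longleftrightarrow> lutm_wf I \<and> lutm_yes I \<and> l = lutm_param I"
  unfolding LUTM_def enc_lutm_repr using repr_inj by blast

lemma Leaf_notin_LUTM: "(Leaf, l) \<notin> LUTM"
proof
  assume "(Leaf, l) \<in> LUTM"
  then obtain I :: lutm_instance where "Leaf = repr I" unfolding LUTM_def enc_lutm_repr by blast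
  then show False by (cases I) simp
qed

lemma weighted_circuit_sat_iff: "(repr C, k) \<in> weighted_circuit_sat t d \<longleftrightarrow>
    wf_circuit C \<and> weft_at_most t C \<and> depth_at_most d C \<and> weighted_satisfiable C k"
proof -
  have "enc_list enc_gate = (repr :: circuit \<Rightarrow> data)" by (simp add: repr_list_def repr_gate_def[abs_def])
  then show ?thesis unfolding weighted_circuit_sat_def using repr_inj[of C] by auto
qed

lemma red_correct: "(x, k) \<in> weighted_circuit_sat 1 d \<longleftrightarrow> red d (x, k) \<in> LUTM"
proof (cases "is_circuit x")
  case False
  have "enc_list enc_gate = (repr :: circuit \<Rightarrow> data)" by (simp add: repr_list_def repr_gate_def[abs_def])
  then have "(x, k) \<notin> weighted_circuit_sat 1 d"
    using False unfolding weighted_circuit_sat_def range_repr_circuit by auto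
  then show ?thesis using False by (simp add: red_def Leaf_notin_LUTM)
next
  case True
  then obtain C :: circuit where x: "x = repr C" using range_repr_circuit by blast
  let ?ok = "wf_circuit C \<and> weft_at_most 1 C \<and> depth_at_most d C"
  have red: "red d (x, k) = (if ?ok then (repr (cand_instance (2 ^ d) C k), red_param (2 ^ d) k) else (Leaf, 0))"
    using True weft_at_most_iff[of C 1] depth_at_most_iff[of C d]
    by (auto simp: red_def red_circuit_def x decode_repr numeral_2_eq_2)
  show ?thesis
  proof (cases ?ok)
    case ok: True
    interpret gadget "length (cands (2 ^ d) C k)" "Suc k ^ 2 ^ d"
      "\<lambda>a. gcol (2 ^ d) k (lk [] (cands (2 ^ d) C k) a)" "cand_adj (cands (2 ^ d) C k)"
      by (rule gadget_cands)
    have "lutm_wf (cand_instance (2 ^ d) C k)" "lutm_param (cand_instance (2 ^ d) C k) = red_param (2 ^ d) k"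
      unfolding cand_instance_def red_param_def by (rule wf_instance, rule param_instance)
    moreover have "weighted_satisfiable C k \<longleftrightarrow> lutm_yes (cand_instance (2 ^ d) C k)"
      using satisfiable_imp_yes yes_imp_satisfiable ok by blast
    ultimately show ?thesis using ok unfolding red by (simp add: x weighted_circuit_sat_iff LUTM_iff)
  next
    case False
    then have "red d (x, k) = (Leaf, 0)" unfolding red by (rule if_not_P)
    then show ?thesis using False by (auto simp: x weighted_circuit_sat_iff Leaf_notin_LUTM)
  qed
qed

text \<open>The depth \<open>d\<close> comes with the problem \<open>A\<close>, so
  \<open>2 ^ d\<close> is a constant of the reduction, which makes the candidates polynomially many.
  Monotonicity of \<open>red_param\<close> is required because the first reduction only bounds the
  parameter of the circuit problem.\<close>

theorem theorem6: "W_hard 1 LUTM"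
  unfolding W_hard_def
proof
  fix A
  assume "A \<in> W_class 1"
  then obtain d where "fpt_reducible A (weighted_circuit_sat 1 d)" unfolding W_class_def by blast
  then show "fpt_reducible A LUTM"
  proof (rule fpt_reducible_ptime[where red = "red d" and G = "red_param (2 ^ d)"])
    show "mono (red_param (2 ^ d))"
      unfolding red_param_def tm_bound_def
      by (intro monoI add_mono mult_mono power_mono) auto
    show "snd (red d (x, k)) \<le> red_param (2 ^ d) k" for x k
      by (simp add: red_def red_circuit_def)
    show "ptime (red_param (2 ^ d))" by (intro ptime_red_param ptime_intros)
  qed (rule ptime_red red_correct)+
qed

end
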